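(* Suppose that $\sup_{z_1,z_2\in Z}V(z_1,z_2)\le\Omega_Z^2$. Suppose the parameters $\{\alpha_t\}_{t\ge1}$ and $\{\gamma_t\}_{t\ge1}$ (with $\gamma_t>0$) in the stochastic AMP method satisfy $\alpha_1=1$, $0\le\alpha_t<1$ for $t>1$, and, for some $q\in(0,1)$ and all $t\ge1$, $$q\mu-L_G\alpha_t\gamma_t-\frac{3L_H^2\gamma_t^2}{\mu}\ge0\qquad\text{and}\qquad\frac{\alpha_t}{\Gamma_t\gamma_t}\le\frac{\alpha_{t+1}}{\Gamma_{t+1}\gamma_{t+1}},$$ where $\Gamma_1=1$ and $\Gamma_t=(1-\alpha_t)\Gamma_{t-1}$ for $t>1$. Then: (a) Under the bounded variance assumption A1, for all $t\ge1$, $\mathbb E[g(w^{ag}_{t+1})]\le\mathcal Q_0(t)$, where $$\mathcal Q_0(t):=\frac{2\alpha_t}{\gamma_t}\Omega_Z^2+\left[4\sigma_H^2+\left(1+\frac1{2(1-q)}\right)\sigma_G^2\right]\Gamma_t\sum_{i=1}^t\frac{\alpha_i\gamma_i}{\mu\Gamma_i}.$$ (b) Under the light-tail assumption A2, for all $\lambda>0$ and $t\ge1$, $$\mathrm{Prob}\{g(w^{ag}_{t+1})>\mathcal Q_0(t)+\lambda\mathcal Q_1(t)\}\le2\exp\{-\lambda^2/3\}+3\exp\{-\lambda\},$$ where $$\mathcal Q_1(t):=\Gamma_t(\sigma_G+\sigma_H)\Omega_Z\sqrt{\frac2\mu\sum_{i=1}^t\left(\frac{\alpha_i}{\Gamm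a_i}\right)^2}+\left[4\sigma_H^2+\left(1+\frac1{2(1-q)}\right)\sigma_G^2\right]\Gamma_t\sum_{i=1}^t\frac{\alpha_i\gamma_i}{\mu\Gamma_i}.$$
   Context: Setting. $\mathcal E$ is a finite-dimensional real vector space with inner product $\langle\cdot,\cdot\rangle$ and a norm $\|\cdot\|$, with dual norm $\|\eta\|_*=\sup_{\|x\|\le1}\langle\eta,x\rangle$; $Z\subset\mathcal E$ is a nonempty closed convex set. $G$ is continuously differentiable with $0\le G(w)-G(v)-\langle\nabla G(v),w-v\rangle\le\frac{L_G}{2}\|w-v\|^2$ for all $w,v\in Z$. $H:Z\to\mathcal E$ satisfies $\langle H(w)-H(v),w-v\rangle\ge0$ and $\|H(w)-H(v)\|_*\le L_H\|w-v\|$ for all $w,v\in Z$. $J$ is a real-valued convex function on $Z$ having a subgradient $J'(u)\in\partial J(u)$ at each $u\in Z$. Prox-mapping. $\omega$ is a differentiable strongly convex function on $Z$ with convexity parameter $\mu>0$ with respect to $\|\cdot\|$; $V(z,u)=\omega(u)-\omega(z)-\langle\nabla\omega(z),u-z\rangle$ for $u,z\in Z$. For $z\in Z$, $\eta\in\mathcal E$, $\gamma>0$, $P_z^{\gamma J}(\eta)=\operatorname{argmin}_{u\in Z}\{\langle\eta,u-z\rangle+V(z,u)+\gamma J(u)\}$, assumed to be well defined. Stochastic oracles. At the $i$-th call with input $x\in Z$, oracles $\mathcal{SO}_G$ and $\mathcal{SO}_H$ return $\mathcal G(x,\xi_i)$ and $\mathcal H(x,\zeta_i)$, where all $\xi_i,\zeta_i$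 are independent random variables and $\mathbb E[\mathcal G(x,\xi_i)]=\nabla G(x)$, $\mathbb E[\mathcal H(x,\zeta_i)]=H(x)$. Assumption A1: $\mathbb E[\|\mathcal G(x,\xi_i)-\nabla G(x)\|_*^2]\le\sigma_G^2$ and $\mathbb E[\|\mathcal H(x,\zeta_i)-H(x)\|_*^2]\le\sigma_H^2$ for all $x\in Z$ and all $i$. Assumption A2: $\mathbb E[\exp\{\|\nabla G(x)-\mathcal G(x,\xi_i)\|_*^2/\sigma_G^2\}]\le\exp\{1\}$ and $\mathbb E[\exp\{\|H(x)-\mathcal H(x,\zeta_i)\|_*^2/\sigma_H^2\}]\le\exp\{1\}$ for all $x\in Z$ and all $i$. Stochastic AMP method. Choose $r_1\in Z$ and set $w_1=w_1^{ag}=r_1$. For $t=1,2,\ldots$: $w_t^{md}=(1-\alpha_t)w_t^{ag}+\alpha_tr_t$; $w_{t+1}=P_{r_t}^{\gamma_tJ}(\gamma_t\mathcal H(r_t,\zeta_{2t-1})+\gamma_t\mathcal G(w_t^{md},\xi_t))$; $r_{t+1}=P_{r_t}^{\gamma_tJ}(\gamma_t\mathcal H(w_{t+1},\zeta_{2t})+\gamma_t\mathcal G(w_t^{md},\xi_t))$ (same sample $\mathcal G(w_t^{md},\xi_t)$); $w_{t+1}^{ag}=(1-\alpha_t)w_t^{ag}+\alpha_tw_{t+1}$. Gap function. $Q(\tilde u,u)=G(\tilde u)-G(u)+\langle H(u),\tilde u-u\rangle+J(\tilde u)-J(u)$ for $\tilde u,u\in Z$, and $g(\tilde u)=\sup_{u\in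 Z}Q(\tilde u,u)$. *)

theory Defs
  imports "HOL-Probability.Probability"
begin

text \<open>The ambient space is a \<^class>\<open>euclidean_space\<close> with its inner product; the working norm
  is an arbitrary function \<open>nrm\<close>, unrelated to the type-class norm.\<close>

definition is_norm :: "('a::real_vector \<Rightarrow> real) \<Rightarrow> bool" where
  "is_norm nrm \<longleftrightarrow>
     (\<forall>x. 0 \<le> nrm x) \<and> (\<forall>x. nrm x = 0 \<longleftrightarrow> x = 0) \<and>
     (\<forall>c x. nrm (c *\<^sub>R x) = \<bar>c\<bar> * nrm x) \<and> (\<forall>x y. nrm (x + y) \<le> nrm x + nrm y)"

definition dual_norm :: "('a::real_inner \<Rightarrow> real) \<Rightarrow> 'a \<Rightarrow> real" where
  "dual_norm nrm \<eta> = (SUP x\<in>{x. nrm x \<le> 1}. \<eta> \<bullet> x)"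

text \<open>Gradients are relative to \<open>Z\<close>, since the functions only matter on \<open>Z\<close>. If \<open>Z\<close> has empty
  interior, \<open>f'\<close> is any one selection of gradients.\<close>

definition gradient_on :: "'a::real_inner set \<Rightarrow> ('a \<Rightarrow> real) \<Rightarrow> ('a \<Rightarrow> 'a) \<Rightarrow> bool" where
  "gradient_on Z f f' \<longleftrightarrow> (\<forall>x\<in>Z. (f has_derivative (\<lambda>h. f' x \<bullet> h)) (at x within Z))"

definition strongly_convex_on ::
    "('a::real_vector \<Rightarrow> real) \<Rightarrow> real \<Rightarrow> 'a set \<Rightarrow> ('a \<Rightarrow> real) \<Rightarrow> bool" where
  "strongly_convex_on nrm \<mu> Z f \<longleftrightarrow>
     (\<forall>x\<in>Z. \<forall>y\<in>Z. \<forall>s\<in>{0..1}.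
        f ((1 - s) *\<^sub>R x + s *\<^sub>R y)
          \<le> (1 - s) * f x + s * f y - \<mu> / 2 * s * (1 - s) * (nrm (x - y))\<^sup>2)"

definition subdifferential :: "'a::real_inner set \<Rightarrow> ('a \<Rightarrow> real) \<Rightarrow> 'a \<Rightarrow> 'a set" where
  "subdifferential Z J u = {p. \<forall>v\<in>Z. J u + p \<bullet> (v - u) \<le> J v}"

definition prox_fun :: "('a::real_inner \<Rightarrow> real) \<Rightarrow> ('a \<Rightarrow> 'a) \<Rightarrow> 'a \<Rightarrow> 'a \<Rightarrow> real" where
  "prox_fun \<omega> \<omega>' z u = \<omega> u - \<omega> z - \<omega>' z \<bullet> (u - z)"

definition prox_objective ::
    "('a::real_inner \<Rightarrow> real) \<Rightarrow> ('a \<Rightarrow> 'a) \<Rightarrow> ('a \<Rightarrow> real) \<Rightarrow> real \<Rightarrow> 'a \<Rightarrow> 'a \<Rightarrow> 'a \<Rightarrow> real" where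
  "prox_objective \<omega> \<omega>' J \<gamma> z \<eta> u = \<eta> \<bullet> (u - z) + prox_fun \<omega> \<omega>' z u + \<gamma> * J u"

definition prox_map ::
    "'a::real_inner set \<Rightarrow> ('a \<Rightarrow> real) \<Rightarrow> ('a \<Rightarrow> 'a) \<Rightarrow> ('a \<Rightarrow> real) \<Rightarrow> real \<Rightarrow> 'a \<Rightarrow> 'a \<Rightarrow> 'a" where
  "prox_map Z \<omega> \<omega>' J \<gamma> z \<eta> = arg_min_on (prox_objective \<omega> \<omega>' J \<gamma> z \<eta>) Z"

definition prox_well_defined ::
    "'a::real_inner set \<Rightarrow> ('a \<Rightarrow> real) \<Rightarrow> ('a \<Rightarrow> 'a) \<Rightarrow> ('a \<Rightarrow> real) \<Rightarrow> bool" where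
  "prox_well_defined Z \<omega> \<omega>' J \<longleftrightarrow>
     (\<forall>z\<in>Z. \<forall>\<eta>. \<forall>\<gamma>>0. \<exists>!u. is_arg_min (prox_objective \<omega> \<omega>' J \<gamma> z \<eta>) (\<lambda>u. u \<in> Z) u)"

text \<open>An oracle \<open>Fs\<close> for \<open>F\<close>, called with the samples \<open>\<xi> 1, \<xi> 2, \<dots>\<close> (index 0 is unused).
  Joint measurability makes the iterates random variables. Each moment condition
  asserts integrability explicitly because the Bochner integral of a non-integrable
  function is 0.\<close>

definition unbiased_oracle ::
    "'s measure \<Rightarrow> 'v measure \<Rightarrow> 'a::euclidean_space set \<Rightarrow> ('a \<Rightarrow> 'a) \<Rightarrow> ('a \<Rightarrow> 'v \<Rightarrow> 'a)
      \<Rightarrow> (nat \<Rightarrow> 's \<Rightarrow> 'v) \<Rightarrow> bool" where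
  "unbiased_oracle M N Z F Fs \<xi> \<longleftrightarrow>
     (\<lambda>(x, v). Fs x v) \<in> borel_measurable (restrict_space borel Z \<Otimes>\<^sub>M N) \<and>
     (\<forall>i\<ge>1. \<xi> i \<in> measurable M N) \<and>
     (\<forall>x\<in>Z. \<forall>i\<ge>1. integrable M (\<lambda>s. Fs x (\<xi> i s)) \<and> (\<integral>s. Fs x (\<xi> i s) \<partial>M) = F x)"

definition bounded_variance ::
    "'s measure \<Rightarrow> ('a::euclidean_space \<Rightarrow> real) \<Rightarrow> 'a set \<Rightarrow> ('a \<Rightarrow> 'a) \<Rightarrow> ('a \<Rightarrow> 'v \<Rightarrow> 'a)
      \<Rightarrow> (nat \<Rightarrow> 's \<Rightarrow> 'v) \<Rightarrow> real \<Rightarrow> bool" where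
  "bounded_variance M nrm Z F Fs \<xi> \<sigma> \<longleftrightarrow>
     (\<forall>x\<in>Z. \<forall>i\<ge>1.
        integrable M (\<lambda>s. (dual_norm nrm (Fs x (\<xi> i s) - F x))\<^sup>2) \<and>
        (\<integral>s. (dual_norm nrm (Fs x (\<xi> i s) - F x))\<^sup>2 \<partial>M) \<le> \<sigma>\<^sup>2)"

text \<open>Positivity of \<open>\<sigma>\<close> gives the quotient its meaning: with \<open>\<sigma> = 0\<close> the bound would hold
  vacuously, as division by 0 yields 0.\<close>

definition light_tail ::
    "'s measure \<Rightarrow> ('a::euclidean_space \<Rightarrow> real) \<Rightarrow> 'a set \<Rightarrow> ('a \<Rightarrow> 'a) \<Rightarrow> ('a \<Rightarrow> 'v \<Rightarrow> 'a)
      \<Rightarrow> (nat \<Rightarrow> 's \<Rightarrow> 'v) \<Rightarrow> real \<Rightarrow> bool" where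
  "light_tail M nrm Z F Fs \<xi> \<sigma> \<longleftrightarrow> 0 < \<sigma> \<and>
     (\<forall>x\<in>Z. \<forall>i\<ge>1.
        integrable M (\<lambda>s. exp ((dual_norm nrm (F x - Fs x (\<xi> i s)))\<^sup>2 / \<sigma>\<^sup>2)) \<and>
        (\<integral>s. exp ((dual_norm nrm (F x - Fs x (\<xi> i s)))\<^sup>2 / \<sigma>\<^sup>2) \<partial>M) \<le> exp 1)"

text \<open>Mutual independence of the whole family \<open>\<xi> 1, \<zeta> 1, \<xi> 2, \<zeta> 2, \<dots>\<close>. This is
  \<^const>\<open>prob_space.indep_vars\<close> unfolded, because the two kinds of samples may have
  different types.\<close>

definition samples_independent ::
    "'s measure \<Rightarrow> 'v measure \<Rightarrow> (nat \<Rightarrow> 's \<Rightarrow> 'v) \<Rightarrow> 'w measure \<Rightarrow> (nat \<Rightarrow> 's \<Rightarrow> 'w) \<Rightarrow> bool" where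
  "samples_independent M N\<^sub>1 \<xi> N\<^sub>2 \<zeta> \<longleftrightarrow>
     prob_space.indep_sets M
       (\<lambda>k. case k of
          Inl i \<Rightarrow> {\<xi> i -` A \<inter> space M | A. A \<in> sets N\<^sub>1}
        | Inr i \<Rightarrow> {\<zeta> i -` A \<inter> space M | A. A \<in> sets N\<^sub>2})
       ({1..} <+> {1..})"

definition gap_Q ::
    "('a::real_inner \<Rightarrow> real) \<Rightarrow> ('a \<Rightarrow> 'a) \<Rightarrow> ('a \<Rightarrow> real) \<Rightarrow> 'a \<Rightarrow> 'a \<Rightarrow> real" where
  "gap_Q G H J v u = G v - G u + H u \<bullet> (v - u) + J v - J u"

text \<open>The real supremum is the genuine one whenever \<open>Z\<close> is bounded (as it is when the prox-function is
  bounded on \<open>Z\<close>), \<open>G\<close> and \<open>H\<close> are continuous, and \<open>J\<close> has a subgradient: then \<open>gap_Q G H J v\<close> is bounded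
  above on \<open>Z\<close>.\<close>

definition gap_fun ::
    "'a::real_inner set \<Rightarrow> ('a \<Rightarrow> real) \<Rightarrow> ('a \<Rightarrow> 'a) \<Rightarrow> ('a \<Rightarrow> real) \<Rightarrow> 'a \<Rightarrow> real" where
  "gap_fun Z G H J v = (SUP u\<in>Z. gap_Q G H J v u)"

definition amp_noise ::
    "(nat \<Rightarrow> real) \<Rightarrow> (nat \<Rightarrow> real) \<Rightarrow> (nat \<Rightarrow> real) \<Rightarrow> real \<Rightarrow> real \<Rightarrow> real \<Rightarrow> real \<Rightarrow> nat \<Rightarrow> real" where
  "amp_noise \<alpha> \<gamma> \<Gamma> \<mu> q \<sigma>\<^sub>G \<sigma>\<^sub>H t =
     (4 * \<sigma>\<^sub>H\<^sup>2 + (1 + 1 / (2 * (1 - q))) * \<sigma>\<^sub>G\<^sup>2) * \<Gamma> t * (\<Sum>i=1..t. \<alpha> i * \<gamma> i / (\<mu> * \<Gamma> i))"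

definition amp_Q0 ::
    "(nat \<Rightarrow> real) \<Rightarrow> (nat \<Rightarrow> real) \<Rightarrow> (nat \<Rightarrow> real) \<Rightarrow> real \<Rightarrow> real \<Rightarrow> real \<Rightarrow> real \<Rightarrow> real \<Rightarrow> nat \<Rightarrow> real" where
  "amp_Q0 \<alpha> \<gamma> \<Gamma> \<mu> q \<sigma>\<^sub>G \<sigma>\<^sub>H \<Omega> t = 2 * \<alpha> t / \<gamma> t * \<Omega>\<^sup>2 + amp_noise \<alpha> \<gamma> \<Gamma> \<mu> q \<sigma>\<^sub>G \<sigma>\<^sub>H t"

definition amp_Q1 ::
    "(nat \<Rightarrow> real) \<Rightarrow> (nat \<Rightarrow> real) \<Rightarrow> (nat \<Rightarrow> real) \<Rightarrow> real \<Rightarrow> real \<Rightarrow> real \<Rightarrow> real \<Rightarrow> real \<Rightarrow> nat \<Rightarrow> real" where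
  "amp_Q1 \<alpha> \<gamma> \<Gamma> \<mu> q \<sigma>\<^sub>G \<sigma>\<^sub>H \<Omega> t =
     \<Gamma> t * (\<sigma>\<^sub>G + \<sigma>\<^sub>H) * \<Omega> * sqrt (2 / \<mu> * (\<Sum>i=1..t. (\<alpha> i / \<Gamma> i)\<^sup>2))
       + amp_noise \<alpha> \<gamma> \<Gamma> \<mu> q \<sigma>\<^sub>G \<sigma>\<^sub>H t"

end

theory Submission
  imports Defs
begin

text \<open>The two prox steps of an iteration share the prox centre \<open>r t\<close>; combining their optimality conditions
  with the smoothness of \<open>G\<close> and the monotonicity of \<open>H\<close> bounds \<open>Q (wag (t + 1)) u\<close> by \<open>(1 - \<alpha> t) Q (wag t) u\<close>
  plus a difference of Bregman distances, squared oracle errors, and inner products of the errors with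
  iterates minus \<open>u\<close>. A virtual prox sequence \<open>rv\<close>, driven by the errors themselves, replaces \<open>u\<close> in these
  inner products by a point that does not depend on the current sample. After division by \<open>\<Gamma> t\<close> the bound
  telescopes and is uniform in \<open>u\<close>, hence bounds the gap by squared errors and two martingales. Taking
  expectations gives (a). For (b), convexity of \<open>exp\<close> and Markov's inequality control the three sums of
  squares, and Chernoff's bound controls the martingales, whose increments satisfy
  \<open>E exp (c X) \<le> exp (3 c\<^sup>2 B\<^sup>2 / 4)\<close> because \<open>exp x \<le> x + exp (9 x\<^sup>2 / 16)\<close>.\<close>

section \<open>Exponential moments\<close>

text \<open>Both prox steps of iteration \<open>t\<close> use the same sample of \<open>G\<close>,
  so \<open>w (t + 1)\<close> is correlated with the error of that sample and their inner product
  need not have mean zero. That error is therefore paired with \<open>r t - rv t\<close>, and the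
  leftover product with \<open>w (t + 1) - r t\<close> is absorbed by Young's inequality into a
  share \<open>1 - q\<close> of the strong convexity. This is why the stepsize condition retains
  only \<open>q * \<mu>\<close>, and where \<open>1 / (2 * (1 - q))\<close> comes from. The factor 2
  of \<open>\<Omega>\<^sup>2\<close> counts the two prox sequences \<open>r\<close> and
  \<open>rv\<close>. The second obstacle is measurability: \<open>Z\<close> may have empty interior,
  so that \<open>\<omega>'\<close> is an arbitrary selection, \<open>J\<close> may jump at the
  relative boundary, and the gap is a supremum over an uncountable set. Hence gradients of
  \<open>\<omega>\<close> are evaluated only along segments of \<open>Z\<close>, the prox-mapping is
  moved to a fixed centre, and the gap is treated as a lower semicontinuous function. Conditional
  expectations are replaced by product measures, with the past held fixed while the new sample is
  averaged.\<close>

lemma exp_le_quadratic_nonpos: "exp x \<le> 1 + x + x\<^sup>2 / 2" if "x \<le> 0" for x :: real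
proof -
  obtain t where t: "\<bar>t\<bar> \<le> \<bar>x\<bar>" "exp x = (\<Sum>m<3. x ^ m / fact m) + exp t / fact 3 * x ^ 3"
    using Maclaurin_exp_le by blast
  have "x ^ 3 \<le> 0" using that by (simp add: power3_eq_cube mult_nonpos_nonpos mult_nonneg_nonpos)
  then have "exp t / fact 3 * x ^ 3 \<le> 0" by (intro mult_nonneg_nonpos) auto
  then show ?thesis using t(2) by (simp add: eval_nat_numeral)
qed

text \<open>The linear term is kept outside the exponential so that it vanishes under a mean-zero
  expectation. For negative \<open>x\<close> the quadratic Taylor bound suffices because 1/2 < 9/16;
  from 16/9 on, \<open>x\<close> is at most \<open>9 / 16 * x\<^sup>2\<close>; in between, Taylor
  polynomials of degree 8 are compared.\<close>

lemma exp_le_add_exp_square: "exp x \<le> x + exp (9 / 16 * x\<^sup>2)" for x :: real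
proof -
  let ?y = "9 / 16 * x\<^sup>2"
  consider "x \<le> 0" | "0 < x" "x < 16 / 9" | "16 / 9 \<le> x" by linarith
  then show ?thesis
  proof cases
    case 1
    have "1 + x\<^sup>2 / 2 \<le> exp ?y"
      using exp_ge_add_one_self[of ?y] zero_le_power2[of x] by linarith
    with exp_le_quadratic_nonpos[OF 1] show ?thesis by linarith
  next
    case 2
    obtain t where t: "\<bar>t\<bar> \<le> \<bar>x\<bar>" "exp x = (\<Sum>m<8. x ^ m / fact m) + exp t / fact 8 * x ^ 8"
      using Maclaurin_exp_le by blast
    \<comment> \<open>Here \<open>t\<close> < 16/9 < 2, so the Lagrange remainder is at most 9/8!
      times \<open>x ^ 8\<close>, as exp 2 is bounded by 9.\<close>
    have "exp t \<le> exp 2" using t(1) 2 by simp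
    also have "exp (2::real) = exp 1 ^ 2" by (simp flip: exp_of_nat_mult)
    also have "\<dots> \<le> 3 ^ 2" using exp_le by (intro power_mono) auto
    finally have "exp t / fact 8 * x ^ 8 \<le> 9 / 40320 * x ^ 8"
      by (intro mult_right_mono) (auto simp: fact_numeral)
    then have up: "exp x \<le> 1 + x + x^2/2 + x^3/6 + x^4/24 + x^5/120 + x^6/720 + x^7/5040 + 9/40320 * x^8"
      unfolding t(2) by (simp add: eval_nat_numeral)
    have "(\<Sum>m<5. ?y ^ m / fact m) \<le> exp ?y"
      using sum_le_suminf[OF summable_exp[of ?y], of "{..<5}"]
      by (simp add: exp_def scaleR_conv_of_real field_simps)
    then have low: "1 + 9/16 * x^2 + 81/512 * x^4 + 243/8192 * x^6 + 2187/524288 * x^8 \<le> exp ?y"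
      by (simp add: eval_nat_numeral field_simps)
    \<comment> \<open>Divided by \<open>x^2\<close>, the bound \<open>low\<close> plus
      \<open>x\<close> minus the bound \<open>up\<close> has even coefficients 1/16, about 0.1165,
      about 0.0283 and a small positive one, and odd coefficients -1/6, -1/120, -1/5040. Each of
      \<open>p1\<close>, \<open>p2\<close>, \<open>p3\<close> pays for one odd coefficient out of
      the even ones next to it, which are split as 0.115 + 0.001 and 0.02 + 0.008; 0.725 and 0.21
      are approximate vertices of the parabolas.\<close>
    have "0 \<le> 115/1000 * (x - 725/1000)^2" by simp
    then have "0 \<le> 115/1000 * x^2 - 115/1000 * 1450/1000 * x + 115/1000 * (725/1000)^2"
      by (simp add: power2_eq_square algebra_simps)
    then have p1: "0 \<le> 1/16 - x/6 + 115/1000 * x^2" using 2 by (simp add: power2_eq_square)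
    have "0 \<le> x^2 * (x - 21/100)^2 / 50" by simp
    then have "0 \<le> 441/500000 * x^2 - 42/5000 * x^3 + x^4 / 50"
      by (simp add: eval_nat_numeral field_simps)
    moreover have "0 \<le> x^3" "0 \<le> x^2" using 2 by simp_all
    ultimately have p2: "0 \<le> 1/1000 * x^2 - x^3/120 + x^4 / 50" by linarith
    have p3: "0 \<le> x^4 * (8/1000 - x / 5040)" using 2 by simp
    have "0 \<le> x ^ 2 * ((1/16 - x/6 + 115/1000 * x^2) + (1/1000 * x^2 - x^3/120 + x^4 / 50)
      + x^4 * (8/1000 - x / 5040))"
      by (rule mult_nonneg_nonneg[OF zero_le_power2 add_nonneg_nonneg[OF add_nonneg_nonneg[OF p1 p2] p3]])
    moreover have "0 \<le> x^6 * 1" "0 \<le> x^4 * 1" "0 \<le> x^8" using 2 by simp_all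
    ultimately show ?thesis using up low by (simp add: eval_nat_numeral field_simps)
  next
    case 3
    then have "x \<le> ?y" by (simp add: power2_eq_square)
    then have "exp x \<le> exp ?y" by simp
    with 3 show ?thesis by linarith
  qed
qed

text \<open>Integrated, this is Jensen's inequality for \<open>y powr p\<close> whenever \<open>E exp Y \<le> exp 1\<close>.\<close>

lemma exp_mult_le_tangent:
  fixes p y :: real
  assumes "0 \<le> p" "p \<le> 1"
  shows "exp (p * y) \<le> exp p * (1 - p + p * exp (y - 1))"
proof -
  have "exp ((1 - p) * 0 + p * (y - 1)) \<le> (1 - p) * exp 0 + p * exp (y - 1)"
    using convex_onD[OF exp_convex, of p 0 "y - 1"] assms by simp
  then have "exp p * exp (p * (y - 1)) \<le> exp p * (1 - p + p * exp (y - 1))"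
    by (intro mult_left_mono) auto
  then show ?thesis by (simp flip: exp_add add: algebra_simps)
qed

context prob_space
begin

text \<open>The integrand is the right-hand side of \<open>exp_mult_le_tangent\<close>. Being affine
  in \<open>exp (Y s)\<close>, it is an integrable majorant whose mean is immediate from the
  light-tail bound.\<close>

lemma expectation_tangent_le:
  fixes p :: real
  assumes "0 \<le> p"
    and Y: "integrable M (\<lambda>s. exp (Y s))" "expectation (\<lambda>s. exp (Y s)) \<le> exp (1::real)"
  shows "integrable M (\<lambda>s. exp p * (1 - p + p * exp (Y s - 1)))"
    and "expectation (\<lambda>s. exp p * (1 - p + p * exp (Y s - 1))) \<le> exp p"
proof -
  have int: "integrable M (\<lambda>s. exp (Y s - 1))"
    using Y(1) by (simp add: exp_diff)
  then show "integrable M (\<lambda>s. exp p * (1 - p + p * exp (Y s - 1)))"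
    by simp
  have "expectation (\<lambda>s. exp (Y s - 1)) \<le> 1"
    using Y(2) by (simp add: exp_diff)
  then have "p * expectation (\<lambda>s. exp (Y s - 1)) \<le> p * 1"
    using \<open>0 \<le> p\<close> by (rule mult_left_mono)
  then show "expectation (\<lambda>s. exp p * (1 - p + p * exp (Y s - 1))) \<le> exp p"
    using int by (simp add: prob_space)
qed

text \<open>A centred variable dominated by a light-tailed one is sub-Gaussian. For small
  \<open>D * \<sigma>\<close> the linear term of \<open>exp_le_add_exp_square\<close> integrates to
  0 and the rest is a power at most 1 of the light-tail exponential; for large
  \<open>D * \<sigma>\<close> Young's inequality already fits under the bound. The nonnegative
  integral avoids integrability questions when such factors are multiplied later.\<close>

lemma nn_integral_exp_le:
  fixes f X :: "'a \<Rightarrow> real"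
  assumes f: "integrable M f" "expectation f = 0"
    and bound: "\<And>s. s \<in> space M \<Longrightarrow> \<bar>f s\<bar> \<le> D * X s"
    and \<sigma>: "0 < \<sigma>"
    and X: "integrable M (\<lambda>s. exp ((X s)\<^sup>2 / \<sigma>\<^sup>2))"
      "expectation (\<lambda>s. exp ((X s)\<^sup>2 / \<sigma>\<^sup>2)) \<le> exp 1"
  shows "(\<integral>\<^sup>+ s. ennreal (exp (f s)) \<partial>M) \<le> ennreal (exp (3 / 4 * (D * \<sigma>)\<^sup>2))"
proof -
  have by_dominating: ?thesis
    if "integrable M g" "\<And>s. s \<in> space M \<Longrightarrow> exp (f s) \<le> g s"
      "expectation g \<le> exp (3 / 4 * (D * \<sigma>)\<^sup>2)" for g
  proof -
    have "(\<integral>\<^sup>+ s. ennreal (exp (f s)) \<partial>M) \<le> (\<integral>\<^sup>+ s. ennreal (g s) \<partial>M)"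
      by (intro nn_integral_mono ennreal_leI that)
    also have "\<dots> = ennreal (expectation g)"
      using that(1,2) by (intro nn_integral_eq_integral AE_I2) (auto intro: order.trans[OF exp_ge_zero])
    also have "\<dots> \<le> ennreal (exp (3 / 4 * (D * \<sigma>)\<^sup>2))"
      by (intro ennreal_leI that)
    finally show ?thesis .
  qed
  have DX: "D * X s = (D * \<sigma>) * (X s / \<sigma>)" for s using \<sigma> by simp
  \<comment> \<open>The threshold makes \<open>p = 9 / 16 * (D * \<sigma>)\<^sup>2 \<le> 1\<close> below it, and
    \<open>3 / 8 * (D * \<sigma>)\<^sup>2 + 2 / 3 \<le> 3 / 4 * (D * \<sigma>)\<^sup>2\<close> above it.\<close>
  show ?thesis
  proof (cases "(D * \<sigma>)\<^sup>2 \<le> 16 / 9")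
    case True
    define p where "p = 9 / 16 * (D * \<sigma>)\<^sup>2"
    have p: "0 \<le> p" "p \<le> 1" "p \<le> 3 / 4 * (D * \<sigma>)\<^sup>2" using True by (auto simp: p_def)
    note tangent = expectation_tangent_le[OF p(1) X]
    show ?thesis
    proof (rule by_dominating)
      show "integrable M (\<lambda>s. f s + exp p * (1 - p + p * exp ((X s)\<^sup>2 / \<sigma>\<^sup>2 - 1)))"
        using f(1) tangent(1) by (rule Bochner_Integration.integrable_add)
      show "expectation (\<lambda>s. f s + exp p * (1 - p + p * exp ((X s)\<^sup>2 / \<sigma>\<^sup>2 - 1)))
          \<le> exp (3 / 4 * (D * \<sigma>)\<^sup>2)"
        unfolding Bochner_Integration.integral_add[OF f(1) tangent(1)] f(2)
        using order.trans[OF tangent(2), of "exp (3 / 4 * (D * \<sigma>)\<^sup>2)"] p(3) by simp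
    next
      fix s assume s: "s \<in> space M"
      have "(f s)\<^sup>2 \<le> (D * X s)\<^sup>2"
        using bound[OF s] by (metis abs_ge_zero power2_abs power_mono)
      then have "9 / 16 * (f s)\<^sup>2 \<le> p * ((X s)\<^sup>2 / \<sigma>\<^sup>2)"
        using \<sigma> by (simp add: p_def power_mult_distrib)
      then have "exp (9 / 16 * (f s)\<^sup>2) \<le> exp p * (1 - p + p * exp ((X s)\<^sup>2 / \<sigma>\<^sup>2 - 1))"
        using order.trans[OF _ exp_mult_le_tangent[OF p(1,2)]] by simp
      then show "exp (f s) \<le> f s + exp p * (1 - p + p * exp ((X s)\<^sup>2 / \<sigma>\<^sup>2 - 1))"
        using exp_le_add_exp_square[of "f s"] by linarith
    qed
  next
    case False
    define p where "p = (2 / 3 :: real)"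
    have p: "0 \<le> p" "p \<le> 1" by (auto simp: p_def)
    note tangent = expectation_tangent_le[OF p(1) X]
    let ?c = "exp (3 / 8 * (D * \<sigma>)\<^sup>2)"
    show ?thesis
    proof (rule by_dominating)
      show "integrable M (\<lambda>s. ?c * (exp p * (1 - p + p * exp ((X s)\<^sup>2 / \<sigma>\<^sup>2 - 1))))"
        using tangent(1) by (rule integrable_mult_right)
      have "expectation (\<lambda>s. ?c * (exp p * (1 - p + p * exp ((X s)\<^sup>2 / \<sigma>\<^sup>2 - 1)))) \<le> ?c * exp p"
        unfolding integral_mult_right_zero using tangent(2) by (intro mult_left_mono) auto
      also have "\<dots> \<le> exp (3 / 4 * (D * \<sigma>)\<^sup>2)"
        using False by (simp flip: exp_add add: p_def)
      finally show "expectation (\<lambda>s. ?c * (exp p * (1 - p + p * exp ((X s)\<^sup>2 / \<sigma>\<^sup>2 - 1))))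
          \<le> exp (3 / 4 * (D * \<sigma>)\<^sup>2)" .
    next
      fix s assume s: "s \<in> space M"
      \<comment> \<open>The coefficients 3/8 and 2/3 have product 1/4, so the inequality is tight;
        2/3 is the power of the light-tail exponential that is then integrated.\<close>
      have young: "a * b \<le> 3 / 8 * a\<^sup>2 + p * b\<^sup>2" for a b :: real
        using zero_le_power2[of "3 * a - 4 * b"] by (simp add: p_def power2_eq_square algebra_simps)
      have "f s \<le> 3 / 8 * (D * \<sigma>)\<^sup>2 + p * ((X s)\<^sup>2 / \<sigma>\<^sup>2)"
        using bound[OF s] young[of "D * \<sigma>" "X s / \<sigma>"] unfolding DX by (simp add: power_divide)
      then have "exp (f s) \<le> ?c * exp (p * ((X s)\<^sup>2 / \<sigma>\<^sup>2))"
        by (simp flip: exp_add)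
      also have "\<dots> \<le> ?c * (exp p * (1 - p + p * exp ((X s)\<^sup>2 / \<sigma>\<^sup>2 - 1)))"
        by (intro mult_left_mono exp_mult_le_tangent p) auto
      finally show "exp (f s) \<le> ?c * (exp p * (1 - p + p * exp ((X s)\<^sup>2 / \<sigma>\<^sup>2 - 1)))" .
    qed
  qed
qed

section \<open>Samples independent of the past\<close>

text \<open>\<open>F\<close> is the information available before the sample \<open>Y\<close> is drawn.\<close>

definition indep_sample :: "'a measure \<Rightarrow> 'b measure \<Rightarrow> ('a \<Rightarrow> 'b) \<Rightarrow> bool" where
  "indep_sample F N Y \<longleftrightarrow> subalgebra M F \<and> Y \<in> measurable M N \<and>
     (\<forall>A\<in>sets F. \<forall>B\<in>sets N. prob (A \<inter> (Y -` B \<inter> space M)) = prob A * prob (Y -` B \<inter> space M))"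

lemma distr_indep_sample:
  assumes ind: "indep_sample F N Y" and X: "X \<in> measurable F S"
  shows "distr M S X \<Otimes>\<^sub>M distr M N Y = distr M (S \<Otimes>\<^sub>M N) (\<lambda>s. (X s, Y s))"
proof -
  have sub: "subalgebra M F" and Y[measurable]: "Y \<in> measurable M N"
    using ind by (auto simp: indep_sample_def)
  have XM[measurable]: "X \<in> measurable M S" using measurable_from_subalg[OF sub X] .
  interpret DX: prob_space "distr M S X" by (rule prob_space_distr) measurable
  interpret DY: prob_space "distr M N Y" by (rule prob_space_distr) measurable
  show ?thesis
  proof (rule pair_measure_eqI)
    show "sigma_finite_measure (distr M S X)" "sigma_finite_measure (distr M N Y)" by unfold_locales
    show "sets (distr M S X \<Otimes>\<^sub>M distr M N Y) = sets (distr M (S \<Otimes>\<^sub>M N) (\<lambda>s. (X s, Y s)))"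
      unfolding sets_distr by (intro sets_pair_measure_cong sets_distr)
    fix A B assume "A \<in> sets (distr M S X)" "B \<in> sets (distr M N Y)"
    then have A[measurable]: "A \<in> sets S" and B[measurable]: "B \<in> sets N" by auto
    have "X -` A \<inter> space M \<in> sets F"
      using measurable_sets[OF X A] sub by (simp add: subalgebra_def)
    then have "prob ((X -` A \<inter> space M) \<inter> (Y -` B \<inter> space M))
        = prob (X -` A \<inter> space M) * prob (Y -` B \<inter> space M)"
      using ind B unfolding indep_sample_def by blast
    moreover have "(\<lambda>s. (X s, Y s)) -` (A \<times> B) \<inter> space M
        = (X -` A \<inter> space M) \<inter> (Y -` B \<inter> space M)" by auto
    ultimately show "emeasure (distr M S X) A * emeasure (distr M N Y) B
        = emeasure (distr M (S \<Otimes>\<^sub>M N) (\<lambda>s. (X s, Y s))) (A \<times> B)"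
      using A B by (subst (1 2 3) emeasure_distr) (auto simp: emeasure_eq_measure ennreal_mult)
  qed
qed

text \<open>The freezing argument that stands in for conditional expectation: the joint law of
  \<open>X\<close> and \<open>Y\<close> is a product, so Fubini averages the sample with the past
  \<open>X s\<close> held fixed.\<close>

lemma nn_integral_indep_sample:
  assumes ind: "indep_sample F N Y" and X: "X \<in> measurable F S"
    and h[measurable]: "h \<in> borel_measurable (S \<Otimes>\<^sub>M N)"
  shows "(\<integral>\<^sup>+ s. h (X s, Y s) \<partial>M) = (\<integral>\<^sup>+ s. (\<integral>\<^sup>+ s'. h (X s, Y s') \<partial>M) \<partial>M)"
proof -
  have sub: "subalgebra M F" and Y[measurable]: "Y \<in> measurable M N"
    using ind by (auto simp: indep_sample_def)
  have XM[measurable]: "X \<in> measurable M S" using measurable_from_subalg[OF sub X] .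
  interpret DY: prob_space "distr M N Y" by (rule prob_space_distr) measurable
  have "(\<integral>\<^sup>+ s. h (X s, Y s) \<partial>M) = integral\<^sup>N (distr M S X \<Otimes>\<^sub>M distr M N Y) h"
    unfolding distr_indep_sample[OF ind X] by (rule nn_integral_distr[symmetric]) measurable
  also have "\<dots> = (\<integral>\<^sup>+ x. \<integral>\<^sup>+ y. h (x, y) \<partial>distr M N Y \<partial>distr M S X)"
    by (rule DY.nn_integral_fst[symmetric]) measurable
  also have "\<dots> = (\<integral>\<^sup>+ s. (\<integral>\<^sup>+ y. h (X s, y) \<partial>distr M N Y) \<partial>M)"
    by (rule nn_integral_distr) measurable
  also have "\<dots> = (\<integral>\<^sup>+ s. (\<integral>\<^sup>+ s'. h (X s, Y s') \<partial>M) \<partial>M)"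
  proof (rule nn_integral_cong)
    fix s assume "s \<in> space M"
    then have "X s \<in> space S" using measurable_space[OF XM] by simp
    then show "(\<integral>\<^sup>+ y. h (X s, y) \<partial>distr M N Y) = (\<integral>\<^sup>+ s'. h (X s, Y s') \<partial>M)"
      by (intro nn_integral_distr Y) measurable
  qed
  finally show ?thesis .
qed

text \<open>The signed version of freezing. Fubini now requires integrability of the random quantity
  itself, while the mean is only known for each frozen input.\<close>

lemma integral_indep_sample_eq_0:
  fixes h :: "'c \<times> 'b \<Rightarrow> real"
  assumes ind: "indep_sample F N Y" and X: "X \<in> measurable F S"
    and h[measurable]: "h \<in> borel_measurable (S \<Otimes>\<^sub>M N)"
    and int: "integrable M (\<lambda>s. h (X s, Y s))"
    and zero: "\<And>x. x \<in> space S \<Longrightarrow> expectation (\<lambda>s. h (x, Y s)) = 0"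
  shows "expectation (\<lambda>s. h (X s, Y s)) = 0"
proof -
  have sub: "subalgebra M F" and Y[measurable]: "Y \<in> measurable M N"
    using ind by (auto simp: indep_sample_def)
  have XM[measurable]: "X \<in> measurable M S" using measurable_from_subalg[OF sub X] .
  interpret DX: prob_space "distr M S X" by (rule prob_space_distr) measurable
  interpret DY: prob_space "distr M N Y" by (rule prob_space_distr) measurable
  interpret pair_sigma_finite "distr M S X" "distr M N Y" ..
  have int': "integrable (distr M S X \<Otimes>\<^sub>M distr M N Y) h"
    unfolding distr_indep_sample[OF ind X] using int by (subst integrable_distr_eq) measurable
  have "expectation (\<lambda>s. h (X s, Y s)) = integral\<^sup>L (distr M S X \<Otimes>\<^sub>M distr M N Y) h"
    unfolding distr_indep_sample[OF ind X] by (rule integral_distr[symmetric]) measurable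
  also have "\<dots> = (\<integral>x. \<integral>y. h (x, y) \<partial>distr M N Y \<partial>distr M S X)"
    by (rule integral_fst'[OF int', symmetric])
  also have "\<dots> = (\<integral>x. 0 \<partial>distr M S X)"
  proof (rule Bochner_Integration.integral_cong[OF refl])
    fix x assume "x \<in> space (distr M S X)"
    then have x: "x \<in> space S" by simp
    then have "(\<integral>y. h (x, y) \<partial>distr M N Y) = expectation (\<lambda>s. h (x, Y s))"
      by (intro integral_distr Y) measurable
    with zero[OF x] show "(\<integral>y. h (x, y) \<partial>distr M N Y) = 0" by simp
  qed
  finally show ?thesis by simp
qed

end

section \<open>Prox mappings for a general norm\<close>

locale vec_norm =
  fixes nrm :: "'a::euclidean_space \<Rightarrow> real"
  assumes is_norm: "is_norm nrm"
begin

abbreviation dual :: "'a \<Rightarrow> real" where "dual \<equiv> dual_norm nrm"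

lemma nrm_nonneg [simp]: "0 \<le> nrm x"
  and nrm_eq_0_iff [simp]: "nrm x = 0 \<longleftrightarrow> x = 0"
  and nrm_scaleR [simp]: "nrm (c *\<^sub>R x) = \<bar>c\<bar> * nrm x"
  and nrm_triangle: "nrm (x + y) \<le> nrm x + nrm y"
  using is_norm by (auto simp: is_norm_def)

lemma nrm_zero [simp]: "nrm 0 = 0"
  using nrm_eq_0_iff by blast

lemma nrm_minus [simp]: "nrm (- x) = nrm x"
  using nrm_scaleR[of "-1" x] by simp

lemma nrm_minus_commute: "nrm (x - y) = nrm (y - x)"
  using nrm_minus[of "x - y"] by simp

text \<open>Together with \<open>norm_le_nrm\<close> this is the equivalence of norms in finite
  dimension. It carries continuity, boundedness and Borel measurability, which refer to the
  type-class norm, over to \<open>nrm\<close> and \<open>dual\<close>, and makes the supremum in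
  \<open>dual_norm\<close> finite.\<close>

lemma nrm_le_norm: "\<exists>C>0. \<forall>x. nrm x \<le> C * norm x"
proof (intro exI conjI allI)
  let ?C = "(\<Sum>b\<in>Basis. nrm b) + 1"
  show "0 < ?C" by (intro add_nonneg_pos sum_nonneg) auto
  fix x :: 'a
  have nrm_sum: "nrm (sum f A) \<le> (\<Sum>a\<in>A. nrm (f a))" if "finite A" for f :: "'a \<Rightarrow> 'a" and A
    using that
    by (induction rule: finite_induct) (auto intro: order.trans[OF nrm_triangle])
  have "nrm x = nrm (\<Sum>b\<in>Basis. (x \<bullet> b) *\<^sub>R b)" by (simp add: euclidean_representation)
  also have "\<dots> \<le> (\<Sum>b\<in>Basis. \<bar>x \<bullet> b\<bar> * nrm b)"
    using nrm_sum[of Basis "\<lambda>b. (x \<bullet> b) *\<^sub>R b"] by simp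
  also have "\<dots> \<le> (\<Sum>b\<in>Basis. norm x * nrm b)"
    by (intro sum_mono mult_right_mono Basis_le_norm) auto
  also have "\<dots> \<le> ?C * norm x" by (simp add: sum_distrib_left algebra_simps)
  finally show "nrm x \<le> ?C * norm x" .
qed

lemma continuous_on_nrm: "continuous_on UNIV nrm"
proof -
  obtain C where C: "0 < C" "\<And>x. nrm x \<le> C * norm x" using nrm_le_norm by blast
  have "\<bar>nrm x - nrm y\<bar> \<le> C * norm (x - y)" for x y
    using nrm_triangle[of "x - y" y] nrm_triangle[of "y - x" x] nrm_minus_commute[of x y] C(2)[of "x - y"]
    by simp
  then have "C-lipschitz_on UNIV nrm"
    using C(1) by (intro lipschitz_onI) (auto simp: dist_norm)
  then show ?thesis by (rule lipschitz_on_continuous_on)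
qed

lemma norm_le_nrm: "\<exists>c>0. \<forall>x. norm x \<le> c * nrm x"
proof -
  have "sphere (0::'a) 1 \<noteq> {}" by simp
  then obtain x0 where x0: "x0 \<in> sphere 0 1" "\<forall>x\<in>sphere 0 1. nrm x0 \<le> nrm x"
    using continuous_attains_inf[OF compact_sphere _ continuous_on_subset[OF continuous_on_nrm subset_UNIV]]
    by metis
  have pos: "0 < nrm x0" using x0(1) nrm_nonneg[of x0] nrm_eq_0_iff[of x0] by (auto simp: less_le)
  have "norm x \<le> (1 / nrm x0) * nrm x" for x
  proof (cases "x = 0")
    case False
    then have "nrm x0 \<le> nrm (x /\<^sub>R norm x)" by (intro x0(2)[rule_format]) simp
    with False pos show ?thesis by (simp add: field_simps)
  qed simp
  with pos show ?thesis by (intro exI[of _ "1 / nrm x0"]) simp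
qed

lemma bdd_above_inner_unit_ball: "bdd_above ((\<lambda>x. \<eta> \<bullet> x) ` {x. nrm x \<le> 1})"
proof -
  obtain c where c: "0 < c" "\<And>x. norm x \<le> c * nrm x" using norm_le_nrm by blast
  have "\<eta> \<bullet> x \<le> norm \<eta> * c" if "nrm x \<le> 1" for x
  proof -
    have "\<eta> \<bullet> x \<le> norm \<eta> * norm x" by (rule norm_cauchy_schwarz)
    also have "\<dots> \<le> norm \<eta> * (c * 1)"
      using c(2)[of x] that c(1) by (intro mult_left_mono order.trans[OF c(2)]) auto
    finally show ?thesis by simp
  qed
  then show ?thesis by (intro bdd_aboveI2) auto
qed

lemma inner_le_dual: "\<eta> \<bullet> x \<le> dual \<eta> * nrm x"
proof (cases "x = 0")
  case False
  then have pos: "0 < nrm x" using nrm_nonneg[of x] nrm_eq_0_iff[of x] by (simp add: less_le)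
  then have "\<eta> \<bullet> (x /\<^sub>R nrm x) \<le> dual \<eta>"
    unfolding dual_norm_def by (intro cSUP_upper bdd_above_inner_unit_ball) (simp add: field_simps)
  with pos show ?thesis by (simp add: field_simps)
qed simp

lemma dual_leI: "(\<And>x. nrm x \<le> 1 \<Longrightarrow> \<eta> \<bullet> x \<le> B) \<Longrightarrow> dual \<eta> \<le> B"
  unfolding dual_norm_def by (rule cSUP_least) (auto intro!: exI[of _ 0])

lemma dual_nonneg [simp]: "0 \<le> dual \<eta>"
  unfolding dual_norm_def
  using cSUP_upper[OF _ bdd_above_inner_unit_ball, of 0 \<eta>] by simp

lemma abs_inner_le_dual: "\<bar>\<eta> \<bullet> x\<bar> \<le> dual \<eta> * nrm x"
  using inner_le_dual[of \<eta> x] inner_le_dual[of \<eta> "- x"] by simp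

lemma inner_le_dual_unit: "nrm x \<le> 1 \<Longrightarrow> \<eta> \<bullet> x \<le> dual \<eta>"
  using inner_le_dual[of \<eta> x] mult_left_mono[of "nrm x" 1 "dual \<eta>"] by simp

lemma dual_triangle: "dual (x + y) \<le> dual x + dual y"
  by (rule dual_leI) (simp add: inner_add_left add_mono inner_le_dual_unit)

lemma dual_minus [simp]: "dual (- x) = dual x"
proof -
  have "dual (- x) \<le> dual x" for x
    by (rule dual_leI) (use inner_le_dual_unit[of "- _" x] in simp)
  from this[of x] this[of "- x"] show ?thesis by simp
qed

lemma dual_minus_commute: "dual (x - y) = dual (y - x)"
  using dual_minus[of "x - y"] by simp

lemma dual_scaleR: "dual (c *\<^sub>R x) \<le> \<bar>c\<bar> * dual x"
proof (rule dual_leI)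
  fix y assume y: "nrm y \<le> 1"
  have "c *\<^sub>R x \<bullet> y \<le> \<bar>c\<bar> * \<bar>x \<bullet> y\<bar>"
    by (simp flip: abs_mult)
  also have "\<dots> \<le> \<bar>c\<bar> * dual x"
    using inner_le_dual_unit[OF y, of x] inner_le_dual_unit[of "- y" x] y
    by (intro mult_left_mono) auto
  finally show "c *\<^sub>R x \<bullet> y \<le> \<bar>c\<bar> * dual x" .
qed

lemma dual_le_norm: "\<exists>C>0. \<forall>x. dual x \<le> C * norm x"
proof -
  obtain c where c: "0 < c" "\<And>x. norm x \<le> c * nrm x" using norm_le_nrm by blast
  have "dual \<eta> \<le> c * norm \<eta>" for \<eta>
  proof (rule dual_leI)
    fix x assume "nrm x \<le> 1"
    have "\<eta> \<bullet> x \<le> norm \<eta> * norm x" by (rule norm_cauchy_schwarz)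
    also have "\<dots> \<le> norm \<eta> * (c * 1)"
      using c(1) \<open>nrm x \<le> 1\<close> by (intro mult_left_mono order.trans[OF c(2)]) auto
    finally show "\<eta> \<bullet> x \<le> c * norm \<eta>" by (simp add: mult.commute)
  qed
  with c(1) show ?thesis by blast
qed

lemma norm_le_dual: "\<exists>C>0. \<forall>x. norm x \<le> C * dual x"
proof -
  obtain C where C: "0 < C" "\<And>x. nrm x \<le> C * norm x" using nrm_le_norm by blast
  have "norm x \<le> C * dual x" for x
  proof (cases "x = 0")
    case False
    have "norm x * norm x = x \<bullet> x" by (simp add: dot_square_norm power2_eq_square)
    also have "\<dots> \<le> dual x * (C * norm x)"
      by (rule order.trans[OF inner_le_dual]) (intro mult_left_mono C(2), simp)
    finally show ?thesis using False by (simp add: mult.assoc mult.commute)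
  qed (use C(1) in simp)
  with C(1) show ?thesis by blast
qed

lemma borel_measurable_dual [measurable]: "dual \<in> borel_measurable borel"
proof -
  obtain C where C: "0 < C" "\<And>x. dual x \<le> C * norm x" using dual_le_norm by blast
  have "\<bar>dual x - dual y\<bar> \<le> C * norm (x - y)" for x y
    using dual_triangle[of "x - y" y] dual_triangle[of "y - x" x] dual_minus_commute[of x y] C(2)[of "x - y"]
    by simp
  then have "C-lipschitz_on UNIV dual"
    using C(1) by (intro lipschitz_onI) (auto simp: dist_norm)
  then show ?thesis
    by (intro borel_measurable_continuous_onI lipschitz_on_continuous_on)
qed

lemma dual_add_power2: "(dual (x + y))\<^sup>2 \<le> 2 * ((dual x)\<^sup>2 + (dual y)\<^sup>2)"
proof -
  have "(dual (x + y))\<^sup>2 \<le> (dual x + dual y)\<^sup>2"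
    by (intro power_mono dual_triangle) simp
  then show ?thesis using sum_squares_bound[of "dual x" "dual y"] by (simp add: power2_sum)
qed

text \<open>The origin of the factor 3 in front of \<open>L\<^sub>H\<^sup>2\<close> in the stepsize
  condition: the difference of the two sampled operator values splits into the Lipschitz part and
  two errors.\<close>

lemma dual_add3_power2: "(dual (x + y + z))\<^sup>2 \<le> 3 * ((dual x)\<^sup>2 + (dual y)\<^sup>2 + (dual z)\<^sup>2)"
proof -
  have "dual (x + y + z) \<le> dual x + dual y + dual z"
    using dual_triangle[of "x + y" z] dual_triangle[of x y] by simp
  then have "(dual (x + y + z))\<^sup>2 \<le> (dual x + dual y + dual z)\<^sup>2"
    by (intro power_mono) simp_all
  moreover have "(a + b + c)\<^sup>2 \<le> 3 * (a\<^sup>2 + b\<^sup>2 + c\<^sup>2)" for a b c :: real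
    using sum_squares_bound[of a b] sum_squares_bound[of b c] sum_squares_bound[of a c]
    by (simp add: power2_eq_square algebra_simps)
  ultimately show ?thesis using order.trans by blast
qed

end

text \<open>Composition with the segment from \<open>x\<close> to \<open>y\<close> turns the
  derivative within \<open>Z\<close>, which need not be unique, into a one-sided limit that depends
  only on values of \<open>f\<close> on \<open>Z\<close>. The later inequalities for
  \<open>\<omega>'\<close> come from this limit.\<close>

lemma gradient_on_directional:
  assumes f: "gradient_on Z f f'" and Z: "convex Z" "x \<in> Z" "y \<in> Z"
  shows "((\<lambda>s. (f (x + s *\<^sub>R (y - x)) - f x) / s) \<longlongrightarrow> f' x \<bullet> (y - x)) (at_right 0)"
proof -
  let ?g = "\<lambda>s::real. x + s *\<^sub>R (y - x)"
  have "?g ` {0..1} \<subseteq> Z"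
  proof safe
    fix s :: real assume "s \<in> {0..1}"
    then have "(1 - s) *\<^sub>R x + s *\<^sub>R y \<in> Z" using Z by (intro convexD) auto
    then show "?g s \<in> Z" by (simp add: algebra_simps)
  qed
  moreover have "(f has_derivative (\<lambda>h. f' x \<bullet> h)) (at (?g 0) within Z)"
    using f Z(2) by (simp add: gradient_on_def)
  ultimately have f': "(f has_derivative (\<lambda>h. f' x \<bullet> h)) (at (?g 0) within ?g ` {0..1})"
    using has_derivative_subset by blast
  have "(?g has_derivative (\<lambda>h. h *\<^sub>R (y - x))) (at 0 within {0..1})"
    by (auto intro!: derivative_eq_intros)
  from has_derivative_in_compose[OF this f']
  have "((\<lambda>s. f (?g s)) has_derivative (\<lambda>h. f' x \<bullet> (h *\<^sub>R (y - x)))) (at 0 within {0..1})" .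
  then have "((\<lambda>s. f (?g s)) has_field_derivative f' x \<bullet> (y - x)) (at 0 within {0..1})"
    by (rule has_derivative_imp_has_field_derivative) simp
  then show ?thesis
    by (simp add: has_field_derivative_iff at_within_Icc_at_right)
qed

lemma gradient_on_continuous: "gradient_on Z f f' \<Longrightarrow> continuous_on Z f"
  unfolding gradient_on_def by (meson has_derivative_continuous_on)

section \<open>Bregman distances, optimality and stability of prox steps\<close>

locale prox_setup = vec_norm nrm for nrm :: "'a::euclidean_space \<Rightarrow> real" +
  fixes Z :: "'a set" and \<omega> :: "'a \<Rightarrow> real" and \<omega>' :: "'a \<Rightarrow> 'a" and \<mu> :: real
  assumes Z: "Z \<noteq> {}" "closed Z" "convex Z"
    and \<mu>: "0 < \<mu>"
    and \<omega>_strongly_convex: "strongly_convex_on nrm \<mu> Z \<omega>"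
    and \<omega>_gradient: "gradient_on Z \<omega> \<omega>'"
begin

abbreviation V :: "'a \<Rightarrow> 'a \<Rightarrow> real" where "V \<equiv> prox_fun \<omega> \<omega>'"

lemma segment_in_Z: "x \<in> Z \<Longrightarrow> y \<in> Z \<Longrightarrow> 0 \<le> s \<Longrightarrow> s \<le> 1 \<Longrightarrow> (1 - s) *\<^sub>R x + s *\<^sub>R y \<in> Z"
  using Z(3) by (intro convexD) auto

lemma segment_in_Z': "x \<in> Z \<Longrightarrow> y \<in> Z \<Longrightarrow> 0 \<le> s \<Longrightarrow> s \<le> 1 \<Longrightarrow> x + s *\<^sub>R (y - x) \<in> Z"
  using segment_in_Z[of x y s] by (simp add: algebra_simps)

text \<open>Strong convexity along the segment from \<open>z\<close> to \<open>u\<close>, divided by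
  \<open>s\<close>, in the limit as \<open>s\<close> tends to 0 from the right.\<close>

lemma prox_fun_lower:
  assumes "z \<in> Z" "u \<in> Z"
  shows "\<mu> / 2 * (nrm (u - z))\<^sup>2 \<le> V z u"
proof -
  let ?N = "\<mu> / 2 * (nrm (u - z))\<^sup>2"
  have "((\<lambda>s. (\<omega> (z + s *\<^sub>R (u - z)) - \<omega> z) / s) \<longlongrightarrow> \<omega>' z \<bullet> (u - z)) (at_right 0)"
    by (rule gradient_on_directional[OF \<omega>_gradient Z(3) assms])
  moreover have "((\<lambda>s. \<omega> u - \<omega> z - (1 - s) * ?N) \<longlongrightarrow> \<omega> u - \<omega> z - (1 - 0) * ?N) (at_right 0)"
    by (intro tendsto_intros)
  moreover have "\<forall>\<^sub>F s in at_right 0. (\<omega> (z + s *\<^sub>R (u - z)) - \<omega> z) / s \<le> \<omega> u - \<omega> z - (1 - s) * ?N"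
    using eventually_at_right_less[of 0] eventually_at_right_real[of 0 1, simplified]
  proof eventually_elim
    case (elim s)
    then have "\<omega> ((1 - s) *\<^sub>R z + s *\<^sub>R u)
        \<le> (1 - s) * \<omega> z + s * \<omega> u - \<mu> / 2 * s * (1 - s) * (nrm (z - u))\<^sup>2"
      using \<omega>_strongly_convex assms by (auto simp: strongly_convex_on_def)
    moreover have "(1 - s) *\<^sub>R z + s *\<^sub>R u = z + s *\<^sub>R (u - z)" by (simp add: algebra_simps)
    ultimately have "\<omega> (z + s *\<^sub>R (u - z)) - \<omega> z \<le> s * (\<omega> u - \<omega> z - (1 - s) * ?N)"
      by (simp add: algebra_simps nrm_minus_commute[of z u])
    with elim show ?case by (simp add: divide_le_eq mult.commute)
  qed
  ultimately have "\<omega>' z \<bullet> (u - z) \<le> \<omega> u - \<omega> z - (1 - 0) * ?N"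
    by (intro tendsto_le[OF trivial_limit_at_right_real])
  then show ?thesis by (simp add: prox_fun_def)
qed

lemma prox_fun_nonneg: "z \<in> Z \<Longrightarrow> u \<in> Z \<Longrightarrow> 0 \<le> V z u"
  using order.trans[OF _ prox_fun_lower] \<mu> by simp

text \<open>Young's inequality with weight \<mu>, chosen so that the quadratic term is exactly what
  \<open>prox_fun_lower\<close> pays for.\<close>

lemma inner_le_prox_fun:
  assumes "z \<in> Z" "u \<in> Z"
  shows "\<eta> \<bullet> (u - z) \<le> V z u + (dual \<eta>)\<^sup>2 / (2 * \<mu>)"
proof -
  let ?n = "nrm (u - z)"
  have "dual \<eta> * ?n \<le> \<mu> / 2 * ?n\<^sup>2 + (dual \<eta>)\<^sup>2 / (2 * \<mu>)"
    using \<mu> zero_le_power2[of "\<mu> * ?n - dual \<eta>"] by (simp add: field_simps power2_eq_square)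
  then show ?thesis
    using inner_le_dual[of \<eta> "u - z"] prox_fun_lower[OF assms] by linarith
qed

lemma prox_fun_add: "V x y + V y x = (\<omega>' x - \<omega>' y) \<bullet> (x - y)"
  by (simp add: prox_fun_def inner_diff_left inner_diff_right)

lemma gradient_strongly_monotone:
  "x \<in> Z \<Longrightarrow> y \<in> Z \<Longrightarrow> \<mu> * (nrm (x - y))\<^sup>2 \<le> (\<omega>' x - \<omega>' y) \<bullet> (x - y)"
  using prox_fun_lower[of x y] prox_fun_lower[of y x] prox_fun_add[of x y] nrm_minus_commute[of x y]
  by simp

text \<open>The minimiser \<open>u\<close> is compared with points moving from \<open>u\<close>
  towards \<open>v\<close>. Only \<omega> is differentiated; convexity bounds the increment of
  \<open>J\<close> along the segment, so \<open>J\<close> enters through a difference of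
  values.\<close>

lemma prox_optimality:
  assumes J: "convex_on Z J" and \<gamma>: "0 \<le> \<gamma>" and v: "v \<in> Z"
    and u: "is_arg_min (prox_objective \<omega> \<omega>' J \<gamma> z \<eta>) (\<lambda>u. u \<in> Z) u"
  shows "0 \<le> (\<omega>' u - \<omega>' z + \<eta>) \<bullet> (v - u) + \<gamma> * (J v - J u)"
proof -
  have uZ: "u \<in> Z" using u by (simp add: is_arg_min_linorder)
  have min: "prox_objective \<omega> \<omega>' J \<gamma> z \<eta> u \<le> prox_objective \<omega> \<omega>' J \<gamma> z \<eta> y" if "y \<in> Z" for y
    using u that by (auto simp: is_arg_min_linorder)
  let ?c = "(\<eta> - \<omega>' z) \<bullet> (v - u) + \<gamma> * (J v - J u)"
  have "((\<lambda>s. (\<omega> (u + s *\<^sub>R (v - u)) - \<omega> u) / s + ?c) \<longlongrightarrow> \<omega>' u \<bullet> (v - u) + ?c) (at_right 0)"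
    by (intro tendsto_intros gradient_on_directional[OF \<omega>_gradient Z(3) uZ v])
  moreover have "\<forall>\<^sub>F s in at_right 0. 0 \<le> (\<omega> (u + s *\<^sub>R (v - u)) - \<omega> u) / s + ?c"
    using eventually_at_right_less[of 0] eventually_at_right_real[of 0 1, simplified]
  proof eventually_elim
    case (elim s)
    let ?y = "u + s *\<^sub>R (v - u)"
    have y: "?y \<in> Z" using elim uZ v by (intro segment_in_Z') auto
    have "J ((1 - s) *\<^sub>R u + s *\<^sub>R v) \<le> (1 - s) * J u + s * J v"
      using convex_onD[OF J, of s u v] elim uZ v by simp
    moreover have "(1 - s) *\<^sub>R u + s *\<^sub>R v = ?y" by (simp add: algebra_simps)
    ultimately have "J ?y - J u \<le> s * (J v - J u)" by (simp add: algebra_simps)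
    then have "\<gamma> * (J ?y - J u) \<le> \<gamma> * (s * (J v - J u))" using \<gamma> by (rule mult_left_mono)
    moreover have "0 \<le> (\<eta> - \<omega>' z) \<bullet> (s *\<^sub>R (v - u)) + (\<omega> ?y - \<omega> u) + \<gamma> * (J ?y - J u)"
      using min[OF y]
      by (simp add: prox_objective_def prox_fun_def inner_diff_left inner_diff_right inner_add_right algebra_simps)
    ultimately have "0 \<le> s * ((\<omega> ?y - \<omega> u) / s + ?c)"
      using elim by (simp add: distrib_left mult.left_commute[of \<gamma>])
    with elim show ?case by (simp add: zero_le_mult_iff)
  qed
  ultimately have "0 \<le> \<omega>' u \<bullet> (v - u) + ?c"
    by (intro tendsto_lowerbound) auto
  then show ?thesis by (simp add: inner_diff_left inner_add_left algebra_simps)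
qed

text \<open>The three-point identity for Bregman distances rewrites the gradient difference in
  \<open>prox_optimality\<close> as the right-hand side.\<close>

lemma prox_three_point:
  assumes "convex_on Z J" "0 \<le> \<gamma>" "v \<in> Z"
    and "is_arg_min (prox_objective \<omega> \<omega>' J \<gamma> z \<eta>) (\<lambda>u. u \<in> Z) u"
  shows "\<eta> \<bullet> (u - v) + \<gamma> * (J u - J v) \<le> V z v - V z u - V u v"
  using prox_optimality[OF assms]
  by (simp add: prox_fun_def inner_diff_left inner_diff_right inner_add_left algebra_simps)

text \<open>Each optimality condition is tested at the other minimiser; in the sum the values of
  \<open>J\<close> cancel and strong monotonicity of \<open>\<omega>'\<close> remains. This yields
  both uniqueness and continuity of the prox-mapping in \<open>\<eta>\<close>.\<close>

lemma prox_lipschitz: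
  assumes J: "convex_on Z J" and \<gamma>: "0 \<le> \<gamma>"
    and u\<^sub>1: "is_arg_min (prox_objective \<omega> \<omega>' J \<gamma> z \<eta>\<^sub>1) (\<lambda>u. u \<in> Z) u\<^sub>1"
    and u\<^sub>2: "is_arg_min (prox_objective \<omega> \<omega>' J \<gamma> z \<eta>\<^sub>2) (\<lambda>u. u \<in> Z) u\<^sub>2"
  shows "\<mu> * nrm (u\<^sub>1 - u\<^sub>2) \<le> dual (\<eta>\<^sub>1 - \<eta>\<^sub>2)"
proof -
  have uZ: "u\<^sub>1 \<in> Z" "u\<^sub>2 \<in> Z" using u\<^sub>1 u\<^sub>2 by (auto simp: is_arg_min_linorder)
  have "(\<omega>' u\<^sub>1 - \<omega>' u\<^sub>2) \<bullet> (u\<^sub>1 - u\<^sub>2) \<le> (\<eta>\<^sub>1 - \<eta>\<^sub>2) \<bullet> (u\<^sub>2 - u\<^sub>1)"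
    using prox_optimality[OF J \<gamma> uZ(2) u\<^sub>1] prox_optimality[OF J \<gamma> uZ(1) u\<^sub>2]
    by (simp add: inner_diff_left inner_diff_right inner_add_left algebra_simps)
  also have "\<dots> \<le> dual (\<eta>\<^sub>1 - \<eta>\<^sub>2) * nrm (u\<^sub>1 - u\<^sub>2)"
    using inner_le_dual[of "\<eta>\<^sub>1 - \<eta>\<^sub>2" "u\<^sub>2 - u\<^sub>1"] by (simp add: nrm_minus_commute)
  finally have "\<mu> * nrm (u\<^sub>1 - u\<^sub>2) * nrm (u\<^sub>1 - u\<^sub>2) \<le> dual (\<eta>\<^sub>1 - \<eta>\<^sub>2) * nrm (u\<^sub>1 - u\<^sub>2)"
    using gradient_strongly_monotone[OF uZ] by (simp add: power2_eq_square mult.assoc)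
  then show ?thesis
    using nrm_nonneg[of "u\<^sub>1 - u\<^sub>2"] by (cases "nrm (u\<^sub>1 - u\<^sub>2) = 0") (auto simp: mult_le_cancel_right)
qed

lemma is_arg_min_prox_map:
  assumes "prox_well_defined Z \<omega> \<omega>' J" "z \<in> Z" "0 < \<gamma>"
  shows "is_arg_min (prox_objective \<omega> \<omega>' J \<gamma> z \<eta>) (\<lambda>u. u \<in> Z) (prox_map Z \<omega> \<omega>' J \<gamma> z \<eta>)"
proof -
  have "\<exists>u. is_arg_min (prox_objective \<omega> \<omega>' J \<gamma> z \<eta>) (\<lambda>u. u \<in> Z) u"
    using assms unfolding prox_well_defined_def by blast
  then show ?thesis
    unfolding prox_map_def arg_min_on_def arg_min_def by (rule someI_ex)
qed

lemma prox_map_in_Z: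
  "prox_well_defined Z \<omega> \<omega>' J \<Longrightarrow> z \<in> Z \<Longrightarrow> 0 < \<gamma> \<Longrightarrow> prox_map Z \<omega> \<omega>' J \<gamma> z \<eta> \<in> Z"
  using is_arg_min_prox_map by (simp add: is_arg_min_linorder)

lemma prox_map_eqI:
  assumes "prox_well_defined Z \<omega> \<omega>' J" "z \<in> Z" "0 < \<gamma>"
    and "is_arg_min (prox_objective \<omega> \<omega>' J \<gamma> z \<eta>) (\<lambda>u. u \<in> Z) u"
  shows "prox_map Z \<omega> \<omega>' J \<gamma> z \<eta> = u"
  using assms is_arg_min_prox_map[OF assms(1-3)] unfolding prox_well_defined_def by blast

text \<open>The virtual sequence uses the prox-mapping without \<open>J\<close>, about which nothing
  is assumed. Compactness of \<open>Z\<close> gives existence, and \<open>prox_lipschitz\<close>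
  with equal arguments gives uniqueness.\<close>

lemma prox_well_defined_zero:
  assumes "bounded Z"
  shows "prox_well_defined Z \<omega> \<omega>' (\<lambda>_. 0)"
  unfolding prox_well_defined_def
proof (intro ballI allI impI ex_ex1I)
  fix z \<eta> and \<gamma> :: real assume z: "z \<in> Z" and \<gamma>: "0 < \<gamma>"
  let ?f = "prox_objective \<omega> \<omega>' (\<lambda>_. 0) \<gamma> z \<eta>"
  have "compact Z" using assms Z(2) by (simp add: compact_eq_bounded_closed)
  moreover have "continuous_on Z ?f"
    unfolding prox_objective_def prox_fun_def
    by (intro continuous_intros gradient_on_continuous[OF \<omega>_gradient])
  ultimately obtain u where "u \<in> Z" "\<forall>y\<in>Z. ?f u \<le> ?f y"
    using continuous_attains_inf Z(1) by blast
  then show "\<exists>u. is_arg_min ?f (\<lambda>u. u \<in> Z) u" by (auto simp: is_arg_min_linorder)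
  fix u\<^sub>1 u\<^sub>2 assume "is_arg_min ?f (\<lambda>u. u \<in> Z) u\<^sub>1" "is_arg_min ?f (\<lambda>u. u \<in> Z) u\<^sub>2"
  then have "\<mu> * nrm (u\<^sub>1 - u\<^sub>2) \<le> dual (\<eta> - \<eta>)"
    using \<gamma> Z(3) by (intro prox_lipschitz) (auto simp: convex_on_def)
  moreover have "dual 0 = 0" using dual_scaleR[of 0 0] dual_nonneg[of 0] by simp
  ultimately show "u\<^sub>1 = u\<^sub>2"
    using \<mu> nrm_nonneg[of "u\<^sub>1 - u\<^sub>2"] by (simp add: mult_le_0_iff)
qed

end

text \<open>Relatively open superlevel sets express lower semicontinuity on \<open>Z\<close>. This
  property survives arbitrary suprema, so it reaches the gap function where countable suprema would
  not suffice directly.\<close>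

lemma measurable_lsc_compose:
  fixes f :: "'a::topological_space \<Rightarrow> real"
  assumes X: "X \<in> measurable M (restrict_space borel Z)"
    and lsc: "\<And>a. \<exists>U. open U \<and> {x \<in> Z. a < f x} = U \<inter> Z"
  shows "(\<lambda>s. f (X s)) \<in> borel_measurable M"
  unfolding borel_measurable_iff_greater
proof (rule allI)
  fix a
  obtain U where U: "open U" "{x \<in> Z. a < f x} = U \<inter> Z" using lsc[of a] by blast
  have "{x \<in> Z. a < f x} \<in> sets (restrict_space borel Z)"
    unfolding U(2) sets_restrict_space using U(1) by (intro image_eqI[of _ _ U]) auto
  from measurable_sets[OF X this] have "X -` {x \<in> Z. a < f x} \<inter> space M \<in> sets M" .
  moreover have "X -` {x \<in> Z. a < f x} \<inter> space M = {s \<in> space M. a < f (X s)}"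
    using measurable_space[OF X] by (auto simp: space_restrict_space)
  ultimately show "{s \<in> space M. a < f (X s)} \<in> sets M" by simp
qed

section \<open>Measurability of the prox-mapping\<close>

context prox_setup
begin

lemma space_Z [simp]: "space (restrict_space borel Z) = Z"
  by (simp add: space_restrict_space)

text \<open>The normal component of \<open>\<omega>'\<close> is arbitrary, possibly not even measurable, when \<open>Z\<close> has empty interior;
  only its projection to the span of \<open>Z - Z\<close> matters.\<close>

lemma measurable_gradient_direction:
  assumes "v \<in> Z"
  shows "(\<lambda>z. \<omega>' z \<bullet> (v - z)) \<in> borel_measurable (restrict_space borel Z)"
proof (rule borel_measurable_LIMSEQ_real)
  \<comment> \<open>The difference quotients with steps 1/(i + 1) are continuous in
    \<open>z\<close>, since \<omega> is continuous on \<open>Z\<close>; the directional derivative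
    is their pointwise limit.\<close>
  let ?e = "\<lambda>i. 1 / real (Suc i)"
  fix z assume "z \<in> space (restrict_space borel Z)"
  then have z: "z \<in> Z" by simp
  have "filterlim ?e (at_right 0) sequentially"
    unfolding filterlim_at using LIMSEQ_inverse_real_of_nat
    by (auto simp: inverse_eq_divide)
  from filterlim_compose[OF gradient_on_directional[OF \<omega>_gradient Z(3) z assms] this]
  show "(\<lambda>i. (\<omega> (z + ?e i *\<^sub>R (v - z)) - \<omega> z) / ?e i) \<longlonglongrightarrow> \<omega>' z \<bullet> (v - z)" .
next
  fix i :: nat
  let ?e = "1 / real (Suc i)"
  have cont: "continuous_on Z \<omega>" by (rule gradient_on_continuous[OF \<omega>_gradient])
  have "continuous_on Z (\<lambda>z. \<omega> (z + ?e *\<^sub>R (v - z)))"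
    using assms
    by (intro continuous_on_compose2[OF cont] continuous_intros) (auto intro!: segment_in_Z')
  then have "continuous_on Z (\<lambda>z. (\<omega> (z + ?e *\<^sub>R (v - z)) - \<omega> z) / ?e)"
    by (intro continuous_intros cont) auto
  then show "(\<lambda>z. (\<omega> (z + ?e *\<^sub>R (v - z)) - \<omega> z) / ?e) \<in> borel_measurable (restrict_space borel Z)"
    by (rule borel_measurable_continuous_on_restrict)
qed

text \<open>\<open>p\<close> is the orthogonal projection of \<open>\<omega>'\<close> onto the span
  of differences of points of \<open>Z\<close>. Its coordinates in an orthonormal basis are linear
  combinations of the directional derivatives already known to be measurable, and on such
  differences it acts as \<open>\<omega>'\<close>.\<close>

lemma measurable_tangential_gradient:
  obtains p where "p \<in> borel_measurable (restrict_space borel Z)"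
    and "\<And>z x y. z \<in> Z \<Longrightarrow> x \<in> Z \<Longrightarrow> y \<in> Z \<Longrightarrow> p z \<bullet> (y - x) = \<omega>' z \<bullet> (y - x)"
proof -
  define S where "S = span {y - x |x y. x \<in> Z \<and> y \<in> Z}"
  have meas: "(\<lambda>z. \<omega>' z \<bullet> d) \<in> borel_measurable (restrict_space borel Z)" if "d \<in> S" for d
    using that unfolding S_def
  proof (induction d rule: span_induct_alt)
    case (step c d e)
    then obtain x y where d: "d = y - x" "x \<in> Z" "y \<in> Z" by blast
    have "(\<lambda>z. \<omega>' z \<bullet> d) = (\<lambda>z. \<omega>' z \<bullet> (y - z) - \<omega>' z \<bullet> (x - z))"
      unfolding d(1) by (simp add: inner_diff_right)
    also have "\<dots> \<in> borel_measurable (restrict_space borel Z)"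
      using d by (intro borel_measurable_diff measurable_gradient_direction)
    finally show ?case
      using step(2) unfolding inner_add_right inner_scaleR_right by measurable
  qed simp
  have sub: "subspace S" by (simp add: S_def)
  obtain B where B: "B \<subseteq> S" "pairwise orthogonal B" "\<And>x. x \<in> B \<Longrightarrow> norm x = 1"
    "independent B" "span B = S"
    using orthonormal_basis_subspace[OF sub] by metis
  have fin: "finite B" using B(4) by (rule independent_imp_finite)
  let ?p = "\<lambda>z. \<Sum>b\<in>B. (\<omega>' z \<bullet> b) *\<^sub>R b"
  show thesis
  proof
    show "?p \<in> borel_measurable (restrict_space borel Z)"
      using B(1) by (intro borel_measurable_sum borel_measurable_scaleR meas) auto
    fix z x y assume "z \<in> Z" "x \<in> Z" "y \<in> Z"
    then have spn: "y - x \<in> span B" unfolding B(5) S_def by (intro span_base) blast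
    have "(\<Sum>b\<in>B. ((y - x) \<bullet> b) *\<^sub>R b) = y - x"
      by (rule orthonormal_basis_expand[OF B(2) B(3) spn fin])
    then have "\<omega>' z \<bullet> (y - x) = \<omega>' z \<bullet> (\<Sum>b\<in>B. ((y - x) \<bullet> b) *\<^sub>R b)"
      by (rule arg_cong[OF sym])
    also have "\<dots> = ?p z \<bullet> (y - x)"
      by (simp only: inner_sum_right inner_sum_left inner_scaleR_right inner_scaleR_left inner_commute
          mult.commute)
    finally show "?p z \<bullet> (y - x) = \<omega>' z \<bullet> (y - x)" by (rule sym)
  qed
qed

text \<open>On \<open>Z\<close>, changing the centre from \<open>z\<close> to a fixed
  \<open>z\<^sub>0\<close> alters the objective only by a linear term, which can be moved into
  \<open>\<eta>\<close>, and by a constant. Joint measurability then follows from the Lipschitz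
  dependence on \<open>\<eta>\<close> at \<open>z\<^sub>0\<close>, composed with the measurable
  shift built from \<open>p\<close>.\<close>

lemma measurable_prox_map:
  assumes J: "convex_on Z J" and wd: "prox_well_defined Z \<omega> \<omega>' J" and \<gamma>: "0 < \<gamma>"
  shows "(\<lambda>(z, \<eta>). prox_map Z \<omega> \<omega>' J \<gamma> z \<eta>)
    \<in> measurable (restrict_space borel Z \<Otimes>\<^sub>M borel) (restrict_space borel Z)"
proof -
  obtain p where p[measurable]: "p \<in> borel_measurable (restrict_space borel Z)"
    and p_eq: "\<And>z x y. z \<in> Z \<Longrightarrow> x \<in> Z \<Longrightarrow> y \<in> Z \<Longrightarrow> p z \<bullet> (y - x) = \<omega>' z \<bullet> (y - x)"
    using measurable_tangential_gradient by blast
  obtain z\<^sub>0 where z0: "z\<^sub>0 \<in> Z" using Z(1) by blast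
  let ?P = "prox_map Z \<omega> \<omega>' J \<gamma>"
  have shift: "?P z \<eta> = ?P z\<^sub>0 (\<eta> - p z + \<omega>' z\<^sub>0)" if z: "z \<in> Z" for z \<eta>
  proof (rule prox_map_eqI[OF wd z \<gamma>])
    let ?c = "\<eta> \<bullet> (z\<^sub>0 - z) - \<omega> z + \<omega> z\<^sub>0 + \<omega>' z \<bullet> (z - z\<^sub>0)"
    have "prox_objective \<omega> \<omega>' J \<gamma> z \<eta> u
        = prox_objective \<omega> \<omega>' J \<gamma> z\<^sub>0 (\<eta> - p z + \<omega>' z\<^sub>0) u + ?c" if "u \<in> Z" for u
      using p_eq[OF z z0 that]
      by (simp add: prox_objective_def prox_fun_def inner_diff_left inner_diff_right inner_add_left)
    then show "is_arg_min (prox_objective \<omega> \<omega>' J \<gamma> z \<eta>) (\<lambda>u. u \<in> Z) (?P z\<^sub>0 (\<eta> - p z + \<omega>' z\<^sub>0))"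
      using is_arg_min_prox_map[OF wd z0 \<gamma>, of "\<eta> - p z + \<omega>' z\<^sub>0"] by (simp add: is_arg_min_linorder)
  qed
  obtain C\<^sub>1 where C1: "0 < C\<^sub>1" "\<And>x. norm x \<le> C\<^sub>1 * nrm x" using norm_le_nrm by blast
  obtain C\<^sub>2 where C2: "0 < C\<^sub>2" "\<And>x. dual x \<le> C\<^sub>2 * norm x" using dual_le_norm by blast
  have "norm (?P z\<^sub>0 \<eta>\<^sub>1 - ?P z\<^sub>0 \<eta>\<^sub>2) \<le> C\<^sub>1 * (C\<^sub>2 * norm (\<eta>\<^sub>1 - \<eta>\<^sub>2) / \<mu>)" for \<eta>\<^sub>1 \<eta>\<^sub>2
  proof (rule order.trans[OF C1(2) mult_left_mono])
    have "\<mu> * nrm (?P z\<^sub>0 \<eta>\<^sub>1 - ?P z\<^sub>0 \<eta>\<^sub>2) \<le> C\<^sub>2 * norm (\<eta>\<^sub>1 - \<eta>\<^sub>2)"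
      using \<gamma> by (intro order.trans[OF prox_lipschitz[OF J _ is_arg_min_prox_map[OF wd z0 \<gamma>] is_arg_min_prox_map[OF wd z0 \<gamma>]] C2(2)])
        simp
    then show "nrm (?P z\<^sub>0 \<eta>\<^sub>1 - ?P z\<^sub>0 \<eta>\<^sub>2) \<le> C\<^sub>2 * norm (\<eta>\<^sub>1 - \<eta>\<^sub>2) / \<mu>"
      using \<mu> by (simp add: field_simps)
  qed (use C1 in simp)
  then have "(C\<^sub>1 * C\<^sub>2 / \<mu>)-lipschitz_on UNIV (?P z\<^sub>0)"
    using C1(1) C2(1) \<mu> by (intro lipschitz_onI) (simp_all add: dist_norm mult.assoc)
  then have [measurable]: "?P z\<^sub>0 \<in> borel_measurable borel"
    by (intro borel_measurable_continuous_onI lipschitz_on_continuous_on)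
  have "(\<lambda>x. ?P z\<^sub>0 (snd x - p (fst x) + \<omega>' z\<^sub>0)) \<in> borel_measurable (restrict_space borel Z \<Otimes>\<^sub>M borel)"
    by measurable
  then have "(\<lambda>(z, \<eta>). ?P z \<eta>) \<in> borel_measurable (restrict_space borel Z \<Otimes>\<^sub>M borel)"
  proof (rule measurable_cong[THEN iffD2, rotated])
    fix x :: "'a \<times> 'a" assume "x \<in> space (restrict_space borel Z \<Otimes>\<^sub>M borel)"
    then have "fst x \<in> Z" by (auto simp: space_pair_measure)
    from shift[OF this, of "snd x"]
    show "(case x of (z, \<eta>) \<Rightarrow> ?P z \<eta>) = ?P z\<^sub>0 (snd x - p (fst x) + \<omega>' z\<^sub>0)"
      by (simp only: split_beta)
  qed
  then show ?thesis
    by (rule measurable_restrict_space2[rotated]) (auto simp: space_pair_measure prox_map_in_Z[OF wd _ \<gamma>])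
qed

end

section \<open>One step of the method\<close>

locale amp_problem = prox_setup nrm Z \<omega> \<omega>' \<mu>
  for nrm :: "'a::euclidean_space \<Rightarrow> real" and Z \<omega> \<omega>' \<mu> +
  fixes G J :: "'a \<Rightarrow> real" and G' H J' :: "'a \<Rightarrow> 'a" and L\<^sub>G L\<^sub>H \<Omega> :: real
  assumes G_gradient: "gradient_on Z G G'" and G'_continuous: "continuous_on Z G'"
    and G_convex: "\<And>v w. v \<in> Z \<Longrightarrow> w \<in> Z \<Longrightarrow> 0 \<le> G w - G v - G' v \<bullet> (w - v)"
    and G_smooth: "\<And>v w. v \<in> Z \<Longrightarrow> w \<in> Z \<Longrightarrow>
           G w - G v - G' v \<bullet> (w - v) \<le> L\<^sub>G / 2 * (nrm (w - v))\<^sup>2"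
    and H_monotone: "\<And>v w. v \<in> Z \<Longrightarrow> w \<in> Z \<Longrightarrow> 0 \<le> (H w - H v) \<bullet> (w - v)"
    and H_lipschitz: "\<And>v w. v \<in> Z \<Longrightarrow> w \<in> Z \<Longrightarrow> dual_norm nrm (H w - H v) \<le> L\<^sub>H * nrm (w - v)"
    and J_convex: "convex_on Z J" and J_subgradient: "\<And>u. u \<in> Z \<Longrightarrow> J' u \<in> subdifferential Z J u"
    and prox_J: "prox_well_defined Z \<omega> \<omega>' J"
    and \<Omega>: "0 \<le> \<Omega>" "\<And>x y. x \<in> Z \<Longrightarrow> y \<in> Z \<Longrightarrow> prox_fun \<omega> \<omega>' x y \<le> \<Omega>\<^sup>2"
begin

abbreviation Q :: "'a \<Rightarrow> 'a \<Rightarrow> real" where "Q \<equiv> gap_Q G H J"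
abbreviation gap :: "'a \<Rightarrow> real" where "gap \<equiv> gap_fun Z G H J"

text \<open>A bound on the \<open>nrm\<close>-diameter of \<open>Z\<close>, forced by strong
  convexity and the bound on the prox-function. It supplies the factor
  \<open>\<Omega> * sqrt (2 / \<mu>)\<close> of \<open>amp_Q1\<close>.\<close>

definition diam :: real where "diam = sqrt (2 / \<mu>) * \<Omega>"

lemma nrm_le_diam: "x \<in> Z \<Longrightarrow> y \<in> Z \<Longrightarrow> nrm (x - y) \<le> diam"
proof -
  assume "x \<in> Z" "y \<in> Z"
  then have "\<mu> / 2 * (nrm (x - y))\<^sup>2 \<le> \<Omega>\<^sup>2"
    using prox_fun_lower[of y x] \<Omega>(2)[of y x] by simp
  then have "(nrm (x - y))\<^sup>2 \<le> diam\<^sup>2"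
    using \<mu> by (simp add: diam_def power_mult_distrib field_simps)
  then show ?thesis
    by (rule power2_le_imp_le) (use \<Omega>(1) \<mu> in \<open>simp add: diam_def\<close>)
qed

lemma diam_nonneg: "0 \<le> diam"
  using \<Omega>(1) \<mu> by (simp add: diam_def)

lemma bounded_Z: "bounded Z"
proof -
  obtain x where x: "x \<in> Z" using Z(1) by blast
  obtain c where c: "0 < c" "\<And>x. norm x \<le> c * nrm x" using norm_le_nrm by blast
  have "dist x y \<le> c * diam" if "y \<in> Z" for y
    unfolding dist_norm
    by (rule order.trans[OF c(2) mult_left_mono[OF nrm_le_diam[OF x that]]]) (use c(1) in simp)
  then show ?thesis unfolding bounded_def by blast
qed

lemma prox_zero: "prox_well_defined Z \<omega> \<omega>' (\<lambda>_. 0)"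
  using bounded_Z by (rule prox_well_defined_zero)

lemma zero_convex: "convex_on Z (\<lambda>_. 0 :: real)"
  using Z(3) by (simp add: convex_on_def)

lemma H_continuous: "continuous_on Z H"
proof -
  obtain C where C: "0 < C" "\<And>x. norm x \<le> C * dual x" using norm_le_dual by blast
  obtain B where B: "0 < B" "\<And>x. nrm x \<le> B * norm x" using nrm_le_norm by blast
  have "norm (H w - H v) \<le> C * \<bar>L\<^sub>H\<bar> * B * norm (w - v)" if "w \<in> Z" "v \<in> Z" for w v
  proof -
    have "norm (H w - H v) \<le> C * dual (H w - H v)" by (rule C)
    also have "\<dots> \<le> C * (\<bar>L\<^sub>H\<bar> * (B * norm (w - v)))"
    proof (intro mult_left_mono)
      have "L\<^sub>H * nrm (w - v) \<le> \<bar>L\<^sub>H\<bar> * nrm (w - v)" by (intro mult_right_mono) auto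
      also have "\<dots> \<le> \<bar>L\<^sub>H\<bar> * (B * norm (w - v))" by (intro mult_left_mono B) auto
      finally show "dual (H w - H v) \<le> \<bar>L\<^sub>H\<bar> * (B * norm (w - v))"
        using H_lipschitz[OF that(2,1)] by linarith
    qed (use C in simp)
    finally show ?thesis by (simp add: mult.assoc)
  qed
  then have "(C * \<bar>L\<^sub>H\<bar> * B)-lipschitz_on Z H"
    using C(1) B(1) by (intro lipschitz_onI) (simp_all add: dist_norm)
  then show ?thesis by (rule lipschitz_on_continuous_on)
qed

lemma J_lower: "u \<in> Z \<Longrightarrow> v \<in> Z \<Longrightarrow> J u + J' u \<bullet> (v - u) \<le> J v"
  using J_subgradient by (auto simp: subdifferential_def)

text \<open>Monotonicity moves \<open>H\<close> from \<open>u\<close> to \<open>v\<close>, and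
  \<open>G\<close> and \<open>J\<close> are linearised at \<open>v\<close>. The bound is affine in
  \<open>u\<close>, so on the bounded set \<open>Z\<close> the supremum defining the gap is
  finite.\<close>

lemma Q_le: 
  assumes "u \<in> Z" "v \<in> Z"
  shows "Q v u \<le> (H v + G' v + J' v) \<bullet> (v - u)"
  using H_monotone[OF assms] G_convex[OF assms(2,1)] J_lower[OF assms(2,1)]
  by (simp add: gap_Q_def inner_diff_left inner_diff_right inner_add_left)

lemma bdd_above_Q: "v \<in> Z \<Longrightarrow> bdd_above (Q v ` Z)"
proof (rule bdd_aboveI2)
  fix u assume "v \<in> Z" "u \<in> Z"
  then have "Q v u \<le> (H v + G' v + J' v) \<bullet> (v - u)" by (intro Q_le)
  also have "\<dots> \<le> dual (H v + G' v + J' v) * nrm (v - u)" by (rule inner_le_dual)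
  also have "\<dots> \<le> dual (H v + G' v + J' v) * diam"
    using \<open>v \<in> Z\<close> \<open>u \<in> Z\<close> by (intro mult_left_mono nrm_le_diam) auto
  finally show "Q v u \<le> dual (H v + G' v + J' v) * diam" .
qed

text \<open>The choice \<open>u = v\<close> makes \<open>Q\<close> vanish. This lower bound lets the
  upper bound \<open>gap_bound\<close> serve as a dominating function for integrability.\<close>

lemma gap_nonneg: "v \<in> Z \<Longrightarrow> 0 \<le> gap v"
  unfolding gap_fun_def
  using cSUP_upper[OF _ bdd_above_Q, of v v] by (simp add: gap_Q_def)

lemma gap_leI: "(\<And>u. u \<in> Z \<Longrightarrow> Q v u \<le> B) \<Longrightarrow> gap v \<le> B"
  unfolding gap_fun_def using Z(1) by (rule cSUP_least)

text \<open>\<open>J\<close> need not be continuous on \<open>Z\<close>, but it is the supremum of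
  its affine minorants, one for each subgradient \<open>J' x\<close>. Each of them gives a
  continuous function of \<open>v\<close>, hence a relatively open superlevel set.\<close>

lemma Q_superlevel_open: "\<exists>U. open U \<and> {v \<in> Z. a < Q v u} = U \<inter> Z"
proof -
  let ?F = "\<lambda>x v. G v - G u + H u \<bullet> (v - u) + (J x + J' x \<bullet> (v - x)) - J u"
  have "{v \<in> Z. a < Q v u} = (\<Union>x\<in>Z. {v \<in> Z. a < ?F x v})"
  proof safe
    fix v assume "v \<in> Z" "a < Q v u"
    then show "v \<in> (\<Union>x\<in>Z. {v \<in> Z. a < ?F x v})"
      by (intro UN_I[of v]) (auto simp: gap_Q_def)
  next
    fix v x assume "x \<in> Z" "v \<in> Z" "a < ?F x v"
    then show "a < Q v u" using J_lower[of x v] by (simp add: gap_Q_def)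
  qed
  moreover have "openin (top_of_set Z) {v \<in> Z. a < ?F x v}" for x
  proof -
    have "continuous_on Z (?F x)"
      by (intro continuous_intros gradient_on_continuous[OF G_gradient])
    then have "openin (top_of_set Z) (Z \<inter> ?F x -` {a<..})"
      by (rule continuous_openin_preimage_gen) simp
    then show ?thesis by (simp add: Int_def vimage_def)
  qed
  ultimately have "openin (top_of_set Z) {v \<in> Z. a < Q v u}" by auto
  then show ?thesis by (auto simp: openin_open)
qed

lemma gap_superlevel_open: "\<exists>U. open U \<and> {v \<in> Z. a < gap v} = U \<inter> Z"
proof -
  have "{v \<in> Z. a < gap v} = (\<Union>u\<in>Z. {v \<in> Z. a < Q v u})"
    using less_cSUP_iff[OF Z(1) bdd_above_Q] by (auto simp: gap_fun_def)
  moreover have "openin (top_of_set Z) {v \<in> Z. a < Q v u}" for u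
    using Q_superlevel_open[of a u] by (auto simp: openin_open)
  ultimately have "openin (top_of_set Z) {v \<in> Z. a < gap v}" by auto
  then show ?thesis by (auto simp: openin_open)
qed

text \<open>Smoothness is applied at \<open>md\<close>, whose distance to the new average is
  \<alpha> times that of \<open>w\<close> and \<open>r\<close>; this yields the factor
  \<open>\<alpha>\<^sup>2\<close>. Monotonicity replaces \<open>H u\<close> by \<open>H w\<close>,
  the operator value that the method samples.\<close>

lemma Q_averaging:
  assumes Z': "r \<in> Z" "y \<in> Z" "w \<in> Z" "u \<in> Z" and \<alpha>: "0 \<le> \<alpha>" "\<alpha> \<le> 1"
    and md: "md = (1 - \<alpha>) *\<^sub>R y + \<alpha> *\<^sub>R r"
  shows "Q ((1 - \<alpha>) *\<^sub>R y + \<alpha> *\<^sub>R w) u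
    \<le> (1 - \<alpha>) * Q y u + \<alpha> * ((G' md + H w) \<bullet> (w - u) + J w - J u) + L\<^sub>G / 2 * (\<alpha>\<^sup>2 * (nrm (w - r))\<^sup>2)"
proof -
  let ?y' = "(1 - \<alpha>) *\<^sub>R y + \<alpha> *\<^sub>R w"
  have mdZ: "md \<in> Z" and y'Z: "?y' \<in> Z"
    unfolding md using assms by (auto intro!: segment_in_Z)
  have diff: "?y' - md = \<alpha> *\<^sub>R (w - r)" by (simp add: md algebra_simps)
  have "G ?y' \<le> G md + G' md \<bullet> (?y' - md) + L\<^sub>G / 2 * (nrm (?y' - md))\<^sup>2"
    using G_smooth[OF mdZ y'Z] by linarith
  also have "(nrm (?y' - md))\<^sup>2 = \<alpha>\<^sup>2 * (nrm (w - r))\<^sup>2"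
    unfolding diff by (simp add: power_mult_distrib)
  \<comment> \<open>The linearisation at \<open>md\<close> is split along the average of
    \<open>y\<close> and \<open>w\<close>, with \<open>w - md\<close> routed through
    \<open>u\<close>; convexity then bounds the parts at \<open>y\<close> and at \<open>u\<close> by
    values of \<open>G\<close>.\<close>
  also have "G md + G' md \<bullet> (?y' - md)
      = (1 - \<alpha>) * (G md + G' md \<bullet> (y - md)) + \<alpha> * (G md + G' md \<bullet> (u - md) + G' md \<bullet> (w - u))"
    by (simp add: inner_diff_right inner_add_right algebra_simps)
  finally have 1: "G ?y' \<le> (1 - \<alpha>) * (G md + G' md \<bullet> (y - md))
      + \<alpha> * (G md + G' md \<bullet> (u - md) + G' md \<bullet> (w - u)) + L\<^sub>G / 2 * (\<alpha>\<^sup>2 * (nrm (w - r))\<^sup>2)" .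
  have 2: "(1 - \<alpha>) * (G md + G' md \<bullet> (y - md)) \<le> (1 - \<alpha>) * G y"
    using G_convex[OF mdZ Z'(2)] \<alpha> by (intro mult_left_mono) auto
  have 3: "\<alpha> * (G md + G' md \<bullet> (u - md) + G' md \<bullet> (w - u)) \<le> \<alpha> * (G u + G' md \<bullet> (w - u))"
    using G_convex[OF mdZ Z'(4)] \<alpha> by (intro mult_left_mono) auto
  have 4: "\<alpha> * (H u \<bullet> (w - u)) \<le> \<alpha> * (H w \<bullet> (w - u))"
    using H_monotone[OF Z'(4,3)] \<alpha> by (intro mult_left_mono) (auto simp: inner_diff_left)
  have 5: "J ?y' \<le> (1 - \<alpha>) * J y + \<alpha> * J w"
    using convex_onD[OF J_convex, of \<alpha> y w] \<alpha> Z' by simp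
  have 6: "H u \<bullet> (?y' - u) = (1 - \<alpha>) * (H u \<bullet> (y - u)) + \<alpha> * (H u \<bullet> (w - u))"
    by (simp add: inner_diff_right inner_add_right algebra_simps)
  have "Q ?y' u = G ?y' - G u + H u \<bullet> (?y' - u) + J ?y' - J u" by (simp add: gap_Q_def)
  also have "\<dots> \<le> (1 - \<alpha>) * G y + \<alpha> * (G u + G' md \<bullet> (w - u)) + L\<^sub>G / 2 * (\<alpha>\<^sup>2 * (nrm (w - r))\<^sup>2)
      - G u + (1 - \<alpha>) * (H u \<bullet> (y - u)) + \<alpha> * (H w \<bullet> (w - u)) + (1 - \<alpha>) * J y + \<alpha> * J w - J u"
    using 1 2 3 4 5 6 by linarith
  also have "\<dots> = (1 - \<alpha>) * Q y u + \<alpha> * ((G' md + H w) \<bullet> (w - u) + J w - J u)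
      + L\<^sub>G / 2 * (\<alpha>\<^sup>2 * (nrm (w - r))\<^sup>2)"
    by (simp add: gap_Q_def inner_add_left algebra_simps)
  finally show ?thesis .
qed

text \<open>The first prox step is tested at \<open>r'\<close> and the second at \<open>u\<close>,
  so \<open>V r r'\<close> cancels. Using \<open>h\<close> instead of \<open>k\<close> in the first
  step costs an inner product with \<open>r' - w\<close>, which \<open>V w r'\<close> absorbs;
  \<open>V r w\<close> is kept for later use.\<close>

lemma extragradient_step:
  assumes rZ: "r \<in> Z" and u: "u \<in> Z" and \<gamma>: "0 < \<gamma>"
    and w: "w = prox_map Z \<omega> \<omega>' J \<gamma> r (\<gamma> *\<^sub>R h + \<gamma> *\<^sub>R g)"
    and r': "r' = prox_map Z \<omega> \<omega>' J \<gamma> r (\<gamma> *\<^sub>R k + \<gamma> *\<^sub>R g)"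
  shows "\<gamma> * ((k + g) \<bullet> (w - u) + J w - J u)
    \<le> V r u - V r' u - V r w + \<gamma>\<^sup>2 * (dual (k - h))\<^sup>2 / (2 * \<mu>)"
proof -
  have wZ: "w \<in> Z" and r'Z: "r' \<in> Z"
    unfolding w r' using prox_map_in_Z[OF prox_J rZ \<gamma>] by auto
  have 1: "(\<gamma> *\<^sub>R h + \<gamma> *\<^sub>R g) \<bullet> (w - r') + \<gamma> * (J w - J r') \<le> V r r' - V r w - V w r'"
    unfolding w using \<gamma> r'Z by (intro prox_three_point[OF J_convex] is_arg_min_prox_map prox_J rZ) auto
  have 2: "(\<gamma> *\<^sub>R k + \<gamma> *\<^sub>R g) \<bullet> (r' - u) + \<gamma> * (J r' - J u) \<le> V r u - V r r' - V r' u"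
    unfolding r' using \<gamma> u by (intro prox_three_point[OF J_convex] is_arg_min_prox_map prox_J rZ) auto
  have "(\<gamma> *\<^sub>R (h - k)) \<bullet> (r' - w) \<le> V w r' + (dual (\<gamma> *\<^sub>R (h - k)))\<^sup>2 / (2 * \<mu>)"
    by (rule inner_le_prox_fun[OF wZ r'Z])
  moreover have "(dual (\<gamma> *\<^sub>R (h - k)))\<^sup>2 / (2 * \<mu>) \<le> \<gamma>\<^sup>2 * (dual (k - h))\<^sup>2 / (2 * \<mu>)"
    using power_mono[OF dual_scaleR[of \<gamma> "h - k"], of 2] \<gamma> \<mu>
    by (intro divide_right_mono) (auto simp: power_mult_distrib dual_minus_commute)
  ultimately have 3: "(\<gamma> *\<^sub>R (h - k)) \<bullet> (r' - w) \<le> V w r' + \<gamma>\<^sup>2 * (dual (k - h))\<^sup>2 / (2 * \<mu>)"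
    by linarith
  have "\<gamma> * ((k + g) \<bullet> (w - u) + J w - J u) =
      ((\<gamma> *\<^sub>R h + \<gamma> *\<^sub>R g) \<bullet> (w - r') + \<gamma> * (J w - J r'))
      + ((\<gamma> *\<^sub>R k + \<gamma> *\<^sub>R g) \<bullet> (r' - u) + \<gamma> * (J r' - J u)) + (\<gamma> *\<^sub>R (h - k)) \<bullet> (r' - w)"
    by (simp add: inner_diff_left inner_diff_right inner_add_left algebra_simps)
  with 1 2 3 show ?thesis by linarith
qed

text \<open>The virtual prox step makes the noise term at an arbitrary \<open>u\<close> comparable to one at a point \<open>x\<close>
  that is independent of the noise.\<close>

lemma virtual_step:
  assumes x: "x \<in> Z" and u: "u \<in> Z" and \<gamma>: "0 < \<gamma>"
    and x': "x' = prox_map Z \<omega> \<omega>' (\<lambda>_. 0) \<gamma> x (- \<gamma> *\<^sub>R d)"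
  shows "- \<gamma> * (d \<bullet> (x - u)) \<le> V x u - V x' u + \<gamma>\<^sup>2 * (dual d)\<^sup>2 / (2 * \<mu>)"
proof -
  have x'Z: "x' \<in> Z" unfolding x' by (rule prox_map_in_Z[OF prox_zero x \<gamma>])
  have 1: "(- \<gamma> *\<^sub>R d) \<bullet> (x' - u) + \<gamma> * (0 - 0) \<le> V x u - V x x' - V x' u"
    unfolding x' using \<gamma> u by (intro prox_three_point[OF zero_convex] is_arg_min_prox_map prox_zero x) auto
  have "(\<gamma> *\<^sub>R d) \<bullet> (x' - x) \<le> V x x' + (dual (\<gamma> *\<^sub>R d))\<^sup>2 / (2 * \<mu>)"
    by (rule inner_le_prox_fun[OF x x'Z])
  moreover have "(dual (\<gamma> *\<^sub>R d))\<^sup>2 / (2 * \<mu>) \<le> \<gamma>\<^sup>2 * (dual d)\<^sup>2 / (2 * \<mu>)"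
    using power_mono[OF dual_scaleR[of \<gamma> d], of 2] \<gamma> \<mu>
    by (intro divide_right_mono) (auto simp: power_mult_distrib)
  ultimately show ?thesis
    using 1 by (simp add: inner_diff_right algebra_simps)
qed

text \<open>Origin of the coefficients: the three-term split of \<open>k - h\<close> over
  \<open>2 * \<mu>\<close> gives 3/2 for both \<open>H\<close>-errors; the virtual step adds 1 for
  \<open>k\<close> and 1 for \<open>g\<close>; Young's inequality in \<open>cross\<close> adds
  \<open>1 / (2 * (1 - q))\<close> for \<open>g\<close>. The point \<open>x\<close> is the current
  point of the virtual sequence.\<close>

lemma Q_step:
  assumes rZ: "r \<in> Z" and y: "y \<in> Z" and x: "x \<in> Z" and u: "u \<in> Z" and \<gamma>: "0 < \<gamma>"
    and \<alpha>: "0 \<le> \<alpha>" "\<alpha> \<le> 1" and q: "0 < q" "q < 1"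
    and stepsize: "0 \<le> q * \<mu> - L\<^sub>G * \<alpha> * \<gamma> - 3 * L\<^sub>H\<^sup>2 * \<gamma>\<^sup>2 / \<mu>"
    and w: "w = prox_map Z \<omega> \<omega>' J \<gamma> r (\<gamma> *\<^sub>R h + \<gamma> *\<^sub>R g)"
    and r': "r' = prox_map Z \<omega> \<omega>' J \<gamma> r (\<gamma> *\<^sub>R k + \<gamma> *\<^sub>R g)"
    and md: "md = (1 - \<alpha>) *\<^sub>R y + \<alpha> *\<^sub>R r"
    and x': "x' = prox_map Z \<omega> \<omega>' (\<lambda>_. 0) \<gamma> x (- \<gamma> *\<^sub>R ((k - H w) + (g - G' md)))"
  shows "Q ((1 - \<alpha>) *\<^sub>R y + \<alpha> *\<^sub>R w) u \<le> (1 - \<alpha>) * Q y u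
    + \<alpha> / \<gamma> * (V r u + V x u - (V r' u + V x' u))
    + \<alpha> * \<gamma> / \<mu> * (3 / 2 * (dual (h - H r))\<^sup>2 + 5 / 2 * (dual (k - H w))\<^sup>2
        + (1 + 1 / (2 * (1 - q))) * (dual (g - G' md))\<^sup>2)
    - \<alpha> * ((k - H w) \<bullet> (w - x) + (g - G' md) \<bullet> (r - x))"
proof -
  define dh dk dg where "dh = h - H r" and "dk = k - H w" and "dg = g - G' md"
  have wZ: "w \<in> Z" unfolding w using prox_map_in_Z[OF prox_J rZ \<gamma>] .
  define n where "n = (nrm (w - r))\<^sup>2"
  define a b c where "a = (dual dh)\<^sup>2" and "b = (dual dk)\<^sup>2" and "c = (dual dg)\<^sup>2"
  have kh: "(dual (k - h))\<^sup>2 \<le> 3 * (L\<^sub>H\<^sup>2 * n + a + b)"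
  proof -
    have "k - h = (H w - H r) + (- dh) + dk" by (simp add: dh_def dk_def)
    then have "(dual (k - h))\<^sup>2 \<le> 3 * ((dual (H w - H r))\<^sup>2 + a + b)"
      using dual_add3_power2[of "H w - H r" "- dh" dk] by (simp add: a_def b_def)
    moreover have "(dual (H w - H r))\<^sup>2 \<le> L\<^sub>H\<^sup>2 * n"
      using power_mono[OF H_lipschitz[OF rZ wZ] dual_nonneg, of 2]
      by (simp add: n_def power_mult_distrib)
    ultimately show ?thesis by simp
  qed
  have extra: "\<gamma> * ((k + g) \<bullet> (w - u) + J w - J u)
      \<le> V r u - V r' u - \<mu> / 2 * n + \<gamma>\<^sup>2 * (3 * (L\<^sub>H\<^sup>2 * n + a + b)) / (2 * \<mu>)"
  proof -
    have "\<gamma>\<^sup>2 * (dual (k - h))\<^sup>2 / (2 * \<mu>) \<le> \<gamma>\<^sup>2 * (3 * (L\<^sub>H\<^sup>2 * n + a + b)) / (2 * \<mu>)"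
      using kh \<mu> by (intro divide_right_mono mult_left_mono) auto
    moreover have "\<mu> / 2 * n \<le> V r w" unfolding n_def by (rule prox_fun_lower[OF rZ wZ])
    ultimately show ?thesis using extragradient_step[OF rZ u \<gamma> w r'] by linarith
  qed
  have virt: "- \<gamma> * ((dk + dg) \<bullet> (x - u)) \<le> V x u - V x' u + \<gamma>\<^sup>2 * (2 * (b + c)) / (2 * \<mu>)"
  proof -
    have "\<gamma>\<^sup>2 * (dual (dk + dg))\<^sup>2 / (2 * \<mu>) \<le> \<gamma>\<^sup>2 * (2 * (b + c)) / (2 * \<mu>)"
      using dual_add_power2[of dk dg] \<mu> unfolding b_def c_def
      by (intro divide_right_mono mult_left_mono) auto
    then show ?thesis
      using virtual_step[OF x u \<gamma> x'] unfolding dk_def dg_def by linarith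
  qed
  \<comment> \<open>The weight \<open>(1 - q) * \<mu>\<close> is the part of the strong convexity
    that the stepsize condition leaves free.\<close>
  have cross: "- \<gamma> * (dg \<bullet> (w - r)) \<le> (1 - q) * \<mu> / 2 * n + \<gamma>\<^sup>2 * c / (2 * ((1 - q) * \<mu>))"
  proof -
    let ?m = "(1 - q) * \<mu>"
    have m: "0 < ?m" using q \<mu> by simp
    have young: "x * y \<le> m / 2 * x\<^sup>2 + y\<^sup>2 / (2 * m)" if "0 < m" for x y m :: real
      using that zero_le_power2[of "m * x - y"] by (simp add: field_simps power2_eq_square)
    have "- (dg \<bullet> (w - r)) \<le> dual dg * nrm (w - r)"
      using abs_inner_le_dual[of dg "w - r"] by linarith
    from mult_left_mono[OF this, of \<gamma>] \<gamma>
    have "- \<gamma> * (dg \<bullet> (w - r)) \<le> \<gamma> * (dual dg * nrm (w - r))" by linarith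
    also have "\<dots> \<le> ?m / 2 * n + \<gamma>\<^sup>2 * c / (2 * ?m)"
      using young[OF m, of "nrm (w - r)" "\<gamma> * dual dg"]
      by (simp add: n_def c_def power_mult_distrib algebra_simps)
    finally show ?thesis .
  qed
  \<comment> \<open>All multiples of the squared step \<open>n\<close>: smoothness of
    \<open>G\<close>, the lower bound on \<open>V r w\<close>, the Lipschitz part of
    \<open>k - h\<close>, and \<open>cross\<close>. Their sum is minus the stepsize expression times
    \<open>\<alpha> / (2 * \<gamma>) * n\<close>.\<close>
  have stepsize': "L\<^sub>G / 2 * (\<alpha>\<^sup>2 * n) + \<alpha> / \<gamma> * (- \<mu> / 2 * n + \<gamma>\<^sup>2 * (3 * (L\<^sub>H\<^sup>2 * n)) / (2 * \<mu>)
      + (1 - q) * \<mu> / 2 * n) \<le> 0"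
  proof -
    have "0 \<le> \<alpha> / (2 * \<gamma>) * n * (q * \<mu> - L\<^sub>G * \<alpha> * \<gamma> - 3 * L\<^sub>H\<^sup>2 * \<gamma>\<^sup>2 / \<mu>)"
      using stepsize \<alpha> \<gamma> by (intro mult_nonneg_nonneg) (auto simp: n_def)
    also have "\<dots> = - (L\<^sub>G / 2 * (\<alpha>\<^sup>2 * n) + \<alpha> / \<gamma> * (- \<mu> / 2 * n + \<gamma>\<^sup>2 * (3 * (L\<^sub>H\<^sup>2 * n)) / (2 * \<mu>)
      + (1 - q) * \<mu> / 2 * n))"
      using \<gamma> \<mu> by (simp add: field_simps power2_eq_square)
    finally show ?thesis by simp
  qed
  let ?S = "V r u - V r' u - \<mu> / 2 * n + \<gamma>\<^sup>2 * (3 * (L\<^sub>H\<^sup>2 * n + a + b)) / (2 * \<mu>)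
      + (V x u - V x' u + \<gamma>\<^sup>2 * (2 * (b + c)) / (2 * \<mu>))
      + ((1 - q) * \<mu> / 2 * n + \<gamma>\<^sup>2 * c / (2 * ((1 - q) * \<mu>)))"
  \<comment> \<open>The error of \<open>H\<close> at \<open>w - u\<close> is split at
    \<open>x\<close>, and the error of \<open>G\<close> at \<open>w - u\<close> is split at
    \<open>r\<close> and \<open>x\<close>: the parts at \<open>x - u\<close> go to the virtual step,
    the part at \<open>w - r\<close> to \<open>cross\<close>, and the others become martingale
    increments.\<close>
  have "\<gamma> * ((G' md + H w) \<bullet> (w - u) + J w - J u + (dk \<bullet> (w - x) + dg \<bullet> (r - x)))
      = \<gamma> * ((k + g) \<bullet> (w - u) + J w - J u) + - \<gamma> * ((dk + dg) \<bullet> (x - u)) + - \<gamma> * (dg \<bullet> (w - r))"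
    by (simp add: dk_def dg_def inner_diff_left inner_diff_right inner_add_left algebra_simps)
  also have "\<dots> \<le> ?S" using extra virt cross by linarith
  finally have "(G' md + H w) \<bullet> (w - u) + J w - J u + (dk \<bullet> (w - x) + dg \<bullet> (r - x)) \<le> ?S / \<gamma>"
    using \<gamma> by (simp add: pos_le_divide_eq mult.commute)
  then have "\<alpha> * ((G' md + H w) \<bullet> (w - u) + J w - J u + (dk \<bullet> (w - x) + dg \<bullet> (r - x))) \<le> \<alpha> * (?S / \<gamma>)"
    using \<alpha>(1) by (rule mult_left_mono)
  moreover have "\<alpha> * (?S / \<gamma>) = \<alpha> / \<gamma> * (V r u + V x u - (V r' u + V x' u))
      + \<alpha> * \<gamma> / \<mu> * (3 / 2 * a + 5 / 2 * b + (1 + 1 / (2 * (1 - q))) * c)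
      + \<alpha> / \<gamma> * (- \<mu> / 2 * n + \<gamma>\<^sup>2 * (3 * (L\<^sub>H\<^sup>2 * n)) / (2 * \<mu>) + (1 - q) * \<mu> / 2 * n)"
  proof -
    have "?S = V r u + V x u - (V r' u + V x' u)
        + (- \<mu> / 2 * n + \<gamma>\<^sup>2 * (3 * (L\<^sub>H\<^sup>2 * n)) / (2 * \<mu>) + (1 - q) * \<mu> / 2 * n)
        + \<gamma> * (\<gamma> / \<mu> * (3 / 2 * a + 5 / 2 * b + (1 + 1 / (2 * (1 - q))) * c))"
    proof -
      have "\<gamma>\<^sup>2 * (3 * (L\<^sub>H\<^sup>2 * n + a + b)) / (2 * \<mu>)
          = \<gamma>\<^sup>2 * (3 * (L\<^sub>H\<^sup>2 * n)) / (2 * \<mu>) + \<gamma> * (\<gamma> / \<mu> * (3 / 2 * a + 3 / 2 * b))"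
        and "\<gamma>\<^sup>2 * (2 * (b + c)) / (2 * \<mu>) = \<gamma> * (\<gamma> / \<mu> * (b + c))"
        and "\<gamma>\<^sup>2 * c / (2 * ((1 - q) * \<mu>)) = \<gamma> * (\<gamma> / \<mu> * (1 / (2 * (1 - q)) * c))"
        using \<mu> q by (simp_all add: power2_eq_square field_simps)
      then show ?thesis by (simp add: distrib_left distrib_right)
    qed
    then have "?S / \<gamma> = (V r u + V x u - (V r' u + V x' u)) / \<gamma>
        + (- \<mu> / 2 * n + \<gamma>\<^sup>2 * (3 * (L\<^sub>H\<^sup>2 * n)) / (2 * \<mu>) + (1 - q) * \<mu> / 2 * n) / \<gamma>
        + \<gamma> / \<mu> * (3 / 2 * a + 5 / 2 * b + (1 + 1 / (2 * (1 - q))) * c)"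
      using \<gamma> by (simp only: add_divide_distrib) simp
    moreover have "\<alpha> * (A / \<gamma> + B / \<gamma> + \<gamma> / \<mu> * C) = \<alpha> / \<gamma> * A + \<alpha> * \<gamma> / \<mu> * C + \<alpha> / \<gamma> * B" for A B C
      by (simp add: algebra_simps)
    ultimately show ?thesis by presburger
  qed
  ultimately show ?thesis
    using Q_averaging[OF rZ y wZ u \<alpha> md] stepsize'
    unfolding n_def[symmetric] dh_def[symmetric] dk_def[symmetric] dg_def[symmetric]
      a_def[symmetric] b_def[symmetric] c_def[symmetric]
    by (simp add: distrib_left)
qed

end

section \<open>Moments and tails of the oracle noise\<close>

context prob_space
begin

text \<open>The oracle assumptions concern deterministic inputs; freezing transfers a bound uniform
  in the input to inputs computed from the past.\<close>

lemma expectation_indep_sample_le: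
  fixes h :: "'c \<times> 'b \<Rightarrow> real"
  assumes ind: "indep_sample F N Y" and X: "X \<in> measurable F S"
    and h[measurable]: "h \<in> borel_measurable (S \<Otimes>\<^sub>M N)" and nonneg: "\<And>x. 0 \<le> h x"
    and le: "\<And>x. x \<in> space S \<Longrightarrow> integrable M (\<lambda>s. h (x, Y s)) \<and> expectation (\<lambda>s. h (x, Y s)) \<le> c"
  shows "integrable M (\<lambda>s. h (X s, Y s))" and "expectation (\<lambda>s. h (X s, Y s)) \<le> c"
proof -
  have sub: "subalgebra M F" and Y[measurable]: "Y \<in> measurable M N"
    using ind by (auto simp: indep_sample_def)
  have XM[measurable]: "X \<in> measurable M S" using measurable_from_subalg[OF sub X] .
  have X_space: "X s \<in> space S" if "s \<in> space M" for s using measurable_space[OF XM that] .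
  obtain s where "s \<in> space M" using not_empty by blast
  then have "0 \<le> expectation (\<lambda>s'. h (X s, Y s'))" "expectation (\<lambda>s'. h (X s, Y s')) \<le> c"
    using nonneg le[OF X_space] by auto
  then have c: "0 \<le> c" by linarith
  have "(\<integral>\<^sup>+ s. ennreal (h (X s, Y s)) \<partial>M) = (\<integral>\<^sup>+ s. (\<integral>\<^sup>+ s'. ennreal (h (X s, Y s')) \<partial>M) \<partial>M)"
    by (rule nn_integral_indep_sample[OF ind X]) measurable
  also have "\<dots> \<le> (\<integral>\<^sup>+ s. ennreal c \<partial>M)"
  proof (rule nn_integral_mono)
    fix s assume "s \<in> space M"
    from le[OF X_space[OF this]] show "(\<integral>\<^sup>+ s'. ennreal (h (X s, Y s')) \<partial>M) \<le> ennreal c"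
      by (subst nn_integral_eq_integral) (auto simp: nonneg ennreal_leI)
  qed
  also have "\<dots> = ennreal c" by (simp add: emeasure_space_1)
  finally have bound: "(\<integral>\<^sup>+ s. ennreal (h (X s, Y s)) \<partial>M) \<le> ennreal c" .
  show int: "integrable M (\<lambda>s. h (X s, Y s))"
  proof (rule integrableI_bounded)
    show "(\<integral>\<^sup>+ s. ennreal (norm (h (X s, Y s))) \<partial>M) < \<infinity>"
      using bound nonneg by (simp add: order.strict_trans1[OF _ ennreal_less_top])
  qed measurable
  show "expectation (\<lambda>s. h (X s, Y s)) \<le> c"
    using bound c nonneg by (subst (asm) nn_integral_eq_integral[OF int]) auto
qed

text \<open>Normalised weights form a convex combination, so the exponential of the weighted sum is
  at most the weighted sum of exponentials and dependence among the \<open>X i\<close> is harmless.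
  Markov's inequality at level \<open>exp (1 + l)\<close> leaves \<open>exp (- l)\<close>.\<close>

lemma prob_weighted_sum_squares_gt:
  fixes X :: "'i \<Rightarrow> 'a \<Rightarrow> real"
  assumes I: "finite I" and c: "\<And>i. i \<in> I \<Longrightarrow> 0 \<le> c i" and A: "0 < sum c I"
    and X[measurable]: "\<And>i. i \<in> I \<Longrightarrow> X i \<in> borel_measurable M"
    and exp_X: "\<And>i. i \<in> I \<Longrightarrow> integrable M (\<lambda>s. exp ((X i s)\<^sup>2 / \<sigma>\<^sup>2))"
      "\<And>i. i \<in> I \<Longrightarrow> expectation (\<lambda>s. exp ((X i s)\<^sup>2 / \<sigma>\<^sup>2)) \<le> exp 1"
    and \<sigma>: "0 < \<sigma>"
  shows "prob {s \<in> space M. (\<Sum>i\<in>I. c i * (X i s)\<^sup>2) > (1 + l) * \<sigma>\<^sup>2 * sum c I} \<le> exp (- l)"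
proof -
  let ?A = "sum c I"
  let ?R = "\<lambda>s. \<Sum>i\<in>I. c i / ?A * exp ((X i s)\<^sup>2 / \<sigma>\<^sup>2)"
  have "I \<noteq> {}" using A by auto
  have int: "integrable M ?R" using exp_X(1) by simp
  have "expectation ?R = (\<Sum>i\<in>I. c i / ?A * expectation (\<lambda>s. exp ((X i s)\<^sup>2 / \<sigma>\<^sup>2)))"
    using exp_X(1) by (subst Bochner_Integration.integral_sum) auto
  also have "\<dots> \<le> (\<Sum>i\<in>I. c i / ?A * exp 1)"
    using c A exp_X(2) by (intro sum_mono mult_left_mono) (auto intro!: divide_nonneg_pos)
  also have "\<dots> = exp 1"
    using A by (simp flip: sum_distrib_right sum_divide_distrib)
  finally have ER: "expectation ?R \<le> exp 1" .
  have "prob {s \<in> space M. (\<Sum>i\<in>I. c i * (X i s)\<^sup>2) > (1 + l) * \<sigma>\<^sup>2 * ?A}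
      \<le> prob {s \<in> space M. ?R s \<ge> exp (1 + l)}"
  proof (rule finite_measure_mono)
    show "{s \<in> space M. ?R s \<ge> exp (1 + l)} \<in> sets M" using I by measurable
    show "{s \<in> space M. (\<Sum>i\<in>I. c i * (X i s)\<^sup>2) > (1 + l) * \<sigma>\<^sup>2 * ?A}
        \<subseteq> {s \<in> space M. ?R s \<ge> exp (1 + l)}"
    proof safe
      fix s assume "(\<Sum>i\<in>I. c i * (X i s)\<^sup>2) > (1 + l) * \<sigma>\<^sup>2 * ?A"
      moreover have "(\<Sum>i\<in>I. c i / ?A * ((X i s)\<^sup>2 / \<sigma>\<^sup>2)) = (\<Sum>i\<in>I. c i * (X i s)\<^sup>2) / (\<sigma>\<^sup>2 * ?A)"
        by (simp add: sum_divide_distrib mult.commute)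
      ultimately have "1 + l \<le> (\<Sum>i\<in>I. c i / ?A * ((X i s)\<^sup>2 / \<sigma>\<^sup>2))"
        using \<sigma> A by (simp add: pos_le_divide_eq mult.assoc)
      then have "exp (1 + l) \<le> exp (\<Sum>i\<in>I. c i / ?A * ((X i s)\<^sup>2 / \<sigma>\<^sup>2))" by simp
      also have "\<dots> \<le> ?R s"
        using convex_on_sum[OF I _ exp_convex, of "\<lambda>i. c i / ?A" "\<lambda>i. (X i s)\<^sup>2 / \<sigma>\<^sup>2"] c A \<open>I \<noteq> {}\<close>
        by (auto simp: divide_nonneg_pos simp flip: sum_divide_distrib)
      finally show "exp (1 + l) \<le> ?R s" .
    qed
  qed
  also have "\<dots> \<le> expectation ?R / exp (1 + l)"
    using c A by (intro integral_Markov_inequality_measure[OF int, of "{}"]) (auto intro!: AE_I2 sum_nonneg)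
  also have "\<dots> \<le> exp 1 / exp (1 + l)" by (intro divide_right_mono ER) simp
  also have "\<dots> = exp (- l)" by (simp flip: exp_diff)
  finally show ?thesis .
qed

lemma prob_gt_of_mgf:
  fixes T :: "'a \<Rightarrow> real"
  assumes [measurable]: "T \<in> borel_measurable M"
    and mgf: "\<And>\<theta>. (\<integral>\<^sup>+ s. ennreal (exp (\<theta> * T s)) \<partial>M) \<le> ennreal (exp (3 / 4 * (\<theta> * B)\<^sup>2))"
    and B: "0 < B" and l: "0 < l"
  shows "prob {s \<in> space M. T s > l * B} \<le> exp (- l\<^sup>2 / 3)"
proof -
  \<comment> \<open>The minimiser of
    \<open>3 / 4 * (\<theta> * B)\<^sup>2 - \<theta> * l * B\<close>, whose minimum is
    \<open>- l\<^sup>2 / 3\<close>.\<close>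
  define \<theta> where "\<theta> = 2 * l / (3 * B)"
  have \<theta>: "0 < \<theta>" "\<theta> * B = 2 / 3 * l" "\<theta> * (l * B) = 2 / 3 * l\<^sup>2"
    using B l by (auto simp: \<theta>_def power2_eq_square)
  have "emeasure M {s \<in> space M. T s > l * B} \<le> emeasure M {s \<in> space M. T s \<ge> l * B}"
    by (rule emeasure_mono) auto
  also have "\<dots> \<le> ennreal (exp (- \<theta> * (l * B)))
      * (\<integral>\<^sup>+ s. ennreal (exp (\<theta> * T s)) * indicator (space M) s \<partial>M)"
    by (rule Chernoff_ineq_nn_integral_ge[OF \<theta>(1)]) measurable
  also have "(\<integral>\<^sup>+ s. ennreal (exp (\<theta> * T s)) * indicator (space M) s \<partial>M) = (\<integral>\<^sup>+ s. ennreal (exp (\<theta> * T s)) \<partial>M)"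
    by (intro nn_integral_cong) auto
  also have "ennreal (exp (- \<theta> * (l * B))) * \<dots> \<le> ennreal (exp (- \<theta> * (l * B))) * ennreal (exp (3 / 4 * (\<theta> * B)\<^sup>2))"
    by (intro mult_left_mono mgf) simp
  also have "\<dots> = ennreal (exp (- \<theta> * (l * B) + 3 / 4 * (\<theta> * B)\<^sup>2))"
    unfolding exp_add by (simp flip: ennreal_mult)
  also have "- \<theta> * (l * B) + 3 / 4 * (\<theta> * B)\<^sup>2 = - l\<^sup>2 / 3"
    unfolding \<theta>(2) mult_minus_left \<theta>(3) by (simp add: power2_eq_square)
  finally show ?thesis by (simp add: emeasure_eq_measure)
qed

end

section \<open>Sigma-algebras generated by finitely or infinitely many of the samples\<close>

locale sampling = prob_space M for M :: "'s measure" +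
  fixes N\<^sub>1 :: "'v measure" and \<xi> :: "nat \<Rightarrow> 's \<Rightarrow> 'v"
    and N\<^sub>2 :: "'w measure" and \<zeta> :: "nat \<Rightarrow> 's \<Rightarrow> 'w"
  assumes \<xi>_measurable: "\<And>i. 1 \<le> i \<Longrightarrow> \<xi> i \<in> measurable M N\<^sub>1"
    and \<zeta>_measurable: "\<And>i. 1 \<le> i \<Longrightarrow> \<zeta> i \<in> measurable M N\<^sub>2"
    and independent: "samples_independent M N\<^sub>1 \<xi> N\<^sub>2 \<zeta>"
begin

definition events_of :: "nat + nat \<Rightarrow> 's set set" where
  "events_of k = (case k of
     Inl i \<Rightarrow> {\<xi> i -` A \<inter> space M | A. A \<in> sets N\<^sub>1}
   | Inr i \<Rightarrow> {\<zeta> i -` A \<inter> space M | A. A \<in> sets N\<^sub>2})"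

text \<open>The information carried by the samples indexed by \<open>I\<close>; a sum type is used
  because the two kinds of samples may take values in different types.\<close>

definition past :: "(nat + nat) set \<Rightarrow> 's measure" where
  "past I = sigma (space M) (\<Union>k\<in>I. events_of k)"

lemma events_of_Pow: "events_of k \<subseteq> Pow (space M)"
  by (auto simp: events_of_def split: sum.split)

lemma vimage_in_events_of:
  "A \<in> sets N\<^sub>1 \<Longrightarrow> \<xi> i -` A \<inter> space M \<in> events_of (Inl i)"
  "B \<in> sets N\<^sub>2 \<Longrightarrow> \<zeta> i -` B \<inter> space M \<in> events_of (Inr i)"
  by (auto simp: events_of_def)

lemma Int_stable_events_of: "Int_stable (events_of k)"
proof -
  have vimage: "Int_stable {f -` A \<inter> space M | A. A \<in> sets N}" for f :: "'s \<Rightarrow> 'c" and N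
  proof (rule Int_stableI, clarify)
    fix A B assume "A \<in> sets N" "B \<in> sets N"
    then show "\<exists>C. (f -` A \<inter> space M) \<inter> (f -` B \<inter> space M) = f -` C \<inter> space M \<and> C \<in> sets N"
      by (intro exI[of _ "A \<inter> B"]) auto
  qed
  show ?thesis by (cases k) (simp_all add: events_of_def vimage)
qed

lemma space_past [simp]: "space (past I) = space M"
  unfolding past_def using events_of_Pow by (intro space_measure_of) auto

lemma sets_past: "sets (past I) = sigma_sets (space M) (\<Union>k\<in>I. events_of k)"
  unfolding past_def using events_of_Pow by (intro sets_measure_of) auto

lemma subalgebra_past:
  assumes "I \<subseteq> {1..} <+> {1..}"
  shows "subalgebra M (past I)"
proof -
  have "events_of k \<subseteq> sets M" if "k \<in> I" for k
    using that assms measurable_sets[OF \<xi>_measurable] measurable_sets[OF \<zeta>_measurable]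
    by (cases k) (auto simp: events_of_def)
  then show ?thesis
    unfolding subalgebra_def sets_past space_past
    by (intro conjI refl sets.sigma_sets_subset UN_least)
qed

lemma measurable_past_mono: "I \<subseteq> J \<Longrightarrow> f \<in> measurable (past I) N \<Longrightarrow> f \<in> measurable (past J) N"
proof -
  assume "I \<subseteq> J" "f \<in> measurable (past I) N"
  moreover from \<open>I \<subseteq> J\<close> have "sets (past I) \<subseteq> sets (past J)"
    unfolding sets_past by (intro sigma_sets_mono') auto
  ultimately show ?thesis by (auto simp: measurable_def)
qed

lemma measurable_past_\<xi>: "Inl i \<in> I \<Longrightarrow> 1 \<le> i \<Longrightarrow> \<xi> i \<in> measurable (past I) N\<^sub>1"
  using measurable_space[OF \<xi>_measurable, of i] vimage_in_events_of(1)[of _ i]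
  by (intro measurableI) (auto simp: sets_past intro!: sigma_sets.Basic)

lemma measurable_past_\<zeta>: "Inr i \<in> I \<Longrightarrow> 1 \<le> i \<Longrightarrow> \<zeta> i \<in> measurable (past I) N\<^sub>2"
  using measurable_space[OF \<zeta>_measurable, of i] vimage_in_events_of(2)[of _ i]
  by (intro measurableI) (auto simp: sets_past intro!: sigma_sets.Basic)

text \<open>The independent family is grouped into the blocks \<open>I\<close> and
  \<open>{k}\<close>, and the sigma-algebras generated by disjoint blocks are again
  independent.\<close>

lemma prob_past_Int:
  assumes I: "I \<subseteq> {1..} <+> {1..}" and k: "k \<in> {1..} <+> {1..}" "k \<notin> I"
    and A: "A \<in> sets (past I)" and B: "B \<in> events_of k"
  shows "prob (A \<inter> B) = prob A * prob B"
proof -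
  let ?I = "case_bool I {k}"
  have "indep_sets events_of ({1..} <+> {1..})"
    using independent unfolding samples_independent_def events_of_def .
  then have "indep_sets events_of (\<Union>j\<in>UNIV. ?I j)"
    by (rule indep_sets_mono_index[rotated]) (use I k in \<open>auto simp: UNIV_bool\<close>)
  then have "indep_sets (\<lambda>j. sigma_sets (space M) (\<Union>i\<in>?I j. events_of i)) UNIV"
    using k(2) by (intro indep_sets_collect_sigma Int_stable_events_of)
      (auto simp: disjoint_family_on_def split: bool.split)
  from indep_setsD[OF this, of UNIV "case_bool A B"]
  show ?thesis using A B by (simp add: UNIV_bool sets_past ac_simps sigma_sets.Basic)
qed

lemma indep_sample_\<xi>:
  assumes "I \<subseteq> {1..} <+> {1..}" "1 \<le> i" "Inl i \<notin> I"
  shows "indep_sample (past I) N\<^sub>1 (\<xi> i)"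
  unfolding indep_sample_def
proof (intro conjI ballI)
  show "subalgebra M (past I)" using assms by (intro subalgebra_past)
  show "\<xi> i \<in> measurable M N\<^sub>1" using assms by (intro \<xi>_measurable)
  fix A B assume "A \<in> sets (past I)" "B \<in> sets N\<^sub>1"
  then show "prob (A \<inter> (\<xi> i -` B \<inter> space M)) = prob A * prob (\<xi> i -` B \<inter> space M)"
    using assms by (intro prob_past_Int[of I "Inl i"] vimage_in_events_of) auto
qed

lemma indep_sample_\<zeta>:
  assumes "I \<subseteq> {1..} <+> {1..}" "1 \<le> i" "Inr i \<notin> I"
  shows "indep_sample (past I) N\<^sub>2 (\<zeta> i)"
  unfolding indep_sample_def
proof (intro conjI ballI)
  show "subalgebra M (past I)" using assms by (intro subalgebra_past)
  show "\<zeta> i \<in> measurable M N\<^sub>2" using assms by (intro \<zeta>_measurable)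
  fix A B assume "A \<in> sets (past I)" "B \<in> sets N\<^sub>2"
  then show "prob (A \<inter> (\<zeta> i -` B \<inter> space M)) = prob A * prob (\<zeta> i -` B \<inter> space M)"
    using assms by (intro prob_past_Int[of I "Inr i"] vimage_in_events_of) auto
qed

end

lemma measurable_convex_comb:
  fixes Z :: "'a::euclidean_space set"
  assumes X: "X \<in> measurable F (restrict_space borel Z)" "Y \<in> measurable F (restrict_space borel Z)"
    and Z: "convex Z" "0 \<le> a" "a \<le> 1"
  shows "(\<lambda>s. (1 - a) *\<^sub>R X s + a *\<^sub>R Y s) \<in> measurable F (restrict_space borel Z)"
proof (rule measurable_restrict_space2)
  have [measurable]: "X \<in> borel_measurable F" "Y \<in> borel_measurable F"
    using X by (simp_all add: measurable_restrict_space2_iff)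
  show "(\<lambda>s. (1 - a) *\<^sub>R X s + a *\<^sub>R Y s) \<in> borel_measurable F" by measurable
  show "(\<lambda>s. (1 - a) *\<^sub>R X s + a *\<^sub>R Y s) \<in> space F \<rightarrow> Z"
    using measurable_space[OF X(1)] measurable_space[OF X(2)] Z
    by (auto simp: space_restrict_space intro!: convexD)
qed

lemma measurable_compose_pair:
  assumes "(\<lambda>(x, v). f x v) \<in> measurable (A \<Otimes>\<^sub>M B) C" "X \<in> measurable F A" "Y \<in> measurable F B"
  shows "(\<lambda>s. f (X s) (Y s)) \<in> measurable F C"
  using measurable_compose[OF measurable_Pair[OF assms(2,3)] assms(1)] by simp

context vec_norm
begin

lemma borel_measurable_noise:
  assumes "(\<lambda>(x, v). Fs x v) \<in> borel_measurable (restrict_space borel Z \<Otimes>\<^sub>M N)"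
    and "Fx \<in> borel_measurable (restrict_space borel Z)"
  shows "(\<lambda>(x, v). Fs x v - Fx x :: 'a) \<in> borel_measurable (restrict_space borel Z \<Otimes>\<^sub>M N)"
proof -
  have [measurable]: "(\<lambda>p. Fs (fst p) (snd p)) \<in> borel_measurable (restrict_space borel Z \<Otimes>\<^sub>M N)"
    using assms(1) by (simp add: split_beta')
  note [measurable] = assms(2)
  show ?thesis unfolding split_beta' by measurable
qed

end

text \<open>One oracle call: the input \<open>X\<close> is known from the past \<open>F\<close>, and
  \<open>Y\<close> is a fresh sample. Each iteration provides three instances, one for
  \<open>G\<close> and two for \<open>H\<close>.\<close>

locale noisy_oracle = vec_norm nrm + prob_space M
  for nrm :: "'a::euclidean_space \<Rightarrow> real" and M :: "'s measure" +
  fixes N :: "'v measure" and Z :: "'a set" and Fx :: "'a \<Rightarrow> 'a" and Fs :: "'a \<Rightarrow> 'v \<Rightarrow> 'a"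
    and F :: "'s measure" and Y :: "'s \<Rightarrow> 'v" and X :: "'s \<Rightarrow> 'a"
  assumes Fs[measurable]: "(\<lambda>(x, v). Fs x v) \<in> borel_measurable (restrict_space borel Z \<Otimes>\<^sub>M N)"
    and Fx[measurable]: "Fx \<in> borel_measurable (restrict_space borel Z)"
    and indep: "indep_sample F N Y"
    and X: "X \<in> measurable F (restrict_space borel Z)"
    and unbiased: "\<And>x. x \<in> Z \<Longrightarrow> integrable M (\<lambda>s. Fs x (Y s)) \<and> expectation (\<lambda>s. Fs x (Y s)) = Fx x"
begin

abbreviation noise :: "'s \<Rightarrow> 'a" where "noise s \<equiv> Fs (X s) (Y s) - Fx (X s)"

lemma noise_measurable [measurable]:
  "(\<lambda>(x, v). Fs x v - Fx x) \<in> borel_measurable (restrict_space borel Z \<Otimes>\<^sub>M N)"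
  by (rule borel_measurable_noise[OF Fs Fx])

lemma subalg: "subalgebra M F" and Y_measurable[measurable]: "Y \<in> measurable M N"
  using indep by (auto simp: indep_sample_def)

lemma X_measurable[measurable]: "X \<in> measurable M (restrict_space borel Z)"
  by (rule measurable_from_subalg[OF subalg X])

lemma X_in_Z: "s \<in> space M \<Longrightarrow> X s \<in> Z"
  using measurable_space[OF X_measurable] by (simp add: space_restrict_space)

lemma borel_measurable_noise_X [measurable]: "noise \<in> borel_measurable M"
  by (rule measurable_compose_pair[OF noise_measurable X_measurable Y_measurable])

text \<open>Used with \<open>g y = y\<^sup>2\<close> under bounded variance and with the exponential
  of the scaled square under light tails.\<close>

lemma expectation_comp_dual_noise_le:
  assumes [measurable]: "g \<in> borel_measurable borel" and g: "\<And>y. 0 \<le> g y"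
    and le: "\<And>x. x \<in> Z \<Longrightarrow> integrable M (\<lambda>s. g (dual (Fs x (Y s) - Fx x)))
      \<and> expectation (\<lambda>s. g (dual (Fs x (Y s) - Fx x))) \<le> (c :: real)"
  shows "integrable M (\<lambda>s. g (dual (noise s)))" "expectation (\<lambda>s. g (dual (noise s))) \<le> c"
proof -
  have "(\<lambda>p. g (dual (case p of (x, v) \<Rightarrow> Fs x v - Fx x))) \<in> borel_measurable (restrict_space borel Z \<Otimes>\<^sub>M N)"
    by measurable
  then have h: "(\<lambda>p. g (dual (Fs (fst p) (snd p) - Fx (fst p)))) \<in> borel_measurable (restrict_space borel Z \<Otimes>\<^sub>M N)"
    by (simp add: split_beta')
  show "integrable M (\<lambda>s. g (dual (noise s)))" "expectation (\<lambda>s. g (dual (noise s))) \<le> c"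
    using expectation_indep_sample_le[OF indep X h, of c] le g by (simp_all add: space_restrict_space)
qed

lemma fixed_noise_mean_zero:
  assumes "x \<in> Z"
  shows "integrable M (\<lambda>s. (Fs x (Y s) - Fx x) \<bullet> y)" "expectation (\<lambda>s. (Fs x (Y s) - Fx x) \<bullet> y) = 0"
proof -
  have int: "integrable M (\<lambda>s. Fs x (Y s) - Fx x)"
    using unbiased[OF assms] by simp
  then show "integrable M (\<lambda>s. (Fs x (Y s) - Fx x) \<bullet> y)" by (rule integrable_inner_left)
  show "expectation (\<lambda>s. (Fs x (Y s) - Fx x) \<bullet> y) = 0"
    using unbiased[OF assms] int by (subst integral_inner_left) (auto simp: prob_space)
qed

text \<open>The martingale difference property: input \<open>X\<close> and direction
  \<open>U\<close> are both known before the sample and are frozen together, whereupon unbiasedness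
  applies.\<close>

lemma noise_inner_mean_zero:
  assumes U: "U \<in> borel_measurable F" and D: "\<And>s. s \<in> space M \<Longrightarrow> nrm (U s) \<le> D"
    and var: "integrable M (\<lambda>s. (dual (noise s))\<^sup>2)"
  shows "integrable M (\<lambda>s. noise s \<bullet> U s)" "expectation (\<lambda>s. noise s \<bullet> U s) = 0"
proof -
  have UM[measurable]: "U \<in> borel_measurable M" by (rule measurable_from_subalg[OF subalg U])
  have "0 \<le> D" using D not_empty nrm_nonneg order.trans by blast
  show int: "integrable M (\<lambda>s. noise s \<bullet> U s)"
  proof (rule Bochner_Integration.integrable_bound)
    \<comment> \<open>The variance bound controls the first moment through
      \<open>y \<le> 1 + y\<^sup>2\<close>.\<close>
    show "integrable M (\<lambda>s. D * (1 + (dual (noise s))\<^sup>2))" using var by simp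
    show "AE s in M. norm (noise s \<bullet> U s) \<le> norm (D * (1 + (dual (noise s))\<^sup>2))"
    proof (rule AE_I2)
      fix s assume s: "s \<in> space M"
      have "\<bar>noise s \<bullet> U s\<bar> \<le> dual (noise s) * nrm (U s)" by (rule abs_inner_le_dual)
      also have "\<dots> \<le> (1 + (dual (noise s))\<^sup>2) * D"
      proof (rule mult_mono)
        show "dual (noise s) \<le> 1 + (dual (noise s))\<^sup>2"
          using sum_squares_bound[of "dual (noise s)" 1] dual_nonneg[of "noise s"]
          unfolding power_one by linarith
      qed (use D[OF s] in auto)
      finally show "norm (noise s \<bullet> U s) \<le> norm (D * (1 + (dual (noise s))\<^sup>2))"
        using \<open>0 \<le> D\<close> by (simp add: mult.commute)
    qed
  qed measurable
  let ?S = "restrict_space borel Z \<Otimes>\<^sub>M (borel :: 'a measure)"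
  have XU: "(\<lambda>s. (X s, U s)) \<in> measurable F ?S" using X U by (rule measurable_Pair)
  let ?h = "\<lambda>p. (Fs (fst (fst p)) (snd p) - Fx (fst (fst p))) \<bullet> snd (fst p)"
  have "(\<lambda>p. (\<lambda>(x, v). Fs x v - Fx x) (fst (fst p), snd p)) \<in> borel_measurable (?S \<Otimes>\<^sub>M N)"
    by measurable
  then have [measurable]: "(\<lambda>p. Fs (fst (fst p)) (snd p) - Fx (fst (fst p))) \<in> borel_measurable (?S \<Otimes>\<^sub>M N)"
    by simp
  have "?h \<in> borel_measurable (?S \<Otimes>\<^sub>M N)" by measurable
  from integral_indep_sample_eq_0[OF indep XU this]
  show "expectation (\<lambda>s. noise s \<bullet> U s) = 0"
    using int fixed_noise_mean_zero(2) by (auto simp: space_pair_measure space_restrict_space)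
qed

text \<open>\<open>T\<close> stands for the exponent accumulated so far. It is frozen along with
  \<open>X\<close> and \<open>U\<close>, so its exponential factors out and only the new increment
  is averaged.\<close>

lemma noise_inner_mgf:
  assumes U: "U \<in> borel_measurable F" and D: "\<And>s. s \<in> space M \<Longrightarrow> nrm (U s) \<le> D"
    and T: "T \<in> borel_measurable F" and \<sigma>: "0 < \<sigma>"
    and tail: "\<And>x. x \<in> Z \<Longrightarrow> integrable M (\<lambda>s. exp ((dual (Fs x (Y s) - Fx x))\<^sup>2 / \<sigma>\<^sup>2))
      \<and> expectation (\<lambda>s. exp ((dual (Fs x (Y s) - Fx x))\<^sup>2 / \<sigma>\<^sup>2)) \<le> exp 1"
  shows "(\<integral>\<^sup>+ s. ennreal (exp (T s + c * (noise s \<bullet> U s))) \<partial>M)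
    \<le> ennreal (exp (3 / 4 * (c * D * \<sigma>)\<^sup>2)) * (\<integral>\<^sup>+ s. ennreal (exp (T s)) \<partial>M)"
proof -
  let ?S = "restrict_space borel Z \<Otimes>\<^sub>M (borel \<Otimes>\<^sub>M borel) :: ('a \<times> 'a \<times> real) measure"
  have XUT: "(\<lambda>s. (X s, U s, T s)) \<in> measurable F ?S" using X U T by (intro measurable_Pair)
  let ?h = "\<lambda>p. ennreal (exp (snd (snd (fst p)))) *
    ennreal (exp (c * ((Fs (fst (fst p)) (snd p) - Fx (fst (fst p))) \<bullet> fst (snd (fst p)))))"
  have "(\<lambda>p. (\<lambda>(x, v). Fs x v - Fx x) (fst (fst p), snd p)) \<in> borel_measurable (?S \<Otimes>\<^sub>M N)"
    by measurable
  then have [measurable]: "(\<lambda>p. Fs (fst (fst p)) (snd p) - Fx (fst (fst p))) \<in> borel_measurable (?S \<Otimes>\<^sub>M N)"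
    by simp
  have h: "?h \<in> borel_measurable (?S \<Otimes>\<^sub>M N)" by measurable
  have TM[measurable]: "T \<in> borel_measurable M" by (rule measurable_from_subalg[OF subalg T])
  have "(\<integral>\<^sup>+ s. ennreal (exp (T s + c * (noise s \<bullet> U s))) \<partial>M)
      = (\<integral>\<^sup>+ s. ennreal (exp (T s)) * ennreal (exp (c * (noise s \<bullet> U s))) \<partial>M)"
    by (simp add: exp_add ennreal_mult)
  also have "\<dots> = (\<integral>\<^sup>+ s. (\<integral>\<^sup>+ s'. ennreal (exp (T s)) *
      ennreal (exp (c * ((Fs (X s) (Y s') - Fx (X s)) \<bullet> U s))) \<partial>M) \<partial>M)"
    using nn_integral_indep_sample[OF indep XUT h] by simp
  also have "\<dots> \<le> (\<integral>\<^sup>+ s. ennreal (exp (3 / 4 * (c * D * \<sigma>)\<^sup>2)) * ennreal (exp (T s)) \<partial>M)"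
  proof (rule nn_integral_mono)
    fix s assume s: "s \<in> space M"
    note XZ = X_in_Z[OF s]
    have [measurable]: "(\<lambda>s'. Fs (X s) (Y s')) \<in> borel_measurable M"
      using unbiased[OF XZ] by auto
    have "(\<integral>\<^sup>+ s'. ennreal (exp (c * ((Fs (X s) (Y s') - Fx (X s)) \<bullet> U s))) \<partial>M)
        \<le> ennreal (exp (3 / 4 * (\<bar>c\<bar> * D * \<sigma>)\<^sup>2))"
    proof (rule nn_integral_exp_le[OF _ _ _ \<sigma> tail[OF XZ, THEN conjunct1] tail[OF XZ, THEN conjunct2]])
      show "integrable M (\<lambda>s'. c * ((Fs (X s) (Y s') - Fx (X s)) \<bullet> U s))"
        using fixed_noise_mean_zero(1)[OF XZ] by (rule integrable_mult_right)
      show "expectation (\<lambda>s'. c * ((Fs (X s) (Y s') - Fx (X s)) \<bullet> U s)) = 0"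
        using fixed_noise_mean_zero(2)[OF XZ, of "U s"] by simp
      fix s'
      let ?d = "Fs (X s) (Y s') - Fx (X s)"
      have "\<bar>?d \<bullet> U s\<bar> \<le> dual ?d * D"
        by (rule order.trans[OF abs_inner_le_dual mult_left_mono[OF D[OF s]]]) simp
      then have "\<bar>c\<bar> * \<bar>?d \<bullet> U s\<bar> \<le> \<bar>c\<bar> * (dual ?d * D)"
        by (rule mult_left_mono) simp
      then show "\<bar>c * (?d \<bullet> U s)\<bar> \<le> \<bar>c\<bar> * D * dual ?d"
        unfolding abs_mult by (simp only: mult.assoc mult.commute[of D])
    qed
    also have "(\<bar>c\<bar> * D * \<sigma>)\<^sup>2 = (c * D * \<sigma>)\<^sup>2" by (simp add: power_mult_distrib)
    finally have "(\<integral>\<^sup>+ s'. ennreal (exp (c * ((Fs (X s) (Y s') - Fx (X s)) \<bullet> U s))) \<partial>M)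
        \<le> ennreal (exp (3 / 4 * (c * D * \<sigma>)\<^sup>2))" .
    then show "(\<integral>\<^sup>+ s'. ennreal (exp (T s)) * ennreal (exp (c * ((Fs (X s) (Y s') - Fx (X s)) \<bullet> U s))) \<partial>M)
        \<le> ennreal (exp (3 / 4 * (c * D * \<sigma>)\<^sup>2)) * ennreal (exp (T s))"
      by (subst nn_integral_cmult) (auto intro!: mult_left_mono simp: mult.commute)
  qed
  also have "\<dots> = ennreal (exp (3 / 4 * (c * D * \<sigma>)\<^sup>2)) * (\<integral>\<^sup>+ s. ennreal (exp (T s)) \<partial>M)"
    by (rule nn_integral_cmult) measurable
  finally show ?thesis .
qed

end

text \<open>An Azuma-type induction: the last increment is peeled off with
  \<open>c = \<theta> * a n\<close>, and the squares of the coefficients add up in the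
  exponent.\<close>

lemma (in prob_space) martingale_mgf:
  fixes a :: "nat \<Rightarrow> real" and \<psi> :: "nat \<Rightarrow> 'a \<Rightarrow> real"
  assumes step: "\<And>n c. 1 \<le> n \<Longrightarrow>
      (\<integral>\<^sup>+ s. ennreal (exp (\<theta> * (\<Sum>i=1..<n. a i * \<psi> i s) + c * \<psi> n s)) \<partial>M)
        \<le> ennreal (exp (3 / 4 * (c * B)\<^sup>2)) * (\<integral>\<^sup>+ s. ennreal (exp (\<theta> * (\<Sum>i=1..<n. a i * \<psi> i s))) \<partial>M)"
  shows "(\<integral>\<^sup>+ s. ennreal (exp (\<theta> * (\<Sum>i=1..t. a i * \<psi> i s))) \<partial>M)
    \<le> ennreal (exp (3 / 4 * (\<theta> * (B * sqrt (\<Sum>i=1..t. (a i)\<^sup>2)))\<^sup>2))"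
proof (induction t)
  case 0
  show ?case by (simp add: emeasure_space_1)
next
  case (Suc t)
  let ?T = "\<lambda>s. \<Sum>i=1..t. a i * \<psi> i s"
  have "(\<integral>\<^sup>+ s. ennreal (exp (\<theta> * (\<Sum>i=1..Suc t. a i * \<psi> i s))) \<partial>M)
      = (\<integral>\<^sup>+ s. ennreal (exp (\<theta> * ?T s + (\<theta> * a (Suc t)) * \<psi> (Suc t) s)) \<partial>M)"
    by (simp add: algebra_simps)
  also have "\<dots> \<le> ennreal (exp (3 / 4 * (\<theta> * a (Suc t) * B)\<^sup>2)) * (\<integral>\<^sup>+ s. ennreal (exp (\<theta> * ?T s)) \<partial>M)"
    using step[of "Suc t" "\<theta> * a (Suc t)"] by (simp add: atLeastLessThanSuc_atLeastAtMost)
  also have "\<dots> \<le> ennreal (exp (3 / 4 * (\<theta> * a (Suc t) * B)\<^sup>2))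
      * ennreal (exp (3 / 4 * (\<theta> * (B * sqrt (\<Sum>i=1..t. (a i)\<^sup>2)))\<^sup>2))"
    by (intro mult_left_mono Suc.IH) simp
  also have "\<dots> = ennreal (exp (3 / 4 * (\<theta> * a (Suc t) * B)\<^sup>2 + 3 / 4 * (\<theta> * (B * sqrt (\<Sum>i=1..t. (a i)\<^sup>2)))\<^sup>2))"
    unfolding exp_add by (simp flip: ennreal_mult)
  also have "3 / 4 * (\<theta> * a (Suc t) * B)\<^sup>2 + 3 / 4 * (\<theta> * (B * sqrt (\<Sum>i=1..t. (a i)\<^sup>2)))\<^sup>2
      = 3 / 4 * (\<theta> * (B * sqrt (\<Sum>i=1..Suc t. (a i)\<^sup>2)))\<^sup>2"
    by (simp add: power_mult_distrib sum_nonneg algebra_simps)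
  finally show ?case .
qed

section \<open>Measurability of the iterates\<close>

locale amp_run = amp_problem nrm Z \<omega> \<omega>' \<mu> G J G' H J' L\<^sub>G L\<^sub>H \<Omega> + sampling M N\<^sub>G \<xi> N\<^sub>H \<zeta>
  for nrm :: "'a::euclidean_space \<Rightarrow> real" and Z \<omega> \<omega>' \<mu> G J G' H J' L\<^sub>G L\<^sub>H \<Omega>
    and M :: "'s measure" and N\<^sub>G :: "'v measure" and \<xi> and N\<^sub>H :: "'w measure" and \<zeta> +
  fixes Gs :: "'a \<Rightarrow> 'v \<Rightarrow> 'a" and Hs :: "'a \<Rightarrow> 'w \<Rightarrow> 'a" and r\<^sub>1 :: 'a
    and w wag wmd r :: "nat \<Rightarrow> 's \<Rightarrow> 'a" and \<alpha> \<gamma> \<Gamma> :: "nat \<Rightarrow> real" and q :: real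
  assumes Gs_unbiased: "unbiased_oracle M N\<^sub>G Z G' Gs \<xi>" and Hs_unbiased: "unbiased_oracle M N\<^sub>H Z H Hs \<zeta>"
    and r\<^sub>1: "r\<^sub>1 \<in> Z" and r_1: "\<And>s. s \<in> space M \<Longrightarrow> r 1 s = r\<^sub>1"
    and wag_1: "\<And>s. s \<in> space M \<Longrightarrow> wag 1 s = r\<^sub>1"
    and wmd: "\<And>t s. 1 \<le> t \<Longrightarrow> s \<in> space M \<Longrightarrow> wmd t s = (1 - \<alpha> t) *\<^sub>R wag t s + \<alpha> t *\<^sub>R r t s"
    and w_step: "\<And>t s. 1 \<le> t \<Longrightarrow> s \<in> space M \<Longrightarrow>
           w (t + 1) s = prox_map Z \<omega> \<omega>' J (\<gamma> t) (r t s)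
             (\<gamma> t *\<^sub>R Hs (r t s) (\<zeta> (2 * t - 1) s) + \<gamma> t *\<^sub>R Gs (wmd t s) (\<xi> t s))"
    and r_step: "\<And>t s. 1 \<le> t \<Longrightarrow> s \<in> space M \<Longrightarrow>
           r (t + 1) s = prox_map Z \<omega> \<omega>' J (\<gamma> t) (r t s)
             (\<gamma> t *\<^sub>R Hs (w (t + 1) s) (\<zeta> (2 * t) s) + \<gamma> t *\<^sub>R Gs (wmd t s) (\<xi> t s))"
    and wag_step: "\<And>t s. 1 \<le> t \<Longrightarrow> s \<in> space M \<Longrightarrow>
           wag (t + 1) s = (1 - \<alpha> t) *\<^sub>R wag t s + \<alpha> t *\<^sub>R w (t + 1) s"
    and \<gamma>_pos: "\<And>t. 1 \<le> t \<Longrightarrow> 0 < \<gamma> t"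
    and \<alpha>_1: "\<alpha> 1 = 1" and \<alpha>_bounds: "\<And>t. 1 < t \<Longrightarrow> 0 \<le> \<alpha> t \<and> \<alpha> t < 1"
    and \<Gamma>_1: "\<Gamma> 1 = 1" and \<Gamma>_step: "\<And>t. 1 < t \<Longrightarrow> \<Gamma> t = (1 - \<alpha> t) * \<Gamma> (t - 1)"
    and q: "0 < q" "q < 1"
    and stepsize: "\<And>t. 1 \<le> t \<Longrightarrow> 0 \<le> q * \<mu> - L\<^sub>G * \<alpha> t * \<gamma> t - 3 * L\<^sub>H\<^sup>2 * (\<gamma> t)\<^sup>2 / \<mu>"
    and weights_mono: "\<And>t. 1 \<le> t \<Longrightarrow> \<alpha> t / (\<Gamma> t * \<gamma> t) \<le> \<alpha> (t + 1) / (\<Gamma> (t + 1) * \<gamma> (t + 1))"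
begin

lemma \<alpha>_nonneg: "1 \<le> t \<Longrightarrow> 0 \<le> \<alpha> t" and \<alpha>_le_1: "1 \<le> t \<Longrightarrow> \<alpha> t \<le> 1"
  using \<alpha>_1 \<alpha>_bounds[of t] by (cases "t = 1"; simp)+

lemma \<Gamma>_pos: "1 \<le> t \<Longrightarrow> 0 < \<Gamma> t"
proof (induction t rule: nat_induct_at_least)
  case base
  then show ?case using \<Gamma>_1 by simp
next
  case (Suc n)
  then show ?case using \<Gamma>_step[of "Suc n"] \<alpha>_bounds[of "Suc n"] by simp
qed

abbreviation ZZ :: "'a measure" where "ZZ \<equiv> restrict_space borel Z"

text \<open>Step \<open>t\<close> draws \<open>\<zeta> (2 * t - 1)\<close>, \<open>\<xi> t\<close> and finally \<open>\<zeta> (2 * t)\<close>; the last one is still independent of \<open>midway t\<close>.\<close>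

definition before :: "nat \<Rightarrow> 's measure" where
  "before t = past ({1..<t} <+> {1..<2 * t - 1})"

definition midway :: "nat \<Rightarrow> 's measure" where
  "midway t = past ({1..t} <+> {1..<2 * t})"

lemma space_before [simp]: "space (before t) = space M"
  and space_midway [simp]: "space (midway t) = space M"
  by (simp_all add: before_def midway_def)

lemma before_midway: "f \<in> measurable (before t) N \<Longrightarrow> f \<in> measurable (midway t) N"
  unfolding before_def midway_def by (erule measurable_past_mono[rotated]) auto

lemma midway_before: "f \<in> measurable (midway t) N \<Longrightarrow> f \<in> measurable (before (t + 1)) N"
  unfolding before_def midway_def by (erule measurable_past_mono[rotated]) auto

lemma before_mono: "s \<le> t \<Longrightarrow> f \<in> measurable (before s) N \<Longrightarrow> f \<in> measurable (before t) N"
  unfolding before_def by (erule measurable_past_mono[rotated]) auto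

lemma before_measurable: "f \<in> measurable (before t) N \<Longrightarrow> f \<in> measurable M N"
  unfolding before_def by (rule measurable_from_subalg[OF subalgebra_past]) auto

lemma midway_measurable: "f \<in> measurable (midway t) N \<Longrightarrow> f \<in> measurable M N"
  unfolding midway_def by (rule measurable_from_subalg[OF subalgebra_past]) auto

definition gsample :: "nat \<Rightarrow> 's \<Rightarrow> 'a" where "gsample t s = Gs (wmd t s) (\<xi> t s)"
definition hsample :: "nat \<Rightarrow> 's \<Rightarrow> 'a" where "hsample t s = Hs (r t s) (\<zeta> (2 * t - 1) s)"
definition ksample :: "nat \<Rightarrow> 's \<Rightarrow> 'a" where "ksample t s = Hs (w (t + 1) s) (\<zeta> (2 * t) s)"

definition gnoise :: "nat \<Rightarrow> 's \<Rightarrow> 'a" where "gnoise t s = gsample t s - G' (wmd t s)"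
definition hnoise :: "nat \<Rightarrow> 's \<Rightarrow> 'a" where "hnoise t s = hsample t s - H (r t s)"
definition knoise :: "nat \<Rightarrow> 's \<Rightarrow> 'a" where "knoise t s = ksample t s - H (w (t + 1) s)"

text \<open>The iterates start at index 1; \<open>rv 0\<close> is a dummy.\<close>

fun rv :: "nat \<Rightarrow> 's \<Rightarrow> 'a" where
  "rv 0 s = r\<^sub>1"
| "rv (Suc t) s = (if t = 0 then r\<^sub>1 else
     prox_map Z \<omega> \<omega>' (\<lambda>_. 0) (\<gamma> t) (rv t s) (- \<gamma> t *\<^sub>R (knoise t s + gnoise t s)))"

lemma Gs_measurable: "(\<lambda>(x, v). Gs x v) \<in> borel_measurable (ZZ \<Otimes>\<^sub>M N\<^sub>G)"
  and Hs_measurable: "(\<lambda>(x, v). Hs x v) \<in> borel_measurable (ZZ \<Otimes>\<^sub>M N\<^sub>H)"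
  using Gs_unbiased Hs_unbiased by (auto simp: unbiased_oracle_def)

lemma G'_measurable: "G' \<in> borel_measurable ZZ" and H_measurable: "H \<in> borel_measurable ZZ"
  by (intro borel_measurable_continuous_on_restrict G'_continuous H_continuous)+

lemma ZZ_borel: "f \<in> measurable F ZZ \<Longrightarrow> f \<in> borel_measurable F"
  by (simp add: measurable_restrict_space2_iff)

lemma prox_J_measurable:
  assumes "1 \<le> t" "X \<in> measurable F ZZ" "E\<^sub>1 \<in> borel_measurable F" "E\<^sub>2 \<in> borel_measurable F"
  shows "(\<lambda>s. prox_map Z \<omega> \<omega>' J (\<gamma> t) (X s) (\<gamma> t *\<^sub>R E\<^sub>1 s + \<gamma> t *\<^sub>R E\<^sub>2 s)) \<in> measurable F ZZ"
  using assms
  by (intro measurable_compose_pair[OF measurable_prox_map[OF J_convex prox_J \<gamma>_pos]]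
      borel_measurable_add borel_measurable_scaleR borel_measurable_const) auto

text \<open>The claims follow the order in which the samples are drawn. Only \<open>r\<close> and
  \<open>wag\<close> have to be carried through the induction on \<open>t\<close>; everything else
  is recomputed within the step.\<close>

lemma measurable_substeps:
  assumes t: "1 \<le> t" and rM: "r t \<in> measurable (before t) ZZ" and wagM: "wag t \<in> measurable (before t) ZZ"
  shows "wmd t \<in> measurable (before t) ZZ"
    and "hsample t \<in> borel_measurable (midway t)" and "gsample t \<in> borel_measurable (midway t)"
    and "w (t + 1) \<in> measurable (midway t) ZZ"
    and "ksample t \<in> borel_measurable (before (t + 1))"
    and "r (t + 1) \<in> measurable (before (t + 1)) ZZ"
    and "wag (t + 1) \<in> measurable (before (t + 1)) ZZ"
proof -
  show wmdM: "wmd t \<in> measurable (before t) ZZ"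
    using measurable_convex_comb[OF wagM rM Z(3) \<alpha>_nonneg[OF t] \<alpha>_le_1[OF t]]
    by (rule measurable_cong[THEN iffD2, rotated]) (simp add: wmd[OF t])
  show hM: "hsample t \<in> borel_measurable (midway t)"
    unfolding hsample_def using t
    by (intro measurable_compose_pair[OF Hs_measurable before_midway[OF rM]])
      (auto simp: midway_def intro!: measurable_past_\<zeta>)
  show gM: "gsample t \<in> borel_measurable (midway t)"
    unfolding gsample_def using t
    by (intro measurable_compose_pair[OF Gs_measurable before_midway[OF wmdM]])
      (auto simp: midway_def intro!: measurable_past_\<xi>)
  show wM: "w (t + 1) \<in> measurable (midway t) ZZ"
    using prox_J_measurable[OF t before_midway[OF rM] hM gM]
    by (rule measurable_cong[THEN iffD2, rotated]) (simp add: w_step[OF t, simplified] hsample_def gsample_def)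
  show kM: "ksample t \<in> borel_measurable (before (t + 1))"
    unfolding ksample_def using t
    by (intro measurable_compose_pair[OF Hs_measurable midway_before[OF wM]])
      (auto simp: before_def intro!: measurable_past_\<zeta>)
  show "r (t + 1) \<in> measurable (before (t + 1)) ZZ"
    using prox_J_measurable[OF t midway_before[OF before_midway[OF rM]] kM midway_before[OF gM]]
    by (rule measurable_cong[THEN iffD2, rotated]) (simp add: r_step[OF t, simplified] ksample_def gsample_def)
  show "wag (t + 1) \<in> measurable (before (t + 1)) ZZ"
    using measurable_convex_comb[OF midway_before[OF before_midway[OF wagM]] midway_before[OF wM]
        Z(3) \<alpha>_nonneg[OF t] \<alpha>_le_1[OF t]]
    by (rule measurable_cong[THEN iffD2, rotated]) (simp add: wag_step[OF t, simplified])
qed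

lemma measurable_r_wag: "1 \<le> t \<Longrightarrow> r t \<in> measurable (before t) ZZ \<and> wag t \<in> measurable (before t) ZZ"
proof (induction t rule: nat_induct_at_least)
  case base
  have "(\<lambda>_. r\<^sub>1) \<in> measurable (before 1) ZZ" using r\<^sub>1 by simp
  then show ?case
    using r_1 wag_1 by (auto intro!: measurable_cong[THEN iffD2, of _ _ "\<lambda>_. r\<^sub>1"])
next
  case (Suc t)
  then show ?case using measurable_substeps(6,7)[of t] by simp
qed

lemmas r_measurable = measurable_r_wag[THEN conjunct1]
  and wag_measurable = measurable_r_wag[THEN conjunct2]

context
  fixes t :: nat assumes t: "1 \<le> t"
begin

lemmas substeps = measurable_substeps[OF t r_measurable[OF t] wag_measurable[OF t]]

lemma gnoise_measurable: "gnoise t \<in> borel_measurable (midway t)"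
  unfolding gnoise_def
  by (intro borel_measurable_diff substeps measurable_compose[OF before_midway[OF substeps(1)] G'_measurable])

lemma hnoise_measurable: "hnoise t \<in> borel_measurable (midway t)"
  unfolding hnoise_def
  by (intro borel_measurable_diff substeps measurable_compose[OF before_midway[OF r_measurable[OF t]] H_measurable])

lemma knoise_measurable: "knoise t \<in> borel_measurable (before (t + 1))"
  unfolding knoise_def
  by (intro borel_measurable_diff substeps measurable_compose[OF midway_before[OF substeps(4)] H_measurable])

text \<open>The input \<open>wmd t\<close> is fixed before step \<open>t\<close>, so the relevant
  past is \<open>before t\<close>. Test directions must be measurable there, which excludes
  \<open>w (t + 1)\<close> in general.\<close>

lemma gnoise_oracle: "noisy_oracle nrm M N\<^sub>G Z G' Gs (before t) (\<xi> t) (wmd t)"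
proof
  show "indep_sample (before t) N\<^sub>G (\<xi> t)"
    unfolding before_def using t by (intro indep_sample_\<xi>) auto
  show "wmd t \<in> measurable (before t) ZZ" by (rule substeps)
  show "integrable M (\<lambda>s. Gs x (\<xi> t s)) \<and> expectation (\<lambda>s. Gs x (\<xi> t s)) = G' x" if "x \<in> Z" for x
    using Gs_unbiased that t by (auto simp: unbiased_oracle_def)
qed (fact Gs_measurable G'_measurable)+

lemma hnoise_oracle: "noisy_oracle nrm M N\<^sub>H Z H Hs (before t) (\<zeta> (2 * t - 1)) (r t)"
proof
  show "indep_sample (before t) N\<^sub>H (\<zeta> (2 * t - 1))"
    unfolding before_def using t by (intro indep_sample_\<zeta>) auto
  show "r t \<in> measurable (before t) ZZ" by (rule r_measurable[OF t])
  show "integrable M (\<lambda>s. Hs x (\<zeta> (2 * t - 1) s)) \<and> expectation (\<lambda>s. Hs x (\<zeta> (2 * t - 1) s)) = H x"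
    if "x \<in> Z" for x
    using Hs_unbiased that t by (auto simp: unbiased_oracle_def)
qed (fact Hs_measurable H_measurable)+

text \<open>The input \<open>w (t + 1)\<close> already uses \<open>\<xi> t\<close> and
  \<open>\<zeta> (2 * t - 1)\<close>, so the relevant past is \<open>midway t\<close>, which stops
  just short of \<open>\<zeta> (2 * t)\<close>.\<close>

lemma knoise_oracle: "noisy_oracle nrm M N\<^sub>H Z H Hs (midway t) (\<zeta> (2 * t)) (w (t + 1))"
proof
  show "indep_sample (midway t) N\<^sub>H (\<zeta> (2 * t))"
    unfolding midway_def using t by (intro indep_sample_\<zeta>) auto
  show "w (t + 1) \<in> measurable (midway t) ZZ" by (rule substeps)
  show "integrable M (\<lambda>s. Hs x (\<zeta> (2 * t) s)) \<and> expectation (\<lambda>s. Hs x (\<zeta> (2 * t) s)) = H x"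
    if "x \<in> Z" for x
    using Hs_unbiased that t by (auto simp: unbiased_oracle_def)
qed (fact Hs_measurable H_measurable)+

end

lemma rv_measurable: "1 \<le> t \<Longrightarrow> rv t \<in> measurable (before t) ZZ"
proof (induction t rule: nat_induct_at_least)
  case base
  show ?case using r\<^sub>1 by simp
next
  case (Suc t)
  have "(\<lambda>s. prox_map Z \<omega> \<omega>' (\<lambda>_. 0) (\<gamma> t) (rv t s) (- \<gamma> t *\<^sub>R (knoise t s + gnoise t s)))
      \<in> measurable (before (t + 1)) ZZ"
    using Suc knoise_measurable midway_before[OF gnoise_measurable] midway_before[OF before_midway]
    by (intro measurable_compose_pair[OF measurable_prox_map[OF zero_convex prox_zero \<gamma>_pos]]
        borel_measurable_add borel_measurable_scaleR borel_measurable_const) auto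
  with Suc.hyps show ?case by simp
qed

text \<open>Membership is read off from measurability, because the target space of the iterates is
  \<open>Z\<close> itself.\<close>

lemma in_Z:
  assumes "1 \<le> t" "s \<in> space M"
  shows "r t s \<in> Z" "wag t s \<in> Z" "rv t s \<in> Z" "w (t + 1) s \<in> Z"
  using assms measurable_space[OF r_measurable, of t s] measurable_space[OF wag_measurable, of t s]
    measurable_space[OF rv_measurable, of t s] measurable_space[OF substeps(4), of t s]
  by simp_all

end

section \<open>Bounds on the gap\<close>

context amp_run
begin

definition kappa :: real where "kappa = 1 + 1 / (2 * (1 - q))"

definition weight :: "nat \<Rightarrow> real" where "weight i = \<alpha> i * \<gamma> i / (\<mu> * \<Gamma> i)"

definition square_noise :: "nat \<Rightarrow> 's \<Rightarrow> real" where
  "square_noise t s = 3 / 2 * (dual (hnoise t s))\<^sup>2 + 5 / 2 * (dual (knoise t s))\<^sup>2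
    + kappa * (dual (gnoise t s))\<^sup>2"

text \<open>Martingale increments, up to weights: \<open>kmart\<close> and \<open>gmart\<close> pair
  each error with a difference of points known before its sample. For \<open>gnoise\<close> this
  forces \<open>r t\<close> in place of \<open>w (t + 1)\<close>.\<close>

definition kmart :: "nat \<Rightarrow> 's \<Rightarrow> real" where "kmart t s = knoise t s \<bullet> (w (t + 1) s - rv t s)"
definition gmart :: "nat \<Rightarrow> 's \<Rightarrow> real" where "gmart t s = gnoise t s \<bullet> (r t s - rv t s)"

lemma weight_nonneg: "1 \<le> i \<Longrightarrow> 0 \<le> weight i"
  using \<alpha>_nonneg[of i] \<gamma>_pos[of i] \<Gamma>_pos[of i] \<mu> by (simp add: weight_def)

lemma kappa_pos: "0 < kappa"
  using q by (simp add: kappa_def add_pos_pos)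

lemma Q_one_step:
  assumes t: "1 \<le> t" and s: "s \<in> space M" and u: "u \<in> Z"
  shows "Q (wag (t + 1) s) u \<le> (1 - \<alpha> t) * Q (wag t s) u
    + \<alpha> t / \<gamma> t * (V (r t s) u + V (rv t s) u - (V (r (t + 1) s) u + V (rv (t + 1) s) u))
    + \<alpha> t * \<gamma> t / \<mu> * square_noise t s - \<alpha> t * (kmart t s + gmart t s)"
proof -
  have rv_Suc: "rv (t + 1) s = prox_map Z \<omega> \<omega>' (\<lambda>_. 0) (\<gamma> t) (rv t s)
      (- \<gamma> t *\<^sub>R ((ksample t s - H (w (t + 1) s)) + (gsample t s - G' (wmd t s))))"
    using t by (simp add: knoise_def gnoise_def)
  show ?thesis
    unfolding square_noise_def kappa_def kmart_def gmart_def hnoise_def knoise_def gnoise_def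
      wag_step[OF t s]
    by (rule Q_step[OF in_Z(1,2,3)[OF t s] u \<gamma>_pos[OF t] \<alpha>_nonneg[OF t] \<alpha>_le_1[OF t] q stepsize[OF t]
        w_step[OF t s, folded hsample_def gsample_def] r_step[OF t s, folded ksample_def gsample_def]
        wmd[OF t s] rv_Suc])
qed

text \<open>As the weights \<open>\<alpha> t / (\<Gamma> t * \<gamma> t)\<close> increase, summation by parts leaves only the last of them.\<close>

lemma Q_telescoped:
  assumes t: "1 \<le> t" and s: "s \<in> space M" and u: "u \<in> Z"
  shows "Q (wag (t + 1) s) u / \<Gamma> t
    \<le> \<alpha> t / (\<Gamma> t * \<gamma> t) * (2 * \<Omega>\<^sup>2 - (V (r (t + 1) s) u + V (rv (t + 1) s) u))
      + (\<Sum>i=1..t. weight i * square_noise i s) - (\<Sum>i=1..t. \<alpha> i / \<Gamma> i * (kmart i s + gmart i s))"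
  using t
proof (induction t rule: nat_induct_at_least)
  case base
  let ?U = "\<lambda>t. V (r t s) u + V (rv t s) u"
  have "?U 1 \<le> 2 * \<Omega>\<^sup>2"
    using \<Omega>(2)[OF in_Z(1)[OF order.refl s] u] \<Omega>(2)[OF in_Z(3)[OF order.refl s] u] by simp
  then have "1 / \<gamma> 1 * (?U 1 - ?U 2) \<le> 1 / \<gamma> 1 * (2 * \<Omega>\<^sup>2 - ?U 2)"
    using \<gamma>_pos[of 1] by (intro mult_left_mono) auto
  with Q_one_step[OF order.refl s u] show ?case
    using \<alpha>_1 \<Gamma>_1 by (simp add: weight_def numeral_2_eq_2)
next
  case (Suc t)
  let ?U = "\<lambda>t. V (r t s) u + V (rv t s) u"
  let ?\<beta> = "\<lambda>t. \<alpha> t / (\<Gamma> t * \<gamma> t)"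
  let ?n = "Suc t"
  have n: "1 \<le> ?n" by simp
  note pos = \<Gamma>_pos[OF n] \<gamma>_pos[OF n]
  \<comment> \<open>The purpose of \<Gamma>: division by it turns the contraction factor into a
    telescoping sum.\<close>
  have "(1 - \<alpha> ?n) / \<Gamma> ?n = 1 / \<Gamma> t"
    using \<Gamma>_step[of ?n] Suc.hyps \<alpha>_bounds[of ?n] by simp
  then have 1: "(1 - \<alpha> ?n) * Q (wag ?n s) u / \<Gamma> ?n = Q (wag (t + 1) s) u / \<Gamma> t"
    by (metis Suc_eq_plus1 times_divide_eq_left mult.left_neutral)
  have "Q (wag (?n + 1) s) u / \<Gamma> ?n \<le> ((1 - \<alpha> ?n) * Q (wag ?n s) u
    + \<alpha> ?n / \<gamma> ?n * (?U ?n - ?U (?n + 1))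
    + \<alpha> ?n * \<gamma> ?n / \<mu> * square_noise ?n s - \<alpha> ?n * (kmart ?n s + gmart ?n s)) / \<Gamma> ?n"
    using Q_one_step[OF n s u] pos by (intro divide_right_mono) auto
  also have "\<dots> = Q (wag (t + 1) s) u / \<Gamma> t + ?\<beta> ?n * (?U ?n - ?U (?n + 1))
      + weight ?n * square_noise ?n s - \<alpha> ?n / \<Gamma> ?n * (kmart ?n s + gmart ?n s)"
    unfolding add_divide_distrib diff_divide_distrib 1 by (simp add: weight_def mult.commute)
  finally have 2: "Q (wag (?n + 1) s) u / \<Gamma> ?n \<le> Q (wag (t + 1) s) u / \<Gamma> t + ?\<beta> ?n * (?U ?n - ?U (?n + 1))
      + weight ?n * square_noise ?n s - \<alpha> ?n / \<Gamma> ?n * (kmart ?n s + gmart ?n s)" .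
  \<comment> \<open>The induction hypothesis keeps the Bregman terms in the form
    \<open>2 * \<Omega>\<^sup>2 - ?U ?n\<close>. As this is nonnegative, its weight may be raised to
    the next one, and then the terms at \<open>?n\<close> cancel.\<close>
  have "?U ?n \<le> 2 * \<Omega>\<^sup>2"
    using \<Omega>(2)[OF in_Z(1)[OF n s] u] \<Omega>(2)[OF in_Z(3)[OF n s] u] by simp
  then have "?\<beta> t * (2 * \<Omega>\<^sup>2 - ?U ?n) \<le> ?\<beta> ?n * (2 * \<Omega>\<^sup>2 - ?U ?n)"
    using weights_mono[OF Suc.hyps] by (intro mult_right_mono) auto
  then have 3: "?\<beta> t * (2 * \<Omega>\<^sup>2 - ?U ?n) + ?\<beta> ?n * (?U ?n - ?U (?n + 1)) \<le> ?\<beta> ?n * (2 * \<Omega>\<^sup>2 - ?U (?n + 1))"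
    by (simp only: right_diff_distrib)
  have split: "(\<Sum>i=1..?n. f i) = (\<Sum>i=1..t. f i) + f ?n" for f :: "nat \<Rightarrow> real" by simp
  show ?case
    using 2 3 Suc.IH unfolding split[unfolded Suc_eq_plus1] Suc_eq_plus1 by linarith
qed

lemma gap_bound:
  assumes t: "1 \<le> t" and s: "s \<in> space M"
  shows "gap (wag (t + 1) s) \<le> 2 * \<alpha> t / \<gamma> t * \<Omega>\<^sup>2
    + \<Gamma> t * (\<Sum>i=1..t. weight i * square_noise i s)
    - \<Gamma> t * (\<Sum>i=1..t. \<alpha> i / \<Gamma> i * (kmart i s + gmart i s))"
proof (rule gap_leI)
  fix u assume u: "u \<in> Z"
  let ?A = "\<Sum>i=1..t. weight i * square_noise i s"
  let ?B = "\<Sum>i=1..t. \<alpha> i / \<Gamma> i * (kmart i s + gmart i s)"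
  let ?U = "V (r (t + 1) s) u + V (rv (t + 1) s) u"
  have t1: "1 \<le> t + 1" by simp
  have \<Gamma>: "0 < \<Gamma> t" by (rule \<Gamma>_pos[OF t])
  have "0 \<le> ?U"
    using prox_fun_nonneg[OF in_Z(1)[OF t1 s] u] prox_fun_nonneg[OF in_Z(3)[OF t1 s] u] by simp
  then have "\<alpha> t / (\<Gamma> t * \<gamma> t) * (2 * \<Omega>\<^sup>2 - ?U) \<le> \<alpha> t / (\<Gamma> t * \<gamma> t) * (2 * \<Omega>\<^sup>2)"
    using \<Gamma> \<gamma>_pos[OF t] \<alpha>_nonneg[OF t] by (intro mult_left_mono) auto
  then have "Q (wag (t + 1) s) u / \<Gamma> t \<le> \<alpha> t / (\<Gamma> t * \<gamma> t) * (2 * \<Omega>\<^sup>2) + ?A - ?B"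
    using Q_telescoped[OF t s u] by linarith
  then have "Q (wag (t + 1) s) u \<le> (\<alpha> t / (\<Gamma> t * \<gamma> t) * (2 * \<Omega>\<^sup>2) + ?A - ?B) * \<Gamma> t"
    using \<Gamma> by (simp add: pos_divide_le_eq)
  also have "\<dots> = 2 * \<alpha> t / \<gamma> t * \<Omega>\<^sup>2 + \<Gamma> t * ?A - \<Gamma> t * ?B"
    using \<Gamma> by (simp add: distrib_left right_diff_distrib mult.commute[of _ "\<Gamma> t"])
  finally show "Q (wag (t + 1) s) u \<le> 2 * \<alpha> t / \<gamma> t * \<Omega>\<^sup>2 + \<Gamma> t * ?A - \<Gamma> t * ?B" .
qed

lemma gap_measurable: "1 \<le> t \<Longrightarrow> (\<lambda>s. gap (wag t s)) \<in> borel_measurable M"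
  by (rule measurable_lsc_compose[OF before_measurable[OF wag_measurable] gap_superlevel_open])

lemmas noise_measurable_M [measurable] =
  midway_measurable[OF gnoise_measurable] midway_measurable[OF hnoise_measurable]
  before_measurable[OF knoise_measurable]

lemma kdiff_measurable: "1 \<le> t \<Longrightarrow> (\<lambda>s. w (t + 1) s - rv t s) \<in> borel_measurable (midway t)"
  by (intro borel_measurable_diff ZZ_borel substeps before_midway rv_measurable)

lemma gdiff_measurable: "1 \<le> t \<Longrightarrow> (\<lambda>s. r t s - rv t s) \<in> borel_measurable (before t)"
  by (intro borel_measurable_diff ZZ_borel r_measurable rv_measurable)

lemma kmart_measurable: "1 \<le> t \<Longrightarrow> kmart t \<in> borel_measurable (before (t + 1))"
  unfolding kmart_def by (intro borel_measurable_inner knoise_measurable midway_before kdiff_measurable)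

lemma gmart_measurable: "1 \<le> t \<Longrightarrow> gmart t \<in> borel_measurable (before (t + 1))"
  unfolding gmart_def
  by (intro borel_measurable_inner midway_before gnoise_measurable before_midway gdiff_measurable)

lemma sum_mart_measurable:
  assumes "\<And>i. 1 \<le> i \<Longrightarrow> X i \<in> borel_measurable (before (i + 1))"
  shows "(\<lambda>s. \<Sum>i=1..<t. a i * X i s :: real) \<in> borel_measurable (before t)"
  by (intro borel_measurable_sum borel_measurable_times borel_measurable_const before_mono[OF _ assms]) auto

lemma kdiff_le: "1 \<le> t \<Longrightarrow> s \<in> space M \<Longrightarrow> nrm (w (t + 1) s - rv t s) \<le> diam"
  by (intro nrm_le_diam in_Z)

lemma gdiff_le: "1 \<le> t \<Longrightarrow> s \<in> space M \<Longrightarrow> nrm (r t s - rv t s) \<le> diam"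
  by (intro nrm_le_diam in_Z)

lemma amp_noise_eq:
  "amp_noise \<alpha> \<gamma> \<Gamma> \<mu> q \<sigma>\<^sub>G \<sigma>\<^sub>H t = (4 * \<sigma>\<^sub>H\<^sup>2 + kappa * \<sigma>\<^sub>G\<^sup>2) * \<Gamma> t * (\<Sum>i=1..t. weight i)"
  by (simp add: amp_noise_def kappa_def weight_def)

section \<open>Bounded variance and the expected gap\<close>

lemma bounded_variance_moment:
  assumes "bounded_variance M nrm Z F Fs \<eta> \<sigma>" "x \<in> Z" "1 \<le> i"
  shows "integrable M (\<lambda>s. (dual (Fs x (\<eta> i s) - F x))\<^sup>2)
    \<and> expectation (\<lambda>s. (dual (Fs x (\<eta> i s) - F x))\<^sup>2) \<le> \<sigma>\<^sup>2"
  using assms unfolding bounded_variance_def by blast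

lemma noise_moment:
  assumes t: "1 \<le> t" and G: "bounded_variance M nrm Z G' Gs \<xi> \<sigma>\<^sub>G" and H: "bounded_variance M nrm Z H Hs \<zeta> \<sigma>\<^sub>H"
  shows "integrable M (\<lambda>s. (dual (gnoise t s))\<^sup>2)" "expectation (\<lambda>s. (dual (gnoise t s))\<^sup>2) \<le> \<sigma>\<^sub>G\<^sup>2"
    and "integrable M (\<lambda>s. (dual (hnoise t s))\<^sup>2)" "expectation (\<lambda>s. (dual (hnoise t s))\<^sup>2) \<le> \<sigma>\<^sub>H\<^sup>2"
    and "integrable M (\<lambda>s. (dual (knoise t s))\<^sup>2)" "expectation (\<lambda>s. (dual (knoise t s))\<^sup>2) \<le> \<sigma>\<^sub>H\<^sup>2"
proof -
  interpret g: noisy_oracle nrm M N\<^sub>G Z G' Gs "before t" "\<xi> t" "wmd t" by (rule gnoise_oracle[OF t])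
  interpret h: noisy_oracle nrm M N\<^sub>H Z H Hs "before t" "\<zeta> (2 * t - 1)" "r t" by (rule hnoise_oracle[OF t])
  interpret k: noisy_oracle nrm M N\<^sub>H Z H Hs "midway t" "\<zeta> (2 * t)" "w (t + 1)" by (rule knoise_oracle[OF t])
  show "integrable M (\<lambda>s. (dual (gnoise t s))\<^sup>2)" "expectation (\<lambda>s. (dual (gnoise t s))\<^sup>2) \<le> \<sigma>\<^sub>G\<^sup>2"
    unfolding gnoise_def gsample_def 
    by (rule g.expectation_comp_dual_noise_le[where g = "\<lambda>y. y\<^sup>2"];
      (rule bounded_variance_moment[OF G])?; use t in simp)+
  show "integrable M (\<lambda>s. (dual (hnoise t s))\<^sup>2)" "expectation (\<lambda>s. (dual (hnoise t s))\<^sup>2) \<le> \<sigma>\<^sub>H\<^sup>2"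
    unfolding hnoise_def hsample_def 
    by (rule h.expectation_comp_dual_noise_le[where g = "\<lambda>y. y\<^sup>2"];
      (rule bounded_variance_moment[OF H])?; use t in simp)+
  show "integrable M (\<lambda>s. (dual (knoise t s))\<^sup>2)" "expectation (\<lambda>s. (dual (knoise t s))\<^sup>2) \<le> \<sigma>\<^sub>H\<^sup>2"
    unfolding knoise_def ksample_def 
    by (rule k.expectation_comp_dual_noise_le[where g = "\<lambda>y. y\<^sup>2"];
      (rule bounded_variance_moment[OF H])?; use t in simp)+
qed

lemma mart_mean_zero:
  assumes t: "1 \<le> t" and G: "bounded_variance M nrm Z G' Gs \<xi> \<sigma>\<^sub>G" and H: "bounded_variance M nrm Z H Hs \<zeta> \<sigma>\<^sub>H"
  shows "integrable M (gmart t)" "expectation (gmart t) = 0"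
    and "integrable M (kmart t)" "expectation (kmart t) = 0"
proof -
  interpret g: noisy_oracle nrm M N\<^sub>G Z G' Gs "before t" "\<xi> t" "wmd t" by (rule gnoise_oracle[OF t])
  interpret k: noisy_oracle nrm M N\<^sub>H Z H Hs "midway t" "\<zeta> (2 * t)" "w (t + 1)" by (rule knoise_oracle[OF t])
  show "integrable M (gmart t)" "expectation (gmart t) = 0"
    unfolding gmart_def gnoise_def gsample_def
    using g.noise_inner_mean_zero[OF gdiff_measurable[OF t] gdiff_le[OF t]] noise_moment(1)[OF t G H]
    by (auto simp: gnoise_def gsample_def)
  show "integrable M (kmart t)" "expectation (kmart t) = 0"
    unfolding kmart_def knoise_def ksample_def
    using k.noise_inner_mean_zero[OF kdiff_measurable[OF t] kdiff_le[OF t]] noise_moment(5)[OF t G H]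
    by (auto simp: knoise_def ksample_def)
qed

lemma expected_gap:
  assumes t: "1 \<le> t" and G: "bounded_variance M nrm Z G' Gs \<xi> \<sigma>\<^sub>G" and H: "bounded_variance M nrm Z H Hs \<zeta> \<sigma>\<^sub>H"
  shows "integrable M (\<lambda>s. gap (wag (t + 1) s))"
    and "expectation (\<lambda>s. gap (wag (t + 1) s)) \<le> amp_Q0 \<alpha> \<gamma> \<Gamma> \<mu> q \<sigma>\<^sub>G \<sigma>\<^sub>H \<Omega> t"
proof -
  let ?R = "\<lambda>s. 2 * \<alpha> t / \<gamma> t * \<Omega>\<^sup>2 + \<Gamma> t * (\<Sum>i=1..t. weight i * square_noise i s)
    - \<Gamma> t * (\<Sum>i=1..t. \<alpha> i / \<Gamma> i * (kmart i s + gmart i s))"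
  note mom = noise_moment[OF _ G H] and mart = mart_mean_zero[OF _ G H]
  have sq: "integrable M (square_noise i)" "expectation (square_noise i) \<le> 4 * \<sigma>\<^sub>H\<^sup>2 + kappa * \<sigma>\<^sub>G\<^sup>2"
    if i: "1 \<le> i" for i
  proof -
    show "integrable M (square_noise i)"
      unfolding square_noise_def using mom[OF i] by simp
    have "expectation (square_noise i) = 3 / 2 * expectation (\<lambda>s. (dual (hnoise i s))\<^sup>2)
      + 5 / 2 * expectation (\<lambda>s. (dual (knoise i s))\<^sup>2) + kappa * expectation (\<lambda>s. (dual (gnoise i s))\<^sup>2)"
      unfolding square_noise_def using mom(1,3,5)[OF i] by simp
    also have "\<dots> \<le> 3 / 2 * \<sigma>\<^sub>H\<^sup>2 + 5 / 2 * \<sigma>\<^sub>H\<^sup>2 + kappa * \<sigma>\<^sub>G\<^sup>2"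
      using mom(2,4,6)[OF i] kappa_pos by (intro add_mono mult_left_mono) auto
    finally show "expectation (square_noise i) \<le> 4 * \<sigma>\<^sub>H\<^sup>2 + kappa * \<sigma>\<^sub>G\<^sup>2" by simp
  qed
  have A: "integrable M (\<lambda>s. \<Sum>i=1..t. weight i * square_noise i s)"
    using sq(1) by auto
  have B: "integrable M (\<lambda>s. \<Sum>i=1..t. \<alpha> i / \<Gamma> i * (kmart i s + gmart i s))"
    using mart(1,3) by (auto intro!: Bochner_Integration.integrable_sum integrable_mult_right)
  have R: "integrable M ?R"
    using A B by (intro Bochner_Integration.integrable_diff Bochner_Integration.integrable_add integrable_mult_right) simp
  have nonneg: "0 \<le> gap (wag (t + 1) s)" if "s \<in> space M" for s
    using that by (intro gap_nonneg in_Z) simp_all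
  \<comment> \<open>Pointwise the gap lies between 0 and the integrable right-hand side
    \<open>?R\<close>.\<close>
  show int: "integrable M (\<lambda>s. gap (wag (t + 1) s))"
  proof (rule Bochner_Integration.integrable_bound[OF R])
    show "(\<lambda>s. gap (wag (t + 1) s)) \<in> borel_measurable M" by (rule gap_measurable) simp
    show "AE s in M. norm (gap (wag (t + 1) s)) \<le> norm (?R s)"
    proof (rule AE_I2)
      fix s assume "s \<in> space M"
      from nonneg[OF this] gap_bound[OF t this] show "norm (gap (wag (t + 1) s)) \<le> norm (?R s)"
        unfolding real_norm_def by linarith
    qed
  qed
  have "expectation (\<lambda>s. gap (wag (t + 1) s)) \<le> expectation ?R"
    using int R gap_bound[OF t] by (rule integral_mono)
  also have "expectation ?R = 2 * \<alpha> t / \<gamma> t * \<Omega>\<^sup>2 + \<Gamma> t * (\<Sum>i=1..t. weight i * expectation (square_noise i))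
    - \<Gamma> t * expectation (\<lambda>s. \<Sum>i=1..t. \<alpha> i / \<Gamma> i * (kmart i s + gmart i s))"
    using A B sq(1) by (simp add: prob_space)
  also have "expectation (\<lambda>s. \<Sum>i=1..t. \<alpha> i / \<Gamma> i * (kmart i s + gmart i s)) = 0"
  proof -
    have "expectation (\<lambda>s. \<Sum>i=1..t. \<alpha> i / \<Gamma> i * (kmart i s + gmart i s))
        = (\<Sum>i=1..t. \<alpha> i / \<Gamma> i * expectation (\<lambda>s. kmart i s + gmart i s))"
      using mart(1,3) by (subst Bochner_Integration.integral_sum) auto
    also have "\<dots> = 0"
      using mart by (intro sum.neutral) (simp add: Bochner_Integration.integral_add)
    finally show ?thesis .
  qed
  also have "2 * \<alpha> t / \<gamma> t * \<Omega>\<^sup>2 + \<Gamma> t * (\<Sum>i=1..t. weight i * expectation (square_noise i)) - \<Gamma> t * 0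
      \<le> 2 * \<alpha> t / \<gamma> t * \<Omega>\<^sup>2 + \<Gamma> t * (\<Sum>i=1..t. weight i * (4 * \<sigma>\<^sub>H\<^sup>2 + kappa * \<sigma>\<^sub>G\<^sup>2)) - \<Gamma> t * 0"
    using \<Gamma>_pos[OF t] weight_nonneg sq(2)
    by (intro add_mono diff_mono mult_left_mono sum_mono order.refl) auto
  also have "\<dots> = amp_Q0 \<alpha> \<gamma> \<Gamma> \<mu> q \<sigma>\<^sub>G \<sigma>\<^sub>H \<Omega> t"
    by (simp add: amp_Q0_def amp_noise_eq flip: sum_distrib_right)
  finally show "expectation (\<lambda>s. gap (wag (t + 1) s)) \<le> amp_Q0 \<alpha> \<gamma> \<Gamma> \<mu> q \<sigma>\<^sub>G \<sigma>\<^sub>H \<Omega> t" .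
qed

section \<open>Light tails and the probability of a large gap\<close>

lemma light_tail_moment:
  assumes "light_tail M nrm Z F Fs \<eta> \<sigma>" "x \<in> Z" "1 \<le> i"
  shows "integrable M (\<lambda>s. exp ((dual (Fs x (\<eta> i s) - F x))\<^sup>2 / \<sigma>\<^sup>2))
    \<and> expectation (\<lambda>s. exp ((dual (Fs x (\<eta> i s) - F x))\<^sup>2 / \<sigma>\<^sup>2)) \<le> exp 1"
  using assms unfolding light_tail_def dual_minus_commute[of "Fs x _"] by blast

lemma noise_exp_moment:
  assumes t: "1 \<le> t" and G: "light_tail M nrm Z G' Gs \<xi> \<sigma>\<^sub>G" and H: "light_tail M nrm Z H Hs \<zeta> \<sigma>\<^sub>H"
  shows "integrable M (\<lambda>s. exp ((dual (gnoise t s))\<^sup>2 / \<sigma>\<^sub>G\<^sup>2))"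
      "expectation (\<lambda>s. exp ((dual (gnoise t s))\<^sup>2 / \<sigma>\<^sub>G\<^sup>2)) \<le> exp 1"
    and "integrable M (\<lambda>s. exp ((dual (hnoise t s))\<^sup>2 / \<sigma>\<^sub>H\<^sup>2))"
      "expectation (\<lambda>s. exp ((dual (hnoise t s))\<^sup>2 / \<sigma>\<^sub>H\<^sup>2)) \<le> exp 1"
    and "integrable M (\<lambda>s. exp ((dual (knoise t s))\<^sup>2 / \<sigma>\<^sub>H\<^sup>2))"
      "expectation (\<lambda>s. exp ((dual (knoise t s))\<^sup>2 / \<sigma>\<^sub>H\<^sup>2)) \<le> exp 1"
proof -
  interpret g: noisy_oracle nrm M N\<^sub>G Z G' Gs "before t" "\<xi> t" "wmd t" by (rule gnoise_oracle[OF t])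
  interpret h: noisy_oracle nrm M N\<^sub>H Z H Hs "before t" "\<zeta> (2 * t - 1)" "r t" by (rule hnoise_oracle[OF t])
  interpret k: noisy_oracle nrm M N\<^sub>H Z H Hs "midway t" "\<zeta> (2 * t)" "w (t + 1)" by (rule knoise_oracle[OF t])
  show "integrable M (\<lambda>s. exp ((dual (gnoise t s))\<^sup>2 / \<sigma>\<^sub>G\<^sup>2))"
      "expectation (\<lambda>s. exp ((dual (gnoise t s))\<^sup>2 / \<sigma>\<^sub>G\<^sup>2)) \<le> exp 1"
    unfolding gnoise_def gsample_def
    by (rule g.expectation_comp_dual_noise_le[where g = "\<lambda>y. exp (y\<^sup>2 / \<sigma>\<^sub>G\<^sup>2)"];
      (rule light_tail_moment[OF G])?; use t in simp)+
  show "integrable M (\<lambda>s. exp ((dual (hnoise t s))\<^sup>2 / \<sigma>\<^sub>H\<^sup>2))"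
      "expectation (\<lambda>s. exp ((dual (hnoise t s))\<^sup>2 / \<sigma>\<^sub>H\<^sup>2)) \<le> exp 1"
    unfolding hnoise_def hsample_def
    by (rule h.expectation_comp_dual_noise_le[where g = "\<lambda>y. exp (y\<^sup>2 / \<sigma>\<^sub>H\<^sup>2)"];
      (rule light_tail_moment[OF H])?; use t in simp)+
  show "integrable M (\<lambda>s. exp ((dual (knoise t s))\<^sup>2 / \<sigma>\<^sub>H\<^sup>2))"
      "expectation (\<lambda>s. exp ((dual (knoise t s))\<^sup>2 / \<sigma>\<^sub>H\<^sup>2)) \<le> exp 1"
    unfolding knoise_def ksample_def
    by (rule k.expectation_comp_dual_noise_le[where g = "\<lambda>y. exp (y\<^sup>2 / \<sigma>\<^sub>H\<^sup>2)"];
      (rule light_tail_moment[OF H])?; use t in simp)+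
qed

lemma kmart_mgf:
  assumes H: "light_tail M nrm Z H Hs \<zeta> \<sigma>\<^sub>H"
  shows "(\<integral>\<^sup>+ s. ennreal (exp (\<theta> * (\<Sum>i=1..t. a i * kmart i s))) \<partial>M)
    \<le> ennreal (exp (3 / 4 * (\<theta> * (\<sigma>\<^sub>H * diam * sqrt (\<Sum>i=1..t. (a i)\<^sup>2)))\<^sup>2))"
proof (rule martingale_mgf)
  fix n :: nat and c :: real assume n: "1 \<le> n"
  interpret k: noisy_oracle nrm M N\<^sub>H Z H Hs "midway n" "\<zeta> (2 * n)" "w (n + 1)" by (rule knoise_oracle[OF n])
  have T: "(\<lambda>s. \<theta> * (\<Sum>i=1..<n. a i * kmart i s)) \<in> borel_measurable (midway n)"
    by (intro borel_measurable_times borel_measurable_const before_midway sum_mart_measurable kmart_measurable)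
  have \<sigma>: "0 < \<sigma>\<^sub>H" using H by (simp add: light_tail_def)
  have "1 \<le> 2 * n" using n by simp
  from k.noise_inner_mgf[OF kdiff_measurable[OF n] kdiff_le[OF n] T \<sigma> light_tail_moment[OF H _ this]]
  show "(\<integral>\<^sup>+ s. ennreal (exp (\<theta> * (\<Sum>i=1..<n. a i * kmart i s) + c * kmart n s)) \<partial>M)
    \<le> ennreal (exp (3 / 4 * (c * (\<sigma>\<^sub>H * diam))\<^sup>2)) * (\<integral>\<^sup>+ s. ennreal (exp (\<theta> * (\<Sum>i=1..<n. a i * kmart i s))) \<partial>M)"
    unfolding kmart_def[of n] knoise_def[of n] ksample_def by (simp only: mult.assoc mult.commute[of diam])
qed

lemma gmart_mgf:
  assumes G: "light_tail M nrm Z G' Gs \<xi> \<sigma>\<^sub>G"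
  shows "(\<integral>\<^sup>+ s. ennreal (exp (\<theta> * (\<Sum>i=1..t. a i * gmart i s))) \<partial>M)
    \<le> ennreal (exp (3 / 4 * (\<theta> * (\<sigma>\<^sub>G * diam * sqrt (\<Sum>i=1..t. (a i)\<^sup>2)))\<^sup>2))"
proof (rule martingale_mgf)
  fix n :: nat and c :: real assume n: "1 \<le> n"
  interpret g: noisy_oracle nrm M N\<^sub>G Z G' Gs "before n" "\<xi> n" "wmd n" by (rule gnoise_oracle[OF n])
  have T: "(\<lambda>s. \<theta> * (\<Sum>i=1..<n. a i * gmart i s)) \<in> borel_measurable (before n)"
    by (intro borel_measurable_times borel_measurable_const sum_mart_measurable gmart_measurable)
  have \<sigma>: "0 < \<sigma>\<^sub>G" using G by (simp add: light_tail_def)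
  from g.noise_inner_mgf[OF gdiff_measurable[OF n] gdiff_le[OF n] T \<sigma> light_tail_moment[OF G _ n]]
  show "(\<integral>\<^sup>+ s. ennreal (exp (\<theta> * (\<Sum>i=1..<n. a i * gmart i s) + c * gmart n s)) \<partial>M)
    \<le> ennreal (exp (3 / 4 * (c * (\<sigma>\<^sub>G * diam))\<^sup>2)) * (\<integral>\<^sup>+ s. ennreal (exp (\<theta> * (\<Sum>i=1..<n. a i * gmart i s))) \<partial>M)"
    unfolding gmart_def[of n] gnoise_def[of n] gsample_def by (simp only: mult.assoc mult.commute[of diam])
qed

text \<open>The thresholds of the five exceptional events are matched to the two constants. Outside
  them the squares contribute \<open>1 + l\<close> times the noise term, where 1 belongs to
  \<open>amp_Q0\<close> and \<open>l\<close> to \<open>amp_Q1\<close>, and the two martingales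
  contribute \<open>l\<close> times the square-root term. A union bound does the rest.\<close>

lemma gap_tail:
  assumes t: "1 \<le> t" and l: "0 < l"
    and G: "light_tail M nrm Z G' Gs \<xi> \<sigma>\<^sub>G" and H: "light_tail M nrm Z H Hs \<zeta> \<sigma>\<^sub>H"
  shows "prob {s \<in> space M. gap (wag (t + 1) s)
      > amp_Q0 \<alpha> \<gamma> \<Gamma> \<mu> q \<sigma>\<^sub>G \<sigma>\<^sub>H \<Omega> t + l * amp_Q1 \<alpha> \<gamma> \<Gamma> \<mu> q \<sigma>\<^sub>G \<sigma>\<^sub>H \<Omega> t}
    \<le> 2 * exp (- l\<^sup>2 / 3) + 3 * exp (- l)"
proof -
  have \<sigma>: "0 < \<sigma>\<^sub>G" "0 < \<sigma>\<^sub>H" using G H by (auto simp: light_tail_def)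
  define A where "A = (\<Sum>i=1..t. weight i)"
  define S where "S = sqrt (\<Sum>i=1..t. (\<alpha> i / \<Gamma> i)\<^sup>2)"
  \<comment> \<open>Later weights may vanish together with \<open>\<alpha> i\<close>; the first one
    is positive since \<open>\<alpha> 1 = \<Gamma> 1 = 1\<close>. The sum under the root in
    \<open>S\<close> is positive for the same reason.\<close>
  have "weight 1 \<le> A"
    unfolding A_def using t weight_nonneg by (intro member_le_sum) auto
  moreover have "0 < weight 1" using \<gamma>_pos[of 1] \<mu> \<alpha>_1 \<Gamma>_1 by (simp add: weight_def)
  ultimately have A: "0 < A" by linarith
  have "(\<alpha> 1 / \<Gamma> 1)\<^sup>2 \<le> (\<Sum>i=1..t. (\<alpha> i / \<Gamma> i)\<^sup>2)"
    using t by (intro member_le_sum) auto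
  then have S: "0 < S" using \<alpha>_1 \<Gamma>_1 by (simp add: S_def)
  let ?sq = "\<lambda>X c. {s \<in> space M. (\<Sum>i=1..t. weight i * (dual (X i s))\<^sup>2) > (1 + l) * c\<^sup>2 * A}"
  let ?mt = "\<lambda>X c. {s \<in> space M. - (\<Sum>i=1..t. \<alpha> i / \<Gamma> i * X i s) > l * (c * diam * S)}"
  note tails = noise_exp_moment[OF _ G H]
  have sq: "prob (?sq X c) \<le> exp (- l)" if "0 < c"
    and "\<And>i. 1 \<le> i \<Longrightarrow> X i \<in> borel_measurable M"
    and "\<And>i. 1 \<le> i \<Longrightarrow> integrable M (\<lambda>s. exp ((dual (X i s))\<^sup>2 / c\<^sup>2))"
    and "\<And>i. 1 \<le> i \<Longrightarrow> expectation (\<lambda>s. exp ((dual (X i s))\<^sup>2 / c\<^sup>2)) \<le> exp 1" for X c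
    unfolding A_def using that weight_nonneg A
    by (intro prob_weighted_sum_squares_gt) (auto simp: A_def)
  have mt: "prob (?mt X c) \<le> exp (- l\<^sup>2 / 3)" if c: "0 < c"
    and meas: "\<And>i. 1 \<le> i \<Longrightarrow> X i \<in> borel_measurable M"
    and zero: "\<And>i s. 1 \<le> i \<Longrightarrow> s \<in> space M \<Longrightarrow> diam = 0 \<Longrightarrow> X i s = 0"
    and mgf: "\<And>\<theta>. (\<integral>\<^sup>+ s. ennreal (exp (\<theta> * (\<Sum>i=1..t. \<alpha> i / \<Gamma> i * X i s))) \<partial>M)
      \<le> ennreal (exp (3 / 4 * (\<theta> * (c * diam * S))\<^sup>2))" for X c
  \<comment> \<open>Chernoff's bound needs a positive scale. With \<open>diam = 0\<close> the
    increments vanish and the event is empty.\<close>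
  proof (cases "diam = 0")
    case True
    then have "?mt X c = {}" using zero by auto
    then show ?thesis unfolding \<open>?mt X c = {}\<close> by simp
  next
    case False
    then have pos: "0 < c * diam * S" using diam_nonneg c S by simp
    show ?thesis
    proof (rule prob_gt_of_mgf[OF _ _ pos l])
      show "(\<lambda>s. - (\<Sum>i=1..t. \<alpha> i / \<Gamma> i * X i s)) \<in> borel_measurable M"
        using meas by (intro borel_measurable_uminus borel_measurable_sum borel_measurable_times) auto
      \<comment> \<open>The martingales enter the gap bound with a minus sign, so their moment bound
        is used at the negated parameter.\<close>
      show "(\<integral>\<^sup>+ s. ennreal (exp (\<theta> * - (\<Sum>i=1..t. \<alpha> i / \<Gamma> i * X i s))) \<partial>M)
        \<le> ennreal (exp (3 / 4 * (\<theta> * (c * diam * S))\<^sup>2))" for \<theta>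
        using mgf[of "- \<theta>"] by simp
    qed
  qed
  let ?B = "?sq hnoise \<sigma>\<^sub>H \<union> ?sq knoise \<sigma>\<^sub>H \<union> ?sq gnoise \<sigma>\<^sub>G \<union> (?mt kmart \<sigma>\<^sub>H \<union> ?mt gmart \<sigma>\<^sub>G)"
  have mart_M: "kmart i \<in> borel_measurable M" "gmart i \<in> borel_measurable M" if "1 \<le> i" for i
    by (rule before_measurable[OF kmart_measurable[OF that]] before_measurable[OF gmart_measurable[OF that]])+
  have sets_sq: "?sq X c \<in> events" if "\<And>i. 1 \<le> i \<Longrightarrow> X i \<in> borel_measurable M" for X c
  proof -
    have [measurable]: "\<And>i. i \<in> {1..t} \<Longrightarrow> X i \<in> borel_measurable M" using that by simp
    show ?thesis by measurable
  qed
  have sets_mt: "?mt X c \<in> events" if "\<And>i. 1 \<le> i \<Longrightarrow> X i \<in> borel_measurable M" for X c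
  proof -
    have [measurable]: "\<And>i. i \<in> {1..t} \<Longrightarrow> X i \<in> borel_measurable M" using that by simp
    show ?thesis by measurable
  qed
  have events: "?sq hnoise \<sigma>\<^sub>H \<in> events" "?sq knoise \<sigma>\<^sub>H \<in> events" "?sq gnoise \<sigma>\<^sub>G \<in> events"
    "?mt kmart \<sigma>\<^sub>H \<in> events" "?mt gmart \<sigma>\<^sub>G \<in> events"
    by (rule sets_sq sets_mt, erule noise_measurable_M mart_M)+
  have "{s \<in> space M. gap (wag (t + 1) s)
      > amp_Q0 \<alpha> \<gamma> \<Gamma> \<mu> q \<sigma>\<^sub>G \<sigma>\<^sub>H \<Omega> t + l * amp_Q1 \<alpha> \<gamma> \<Gamma> \<mu> q \<sigma>\<^sub>G \<sigma>\<^sub>H \<Omega> t} \<subseteq> ?B"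
  proof (rule subsetI, rule ccontr)
    fix s
    assume "s \<in> {s \<in> space M. gap (wag (t + 1) s)
      > amp_Q0 \<alpha> \<gamma> \<Gamma> \<mu> q \<sigma>\<^sub>G \<sigma>\<^sub>H \<Omega> t + l * amp_Q1 \<alpha> \<gamma> \<Gamma> \<mu> q \<sigma>\<^sub>G \<sigma>\<^sub>H \<Omega> t}" and "s \<notin> ?B"
    then have s: "s \<in> space M"
      and large: "amp_Q0 \<alpha> \<gamma> \<Gamma> \<mu> q \<sigma>\<^sub>G \<sigma>\<^sub>H \<Omega> t + l * amp_Q1 \<alpha> \<gamma> \<Gamma> \<mu> q \<sigma>\<^sub>G \<sigma>\<^sub>H \<Omega> t < gap (wag (t + 1) s)"
      and h: "(\<Sum>i=1..t. weight i * (dual (hnoise i s))\<^sup>2) \<le> (1 + l) * \<sigma>\<^sub>H\<^sup>2 * A"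
      and k: "(\<Sum>i=1..t. weight i * (dual (knoise i s))\<^sup>2) \<le> (1 + l) * \<sigma>\<^sub>H\<^sup>2 * A"
      and g: "(\<Sum>i=1..t. weight i * (dual (gnoise i s))\<^sup>2) \<le> (1 + l) * \<sigma>\<^sub>G\<^sup>2 * A"
      and km: "- (\<Sum>i=1..t. \<alpha> i / \<Gamma> i * kmart i s) \<le> l * (\<sigma>\<^sub>H * diam * S)"
      and gm: "- (\<Sum>i=1..t. \<alpha> i / \<Gamma> i * gmart i s) \<le> l * (\<sigma>\<^sub>G * diam * S)"
      by (auto simp: not_less)
    have "(\<Sum>i=1..t. weight i * square_noise i s) = 3 / 2 * (\<Sum>i=1..t. weight i * (dual (hnoise i s))\<^sup>2)
        + 5 / 2 * (\<Sum>i=1..t. weight i * (dual (knoise i s))\<^sup>2)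
        + kappa * (\<Sum>i=1..t. weight i * (dual (gnoise i s))\<^sup>2)"
      by (simp add: square_noise_def sum.distrib sum_distrib_left distrib_left mult.left_commute)
    also have "\<dots> \<le> 3 / 2 * ((1 + l) * \<sigma>\<^sub>H\<^sup>2 * A) + 5 / 2 * ((1 + l) * \<sigma>\<^sub>H\<^sup>2 * A) + kappa * ((1 + l) * \<sigma>\<^sub>G\<^sup>2 * A)"
      using h k g kappa_pos by (intro add_mono mult_left_mono) auto
    also have "\<dots> = (1 + l) * ((4 * \<sigma>\<^sub>H\<^sup>2 + kappa * \<sigma>\<^sub>G\<^sup>2) * A)" by (simp add: algebra_simps)
    finally have 1: "(\<Sum>i=1..t. weight i * square_noise i s) \<le> (1 + l) * ((4 * \<sigma>\<^sub>H\<^sup>2 + kappa * \<sigma>\<^sub>G\<^sup>2) * A)" .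
    have "- (\<Sum>i=1..t. \<alpha> i / \<Gamma> i * (kmart i s + gmart i s))
        = - (\<Sum>i=1..t. \<alpha> i / \<Gamma> i * kmart i s) + - (\<Sum>i=1..t. \<alpha> i / \<Gamma> i * gmart i s)"
      by (simp add: distrib_left sum.distrib)
    also have "\<dots> \<le> l * (\<sigma>\<^sub>H * diam * S) + l * (\<sigma>\<^sub>G * diam * S)" by (intro add_mono km gm)
    finally have 2: "- (\<Sum>i=1..t. \<alpha> i / \<Gamma> i * (kmart i s + gmart i s)) \<le> l * ((\<sigma>\<^sub>G + \<sigma>\<^sub>H) * diam * S)"
      by (simp add: algebra_simps)
    have "gap (wag (t + 1) s) \<le> 2 * \<alpha> t / \<gamma> t * \<Omega>\<^sup>2 + \<Gamma> t * (\<Sum>i=1..t. weight i * square_noise i s)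
        + \<Gamma> t * - (\<Sum>i=1..t. \<alpha> i / \<Gamma> i * (kmart i s + gmart i s))"
      using gap_bound[OF t s] by simp
    also have "\<dots> \<le> 2 * \<alpha> t / \<gamma> t * \<Omega>\<^sup>2 + \<Gamma> t * ((1 + l) * ((4 * \<sigma>\<^sub>H\<^sup>2 + kappa * \<sigma>\<^sub>G\<^sup>2) * A))
        + \<Gamma> t * (l * ((\<sigma>\<^sub>G + \<sigma>\<^sub>H) * diam * S))"
      using 1 2 \<Gamma>_pos[OF t] by (intro add_mono mult_left_mono order.refl) auto
    also have "\<dots> = amp_Q0 \<alpha> \<gamma> \<Gamma> \<mu> q \<sigma>\<^sub>G \<sigma>\<^sub>H \<Omega> t + l * amp_Q1 \<alpha> \<gamma> \<Gamma> \<mu> q \<sigma>\<^sub>G \<sigma>\<^sub>H \<Omega> t"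
      unfolding amp_Q0_def amp_Q1_def amp_noise_eq real_sqrt_mult diam_def S_def[symmetric] A_def[symmetric]
      by (simp add: algebra_simps)
    finally show False using large by simp
  qed
  then have "prob {s \<in> space M. gap (wag (t + 1) s)
      > amp_Q0 \<alpha> \<gamma> \<Gamma> \<mu> q \<sigma>\<^sub>G \<sigma>\<^sub>H \<Omega> t + l * amp_Q1 \<alpha> \<gamma> \<Gamma> \<mu> q \<sigma>\<^sub>G \<sigma>\<^sub>H \<Omega> t} \<le> prob ?B"
    by (intro finite_measure_mono sets.Un events)
  also have "\<dots> \<le> (prob (?sq hnoise \<sigma>\<^sub>H) + prob (?sq knoise \<sigma>\<^sub>H) + prob (?sq gnoise \<sigma>\<^sub>G))
      + (prob (?mt kmart \<sigma>\<^sub>H) + prob (?mt gmart \<sigma>\<^sub>G))"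
    using measure_Un_le[OF sets.Un[OF sets.Un[OF events(1,2)] events(3)] sets.Un[OF events(4,5)]]
      measure_Un_le[OF sets.Un[OF events(1,2)] events(3)]
      measure_Un_le[OF events(1,2)] measure_Un_le[OF events(4,5)]
    by linarith
  also have "\<dots> \<le> (exp (- l) + exp (- l) + exp (- l)) + (exp (- l\<^sup>2 / 3) + exp (- l\<^sup>2 / 3))"
  proof (intro add_mono)
    show "prob (?sq hnoise \<sigma>\<^sub>H) \<le> exp (- l)" by (intro sq \<sigma> noise_measurable_M tails)
    show "prob (?sq knoise \<sigma>\<^sub>H) \<le> exp (- l)" by (intro sq \<sigma> noise_measurable_M tails)
    show "prob (?sq gnoise \<sigma>\<^sub>G) \<le> exp (- l)" by (intro sq \<sigma> noise_measurable_M tails)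
    show "prob (?mt kmart \<sigma>\<^sub>H) \<le> exp (- l\<^sup>2 / 3)"
    proof (intro mt \<sigma> mart_M)
      show "kmart i s = 0" if "1 \<le> i" "s \<in> space M" "diam = 0" for i s
      proof -
        have "nrm (w (i + 1) s - rv i s) = 0"
          using kdiff_le[OF that(1,2)] that(3) nrm_nonneg[of "w (i + 1) s - rv i s"] by linarith
        then show ?thesis by (simp add: kmart_def)
      qed
    qed (unfold S_def, (assumption | rule kmart_mgf[OF H])+)
    show "prob (?mt gmart \<sigma>\<^sub>G) \<le> exp (- l\<^sup>2 / 3)"
    proof (intro mt \<sigma> mart_M)
      show "gmart i s = 0" if "1 \<le> i" "s \<in> space M" "diam = 0" for i s
      proof -
        have "nrm (r i s - rv i s) = 0"
          using gdiff_le[OF that(1,2)] that(3) nrm_nonneg[of "r i s - rv i s"] by linarith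
        then show ?thesis by (simp add: gmart_def)
      qed
    qed (unfold S_def, (assumption | rule gmart_mgf[OF G])+)
  qed
  finally show ?thesis by simp
qed

end

theorem theorem3p1:
  fixes nrm :: "'a::euclidean_space \<Rightarrow> real"
    and Z :: "'a set"
    and G J \<omega> :: "'a \<Rightarrow> real"
    and G' H J' \<omega>' :: "'a \<Rightarrow> 'a"
    and L\<^sub>G L\<^sub>H \<mu> q \<sigma>\<^sub>G \<sigma>\<^sub>H \<Omega> :: real
    and \<alpha> \<gamma> \<Gamma> :: "nat \<Rightarrow> real"
    and M :: "'s measure" and N\<^sub>G :: "'v measure" and N\<^sub>H :: "'w measure"
    and \<xi> :: "nat \<Rightarrow> 's \<Rightarrow> 'v" and \<zeta> :: "nat \<Rightarrow> 's \<Rightarrow> 'w"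
    and Gs :: "'a \<Rightarrow> 'v \<Rightarrow> 'a" and Hs :: "'a \<Rightarrow> 'w \<Rightarrow> 'a"
    and r\<^sub>1 :: 'a
    and w wag wmd r :: "nat \<Rightarrow> 's \<Rightarrow> 'a"
  assumes "is_norm nrm"
    and "Z \<noteq> {}" "closed Z" "convex Z"
    and "gradient_on Z G G'" "continuous_on Z G'"
    and "\<And>v w. v \<in> Z \<Longrightarrow> w \<in> Z \<Longrightarrow> 0 \<le> G w - G v - G' v \<bullet> (w - v)"
    and "\<And>v w. v \<in> Z \<Longrightarrow> w \<in> Z \<Longrightarrow>
           G w - G v - G' v \<bullet> (w - v) \<le> L\<^sub>G / 2 * (nrm (w - v))\<^sup>2"
    and "\<And>v w. v \<in> Z \<Longrightarrow> w \<in> Z \<Longrightarrow> 0 \<le> (H w - H v) \<bullet> (w - v)"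
    and "\<And>v w. v \<in> Z \<Longrightarrow> w \<in> Z \<Longrightarrow> dual_norm nrm (H w - H v) \<le> L\<^sub>H * nrm (w - v)"
    and "convex_on Z J" "\<And>u. u \<in> Z \<Longrightarrow> J' u \<in> subdifferential Z J u"
    and "0 < \<mu>" "strongly_convex_on nrm \<mu> Z \<omega>" "gradient_on Z \<omega> \<omega>'"
    and "prox_well_defined Z \<omega> \<omega>' J"
    and "prob_space M"
    and "unbiased_oracle M N\<^sub>G Z G' Gs \<xi>" "unbiased_oracle M N\<^sub>H Z H Hs \<zeta>"
    and "samples_independent M N\<^sub>G \<xi> N\<^sub>H \<zeta>"
    and "r\<^sub>1 \<in> Z"
    and "\<And>s. s \<in> space M \<Longrightarrow> r 1 s = r\<^sub>1"
    and "\<And>s. s \<in> space M \<Longrightarrow> w 1 s = r\<^sub>1"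
    and "\<And>s. s \<in> space M \<Longrightarrow> wag 1 s = r\<^sub>1"
    and "\<And>t s. 1 \<le> t \<Longrightarrow> s \<in> space M \<Longrightarrow>
           wmd t s = (1 - \<alpha> t) *\<^sub>R wag t s + \<alpha> t *\<^sub>R r t s"
    and "\<And>t s. 1 \<le> t \<Longrightarrow> s \<in> space M \<Longrightarrow>
           w (t + 1) s = prox_map Z \<omega> \<omega>' J (\<gamma> t) (r t s)
             (\<gamma> t *\<^sub>R Hs (r t s) (\<zeta> (2 * t - 1) s) + \<gamma> t *\<^sub>R Gs (wmd t s) (\<xi> t s))"
    and "\<And>t s. 1 \<le> t \<Longrightarrow> s \<in> space M \<Longrightarrow>
           r (t + 1) s = prox_map Z \<omega> \<omega>' J (\<gamma> t) (r t s)
             (\<gamma> t *\<^sub>R Hs (w (t + 1) s) (\<zeta> (2 * t) s) + \<gamma> t *\<^sub>R Gs (wmd t s) (\<xi> t s))"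
    and "\<And>t s. 1 \<le> t \<Longrightarrow> s \<in> space M \<Longrightarrow>
           wag (t + 1) s = (1 - \<alpha> t) *\<^sub>R wag t s + \<alpha> t *\<^sub>R w (t + 1) s"
    and "0 \<le> \<Omega>" "\<And>z\<^sub>1 z\<^sub>2. z\<^sub>1 \<in> Z \<Longrightarrow> z\<^sub>2 \<in> Z \<Longrightarrow> prox_fun \<omega> \<omega>' z\<^sub>1 z\<^sub>2 \<le> \<Omega>\<^sup>2"
    and "\<And>t. 1 \<le> t \<Longrightarrow> 0 < \<gamma> t"
    and "\<alpha> 1 = 1" "\<And>t. 1 < t \<Longrightarrow> 0 \<le> \<alpha> t \<and> \<alpha> t < 1"
    and "\<Gamma> 1 = 1" "\<And>t. 1 < t \<Longrightarrow> \<Gamma> t = (1 - \<alpha> t) * \<Gamma> (t - 1)"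
    and "0 < q" "q < 1"
    and "\<And>t. 1 \<le> t \<Longrightarrow> 0 \<le> q * \<mu> - L\<^sub>G * \<alpha> t * \<gamma> t - 3 * L\<^sub>H\<^sup>2 * (\<gamma> t)\<^sup>2 / \<mu>"
    and "\<And>t. 1 \<le> t \<Longrightarrow> \<alpha> t / (\<Gamma> t * \<gamma> t) \<le> \<alpha> (t + 1) / (\<Gamma> (t + 1) * \<gamma> (t + 1))"
  shows
    "(bounded_variance M nrm Z G' Gs \<xi> \<sigma>\<^sub>G \<and> bounded_variance M nrm Z H Hs \<zeta> \<sigma>\<^sub>H \<longrightarrow>
       (\<forall>t\<ge>1.
          integrable M (\<lambda>s. gap_fun Z G H J (wag (t + 1) s)) \<and>
          (\<integral>s. gap_fun Z G H J (wag (t + 1) s) \<partial>M) \<le> amp_Q0 \<alpha> \<gamma> \<Gamma> \<mu> q \<sigma>\<^sub>G \<sigma>\<^sub>H \<Omega> t))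
     \<and>
     (light_tail M nrm Z G' Gs \<xi> \<sigma>\<^sub>G \<and> light_tail M nrm Z H Hs \<zeta> \<sigma>\<^sub>H \<longrightarrow>
       (\<forall>l>0. \<forall>t\<ge>1.
          (\<lambda>s. gap_fun Z G H J (wag (t + 1) s)) \<in> borel_measurable M \<and>
          measure M {s \<in> space M. gap_fun Z G H J (wag (t + 1) s)
              > amp_Q0 \<alpha> \<gamma> \<Gamma> \<mu> q \<sigma>\<^sub>G \<sigma>\<^sub>H \<Omega> t + l * amp_Q1 \<alpha> \<gamma> \<Gamma> \<mu> q \<sigma>\<^sub>G \<sigma>\<^sub>H \<Omega> t}
            \<le> 2 * exp (- l\<^sup>2 / 3) + 3 * exp (- l)))"
proof -
  interpret amp_run nrm Z \<omega> \<omega>' \<mu> G J G' H J' L\<^sub>G L\<^sub>H \<Omega> M N\<^sub>G \<xi> N\<^sub>H \<zeta> Gs Hs r\<^sub>1 w wag wmd r \<alpha> \<gamma> \<Gamma> q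
  proof (intro amp_run.intro amp_problem.intro prox_setup.intro sampling.intro)
    show "vec_norm nrm" using assms(1) by (rule vec_norm.intro)
    show "prox_setup_axioms nrm Z \<omega> \<omega>' \<mu>" by (rule prox_setup_axioms.intro) (fact assms)+
    show "amp_problem_axioms nrm Z \<omega> \<omega>' G J G' H J' L\<^sub>G L\<^sub>H \<Omega>"
      by (rule amp_problem_axioms.intro) (fact assms)+
    show "prob_space M" by fact
    show "sampling_axioms M N\<^sub>G \<xi> N\<^sub>H \<zeta>"
      using assms(18,19,20) by (intro sampling_axioms.intro) (auto simp: unbiased_oracle_def)
    show "amp_run_axioms Z \<omega> \<omega>' \<mu> J G' H L\<^sub>G L\<^sub>H M N\<^sub>G \<xi> N\<^sub>H \<zeta> Gs Hs r\<^sub>1 w wag wmd r \<alpha> \<gamma> \<Gamma> q"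
      by (rule amp_run_axioms.intro) (fact assms)+
  qed
  show ?thesis
    by (intro conjI impI allI expected_gap gap_tail gap_measurable) auto
qed

end
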